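(* Let $k$ be a commutative ring and let $H$ be a comonoidal $k$-prebialgebra (satisfying (lc) and (rc)). Then the forgetful functor $U:\mathcal{M}^H\to{}_k\mathcal{M}$ from the monoidal category $(\mathcal{M}^H,\otimes^r,H_s)$ of right $H$-comodules to the monoidal category of $k$-modules is monoidal and opmonoidal (with the structure maps given in the context). If moreover any of (rm) and (lm) holds, then $U$ is essentially strong monoidal and essentially strong opmonoidal.
   Context: Conventions. $k$ is a commutative ring and $\otimes=\otimes_k$. A $k$-prebialgebra is a $k$-module $H$ that is both an associative unital $k$-algebra (unit $1$) and a coassociative counital $k$-coalgebra (comultiplication $\Delta$, counit $\varepsilon$) such that $\Delta(hk)=\Delta(h)\Delta(k)$ for all $h,k\in H$; it is not required that $\Delta(1)=1\otimes 1$ nor that $\varepsilon$ is multiplicative. Sweedler notation: $\Delta(h)=h_{(1)}\otimes h_{(2)}$, $\Delta(1)=1_{(1)}\otimes 1_{(2)}=1_{(1')}\otimes 1_{(2')}$, $\Delta^2=(\Delta\otimes H)\circ\Delta$; right coactions are written $m\mapsto m_{[0]}\otimes m_{[1]}$. Axioms (for all $h,k,l\in H$): (lm) $\varepsilon(hkl)=\varepsilon(hk_{(1)})\varepsilon(k_{(2)}l)$; (rm) $\varepsilon(hkl)=\varepsilon(hk_{(2)})\varepsilon(k_{(1)}l)$; (lc) $\Delta^2(1)=1_{(1)}\otimes 1_{(2)}1_{(1')}\otimes 1_{(2')}$; (rc) $\Delta^2(1)=1_{(1)}\otimes 1_{(1')}1_{(2)}\otimes 1_{(2')}$. Monoidal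 structure on $\mathcal{M}^H$ (for $H$ satisfying (lc) and (rc)). The unit object is $H_s=\mathrm{Im}(\varepsilon_s)$, $\varepsilon_s(h)=\langle\varepsilon,h1_{(2)}\rangle 1_{(1)}$, a right $H$-comodule via $\Delta$ (indeed $\Delta(H_s)\subset H_s\otimes H$); note $1\in H_s$. For right $H$-comodules $M,N$ let $\pi:M\otimes N\to M\otimes N$, $\pi(m\otimes n)=\langle\varepsilon,m_{[1]}n_{[1]}\rangle m_{[0]}\otimes n_{[0]}$, and $M\otimes^r N=\mathrm{Im}(\pi)$ with coaction $m\otimes n\mapsto m_{[0]}\otimes n_{[0]}\otimes m_{[1]}n_{[1]}$. The associativity constraint is induced by that of $k$-modules; the unit constraints are the restrictions to $H_s\otimes^r M$ and $M\otimes^r H_s$ of $y\otimes m\mapsto\langle\varepsilon,ym_{[1]}\rangle m_{[0]}$ and $m\otimes y\mapsto\langle\varepsilon,m_{[1]}y\rangle m_{[0]}$. Structure maps of $U$. Monoidal structure: $M\otimes N\to M\otimes^r N$ given by $\pi$, and $k\to H_s$, $x\mapsto x1$. Opmonoidal structure: the inclusion $M\otimes^r N\hookrightarrow M\otimes N$, and $\varepsilon|_{H_s}:H_s\to k$. Essentially strong (op)monoidal. Let $U:(\mathcal{C},\boxtimes,I)\to{}_k\mathcal{M}$ be a monoidal functor, with maps $U(M)\otimes U(N)\to U(M\boxtimes N)$ and $k\to U(I)$. Then $U(I)$ is a $k$-algebra, each $U(M)$ is a $U(I)$-bimodule (via the structure maps and unit constraints), and $U$ factors through a monoidal functor $\mathcal{C}\to{}_{U(I)}\mathcal{M}_{U(I)}$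 into $U(I)$-bimodules; $U$ is essentially strong monoidal if the latter is strong monoidal, i.e. the induced maps $U(M)\otimes_{U(I)}U(N)\to U(M\boxtimes N)$ are isomorphisms for all $M,N$. Dually, if $U$ is opmonoidal, with maps $U(M\boxtimes N)\to U(M)\otimes U(N)$ and $U(I)\to k$, then $U(I)$ is a $k$-coalgebra, each $U(M)$ is a $U(I)$-bicomodule, and $U$ is essentially strong opmonoidal if the induced maps from $U(M\boxtimes N)$ to the cotensor product of $U(M)$ and $U(N)$ over $U(I)$ are isomorphisms for all $M,N$; here the cotensor product over a coalgebra $C$ of a right $C$-comodule $M$ and a left $C$-comodule $N$ is the set of $\sum_i m_i\otimes n_i\in M\otimes N$ with $\sum_i m_{i[0]}\otimes m_{i[1]}\otimes n_i=\sum_i m_i\otimes n_{i[-1]}\otimes n_{i[0]}$. *)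

theory Defs
  imports "HOL-Algebra.Module" "HOL-Algebra.AbelCoset" "HOL-Library.Infinite_Typeclass"
begin

section \<open>Modules, tensor products and cotensor products\<close>

text \<open>
  All carriers (of the ring \<open>k\<close>, of \<open>H\<close> and of all modules and comodules) are subsets of
  one arbitrary infinite type \<open>'u\<close>. It plays the role of a universe: since finite lists over \<open>'u\<close>
  embed into \<open>'u\<close>, it is closed under the tensor product, so that the modules (comodules)
  with carrier in \<open>'u\<close> are the objects of a monoidal category.
  The fields \<open>mult\<close> and \<open>one\<close> of a module record carry no information unless the
  record is also used as an algebra.
\<close>

unbundle cardinal_syntax

lemma list_code_exists: "\<exists>f :: ('u::infinite \<times> 'u) list \<Rightarrow> 'u. inj f"
proof -
  let ?U = "UNIV :: 'u set"
  have "|?U \<times> ?U| =o |?U|"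
    by (rule card_of_Times_same_infinite) (rule infinite_UNIV)
  then obtain p :: "'u \<times> 'u \<Rightarrow> 'u" where p: "inj p"
    unfolding card_of_ordIso[symmetric] by (auto simp: bij_betw_def)
  obtain n :: "nat \<Rightarrow> 'u" where n: "inj n"
    using infinite_countable_subset[OF infinite_UNIV] by blast
  define c where "c = (\<lambda>xs :: ('u \<times> 'u) list. rec_list (n 0) (\<lambda>x _ r. p (p x, r)) xs)"
  have c: "xs = ys" if "length xs = length ys" "c xs = c ys" for xs ys
    using that
  proof (induction xs ys rule: list_induct2)
    case (Cons x xs y ys)
    then show ?case using p by (simp add: c_def) (metis injD prod.inject)
  qed simp
  have "inj (\<lambda>xs. p (n (length xs), c xs))"
    using p n c by (intro injI) (metis injD prod.inject)
  then show ?thesis by blast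
qed

unbundle no cardinal_syntax

definition tcode :: "('u::infinite \<times> 'u) list \<Rightarrow> 'u" where
  "tcode = (SOME f. inj f)"

lemma inj_tcode: "inj tcode"
  unfolding tcode_def using someI_ex[OF list_code_exists] .

definition tdecode :: "'u::infinite \<Rightarrow> ('u \<times> 'u) list" where
  "tdecode = inv_into UNIV tcode"

definition linear_maps ::
  "('u, 'x) ring_scheme \<Rightarrow> ('u, 'a, 'y) module_scheme \<Rightarrow> ('u, 'b, 'z) module_scheme \<Rightarrow> ('a \<Rightarrow> 'b) set" where
  "linear_maps k M N = {f \<in> carrier M \<rightarrow> carrier N.
     (\<forall>x\<in>carrier M. \<forall>y\<in>carrier M. f (x \<oplus>\<^bsub>M\<^esub> y) = f x \<oplus>\<^bsub>N\<^esub> f y) \<and>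
     (\<forall>a\<in>carrier k. \<forall>x\<in>carrier M. f (a \<odot>\<^bsub>M\<^esub> x) = a \<odot>\<^bsub>N\<^esub> f x)}"

definition linear_isos ::
  "('u, 'x) ring_scheme \<Rightarrow> ('u, 'a, 'y) module_scheme \<Rightarrow> ('u, 'b, 'z) module_scheme \<Rightarrow> ('a \<Rightarrow> 'b) set" where
  "linear_isos k M N = {f \<in> linear_maps k M N. bij_betw f (carrier M) (carrier N)}"

definition reg_module :: "'u ring \<Rightarrow> ('u, 'u) module" where
  "reg_module k = \<lparr>carrier = carrier k, mult = mult k, one = one k,
     zero = zero k, add = add k, smult = mult k\<rparr>"

text \<open>
  A list \<open>[(m\<^sub>1, n\<^sub>1), \<dots>, (m\<^sub>r, n\<^sub>r)]\<close> stands for the formal sum of the \<open>m\<^sub>i \<otimes> n\<^sub>i\<close>;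
  \<open>tensor_eq\<close> is the congruence defining \<open>M \<otimes>\<^sub>k N\<close>.
\<close>

inductive tensor_eq ::
  "'u ring \<Rightarrow> ('u, 'u, 'y) module_scheme \<Rightarrow> ('u, 'u, 'z) module_scheme
     \<Rightarrow> ('u \<times> 'u) list \<Rightarrow> ('u \<times> 'u) list \<Rightarrow> bool"
  for k M N where
  refl: "xs \<in> lists (carrier M \<times> carrier N) \<Longrightarrow> tensor_eq k M N xs xs"
| sym: "tensor_eq k M N xs ys \<Longrightarrow> tensor_eq k M N ys xs"
| trans: "tensor_eq k M N xs ys \<Longrightarrow> tensor_eq k M N ys zs \<Longrightarrow> tensor_eq k M N xs zs"
| append: "tensor_eq k M N xs xs' \<Longrightarrow> tensor_eq k M N ys ys' \<Longrightarrow> tensor_eq k M N (xs @ ys) (xs' @ ys')"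
| commute: "xs \<in> lists (carrier M \<times> carrier N) \<Longrightarrow> ys \<in> lists (carrier M \<times> carrier N)
    \<Longrightarrow> tensor_eq k M N (xs @ ys) (ys @ xs)"
| zero: "n \<in> carrier N \<Longrightarrow> tensor_eq k M N [(\<zero>\<^bsub>M\<^esub>, n)] []"
| add_left: "m \<in> carrier M \<Longrightarrow> m' \<in> carrier M \<Longrightarrow> n \<in> carrier N
    \<Longrightarrow> tensor_eq k M N [(m \<oplus>\<^bsub>M\<^esub> m', n)] [(m, n), (m', n)]"
| add_right: "m \<in> carrier M \<Longrightarrow> n \<in> carrier N \<Longrightarrow> n' \<in> carrier N
    \<Longrightarrow> tensor_eq k M N [(m, n \<oplus>\<^bsub>N\<^esub> n')] [(m, n), (m, n')]"
| scalar: "a \<in> carrier k \<Longrightarrow> m \<in> carrier M \<Longrightarrow> n \<in> carrier N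
    \<Longrightarrow> tensor_eq k M N [(a \<odot>\<^bsub>M\<^esub> m, n)] [(m, a \<odot>\<^bsub>N\<^esub> n)]"

text \<open>The element of \<open>M \<otimes>\<^sub>k N\<close> given by a formal sum: the code of a chosen representative of its class.\<close>

definition tclass ::
  "'u::infinite ring \<Rightarrow> ('u, 'u, 'y) module_scheme \<Rightarrow> ('u, 'u, 'z) module_scheme
     \<Rightarrow> ('u \<times> 'u) list \<Rightarrow> 'u" where
  "tclass k M N xs = tcode (SOME ys. tensor_eq k M N xs ys)"

definition tensor ::
  "'u::infinite ring \<Rightarrow> ('u, 'u, 'y) module_scheme \<Rightarrow> ('u, 'u, 'z) module_scheme
     \<Rightarrow> ('u, 'u) module" where
  "tensor k M N = \<lparr>carrier = tclass k M N ` lists (carrier M \<times> carrier N),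
     mult = undefined, one = undefined,
     zero = tclass k M N [],
     add = (\<lambda>s t. tclass k M N (tdecode s @ tdecode t)),
     smult = (\<lambda>a t. tclass k M N (map (\<lambda>(m, n). (a \<odot>\<^bsub>M\<^esub> m, n)) (tdecode t)))\<rparr>"

definition tens ::
  "'u::infinite ring \<Rightarrow> ('u, 'u, 'y) module_scheme \<Rightarrow> ('u, 'u, 'z) module_scheme
     \<Rightarrow> 'u \<Rightarrow> 'u \<Rightarrow> 'u" where
  "tens k M N m n = tclass k M N [(m, n)]"

text \<open>
  \<open>tlift P \<beta>\<close> is the additive map \<open>M \<otimes>\<^sub>k N \<rightarrow> P\<close> with \<open>m \<otimes> n \<mapsto> \<beta> m n\<close>; it is only used
  for \<open>k\<close>-bilinear \<open>\<beta>\<close>, where it does not depend on the chosen representatives.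
  Thus \<open>tlift P (\<lambda>a b. E a b) (\<Delta> h)\<close> is what Sweedler notation writes as
  \<open>E h\<^sub>(\<^sub>1\<^sub>) h\<^sub>(\<^sub>2\<^sub>)\<close>.
\<close>

definition tlift ::
  "('b, 'x) ring_scheme \<Rightarrow> ('u::infinite \<Rightarrow> 'u \<Rightarrow> 'b) \<Rightarrow> 'u \<Rightarrow> 'b" where
  "tlift P \<beta> t = foldr (\<lambda>(m, n) s. \<beta> m n \<oplus>\<^bsub>P\<^esub> s) (tdecode t) \<zero>\<^bsub>P\<^esub>"

text \<open>\<open>f \<otimes> g\<close> for \<open>f : M \<rightarrow> M'\<close> and \<open>g : N \<rightarrow> N'\<close>; only the codomains are arguments.\<close>

definition tmap ::
  "'u::infinite ring \<Rightarrow> ('u, 'u, 'y) module_scheme \<Rightarrow> ('u, 'u, 'z) module_scheme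
     \<Rightarrow> ('u \<Rightarrow> 'u) \<Rightarrow> ('u \<Rightarrow> 'u) \<Rightarrow> 'u \<Rightarrow> 'u" where
  "tmap k M' N' f g = tlift (tensor k M' N') (\<lambda>m n. tens k M' N' (f m) (g n))"

text \<open>The associator \<open>(M \<otimes> N) \<otimes> P \<rightarrow> M \<otimes> (N \<otimes> P)\<close>.\<close>

definition tassoc ::
  "'u::infinite ring \<Rightarrow> ('u, 'u, 'x) module_scheme \<Rightarrow> ('u, 'u, 'y) module_scheme
     \<Rightarrow> ('u, 'u, 'z) module_scheme \<Rightarrow> 'u \<Rightarrow> 'u" where
  "tassoc k M N P =
     (let T = tensor k M (tensor k N P) in
      tlift T (\<lambda>s p. tlift T (\<lambda>m n. tens k M (tensor k N P) m (tens k N P n p)) s))"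

definition span_submodule ::
  "('u, 'x) ring_scheme \<Rightarrow> ('u, 'a, 'y) module_scheme \<Rightarrow> 'a set \<Rightarrow> 'a set" where
  "span_submodule k M X = \<Inter> {S. submodule S k M \<and> X \<subseteq> S}"

definition quot_module ::
  "('u, 'a, 'y) module_scheme \<Rightarrow> 'a set \<Rightarrow> ('u, 'a set) module" where
  "quot_module M S = \<lparr>carrier = a_rcosets\<^bsub>M\<^esub> S, mult = undefined, one = undefined,
     zero = S, add = set_add M, smult = (\<lambda>a X. \<Union>x\<in>X. S +>\<^bsub>M\<^esub> (a \<odot>\<^bsub>M\<^esub> x))\<rparr>"

text \<open>
  For a right \<open>B\<close>-module \<open>M\<close> with action \<open>ra m b = m \<cdot> b\<close> and a left \<open>B\<close>-module \<open>N\<close> with action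
  \<open>la b n = b \<cdot> n\<close> over a \<open>k\<close>-algebra \<open>B\<close>:
  \<open>M \<otimes>\<^sub>B N\<close> is the quotient of \<open>M \<otimes>\<^sub>k N\<close> by \<open>balancing k M N B ra la\<close>.
\<close>

definition balancing ::
  "'u::infinite ring \<Rightarrow> ('u, 'u) module \<Rightarrow> ('u, 'u) module \<Rightarrow> ('u, 'u) module
     \<Rightarrow> ('u \<Rightarrow> 'u \<Rightarrow> 'u) \<Rightarrow> ('u \<Rightarrow> 'u \<Rightarrow> 'u) \<Rightarrow> 'u set" where
  "balancing k M N B ra la = span_submodule k (tensor k M N)
     {tens k M N (ra m b) n \<ominus>\<^bsub>tensor k M N\<^esub> tens k M N m (la b n) | m b n.
        m \<in> carrier M \<and> b \<in> carrier B \<and> n \<in> carrier N}"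

definition tensor_over ::
  "'u::infinite ring \<Rightarrow> ('u, 'u) module \<Rightarrow> ('u, 'u) module \<Rightarrow> ('u, 'u) module
     \<Rightarrow> ('u \<Rightarrow> 'u \<Rightarrow> 'u) \<Rightarrow> ('u \<Rightarrow> 'u \<Rightarrow> 'u) \<Rightarrow> ('u, 'u set) module" where
  "tensor_over k M N B ra la = quot_module (tensor k M N) (balancing k M N B ra la)"

text \<open>
  The cotensor product over a coalgebra \<open>C\<close> of a right \<open>C\<close>-comodule
  \<open>rc : M \<rightarrow> M \<otimes> C\<close> and a left \<open>C\<close>-comodule \<open>lc : N \<rightarrow> C \<otimes> N\<close>.
\<close>

definition cotensor ::
  "'u::infinite ring \<Rightarrow> ('u, 'u) module \<Rightarrow> ('u, 'u) module \<Rightarrow> ('u, 'u) module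
     \<Rightarrow> ('u \<Rightarrow> 'u) \<Rightarrow> ('u \<Rightarrow> 'u) \<Rightarrow> ('u, 'u) module" where
  "cotensor k M N C rc lc = (tensor k M N)
     \<lparr>carrier := {x \<in> carrier (tensor k M N).
        tassoc k M C N (tmap k (tensor k M C) N rc id x) = tmap k M (tensor k C N) id lc x}\<rparr>"


section \<open>Monoidal categories and monoidal functors\<close>

record ('o, 'a) cat =
  Ob :: "'o set"
  Arr :: "'a set"
  Dom :: "'a \<Rightarrow> 'o"
  Cod :: "'a \<Rightarrow> 'o"
  Ident :: "'o \<Rightarrow> 'a"
  Comp :: "'a \<Rightarrow> 'a \<Rightarrow> 'a" (infixr \<open>\<cdot>\<index>\<close> 65)

record ('o, 'a) moncat = "('o, 'a) cat" +
  TensO :: "'o \<Rightarrow> 'o \<Rightarrow> 'o" (infixr \<open>\<diamondop>\<index>\<close> 75)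
  TensA :: "'a \<Rightarrow> 'a \<Rightarrow> 'a" (infixr \<open>\<star>\<index>\<close> 75)
  UnitO :: "'o"
  Assoc :: "'o \<Rightarrow> 'o \<Rightarrow> 'o \<Rightarrow> 'a"
  LUnit :: "'o \<Rightarrow> 'a"
  RUnit :: "'o \<Rightarrow> 'a"

definition Hom :: "('o, 'a, 'x) cat_scheme \<Rightarrow> 'o \<Rightarrow> 'o \<Rightarrow> 'a set" where
  "Hom C A B = {f \<in> Arr C. Dom C f = A \<and> Cod C f = B}"

definition inverse_arrows :: "('o, 'a, 'x) cat_scheme \<Rightarrow> 'a \<Rightarrow> 'a \<Rightarrow> bool" where
  "inverse_arrows C f g \<longleftrightarrow> f \<in> Arr C \<and> g \<in> Hom C (Cod C f) (Dom C f) \<and>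
     g \<cdot>\<^bsub>C\<^esub> f = Ident C (Dom C f) \<and> f \<cdot>\<^bsub>C\<^esub> g = Ident C (Cod C f)"

definition Iso :: "('o, 'a, 'x) cat_scheme \<Rightarrow> 'o \<Rightarrow> 'o \<Rightarrow> 'a set" where
  "Iso C A B = {f \<in> Hom C A B. \<exists>g. inverse_arrows C f g}"

definition inv_arr :: "('o, 'a, 'x) cat_scheme \<Rightarrow> 'a \<Rightarrow> 'a" where
  "inv_arr C f = (THE g. inverse_arrows C f g)"

locale category =
  fixes C :: "('o, 'a, 'x) cat_scheme" (structure)
  assumes Dom_Ob: "f \<in> Arr C \<Longrightarrow> Dom C f \<in> Ob C"
    and Cod_Ob: "f \<in> Arr C \<Longrightarrow> Cod C f \<in> Ob C"
    and Ident_Hom: "A \<in> Ob C \<Longrightarrow> Ident C A \<in> Hom C A A"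
    and Comp_Hom: "f \<in> Hom C X Y \<Longrightarrow> g \<in> Hom C Y Z \<Longrightarrow> g \<cdot> f \<in> Hom C X Z"
    and Comp_Ident: "f \<in> Hom C X Y \<Longrightarrow> f \<cdot> Ident C X = f"
    and Ident_Comp: "f \<in> Hom C X Y \<Longrightarrow> Ident C Y \<cdot> f = f"
    and Comp_assoc: "f \<in> Hom C W X \<Longrightarrow> g \<in> Hom C X Y \<Longrightarrow> h \<in> Hom C Y Z
      \<Longrightarrow> (h \<cdot> g) \<cdot> f = h \<cdot> (g \<cdot> f)"

locale monoidal_category = category C
  for C :: "('o, 'a, 'x) moncat_scheme" (structure) +
  assumes TensO_Ob: "X \<in> Ob C \<Longrightarrow> Y \<in> Ob C \<Longrightarrow> X \<diamondop> Y \<in> Ob C"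
    and TensA_Hom: "f \<in> Hom C X X' \<Longrightarrow> g \<in> Hom C Y Y' \<Longrightarrow> f \<star> g \<in> Hom C (X \<diamondop> Y) (X' \<diamondop> Y')"
    and TensA_Ident: "X \<in> Ob C \<Longrightarrow> Y \<in> Ob C \<Longrightarrow> Ident C X \<star> Ident C Y = Ident C (X \<diamondop> Y)"
    and TensA_Comp: "f \<in> Hom C X X' \<Longrightarrow> f' \<in> Hom C X' X'' \<Longrightarrow> g \<in> Hom C Y Y' \<Longrightarrow> g' \<in> Hom C Y' Y''
      \<Longrightarrow> (f' \<cdot> f) \<star> (g' \<cdot> g) = (f' \<star> g') \<cdot> (f \<star> g)"
    and UnitO_Ob: "UnitO C \<in> Ob C"
    and Assoc_Iso: "X \<in> Ob C \<Longrightarrow> Y \<in> Ob C \<Longrightarrow> Z \<in> Ob C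
      \<Longrightarrow> Assoc C X Y Z \<in> Iso C ((X \<diamondop> Y) \<diamondop> Z) (X \<diamondop> (Y \<diamondop> Z))"
    and Assoc_natural: "f \<in> Hom C X X' \<Longrightarrow> g \<in> Hom C Y Y' \<Longrightarrow> h \<in> Hom C Z Z'
      \<Longrightarrow> Assoc C X' Y' Z' \<cdot> ((f \<star> g) \<star> h) = (f \<star> (g \<star> h)) \<cdot> Assoc C X Y Z"
    and LUnit_Iso: "X \<in> Ob C \<Longrightarrow> LUnit C X \<in> Iso C (UnitO C \<diamondop> X) X"
    and LUnit_natural: "f \<in> Hom C X X' \<Longrightarrow> LUnit C X' \<cdot> (Ident C (UnitO C) \<star> f) = f \<cdot> LUnit C X"
    and RUnit_Iso: "X \<in> Ob C \<Longrightarrow> RUnit C X \<in> Iso C (X \<diamondop> UnitO C) X"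
    and RUnit_natural: "f \<in> Hom C X X' \<Longrightarrow> RUnit C X' \<cdot> (f \<star> Ident C (UnitO C)) = f \<cdot> RUnit C X"
    and pentagon: "W \<in> Ob C \<Longrightarrow> X \<in> Ob C \<Longrightarrow> Y \<in> Ob C \<Longrightarrow> Z \<in> Ob C
      \<Longrightarrow> Assoc C W X (Y \<diamondop> Z) \<cdot> Assoc C (W \<diamondop> X) Y Z =
          (Ident C W \<star> Assoc C X Y Z) \<cdot> Assoc C W (X \<diamondop> Y) Z \<cdot> (Assoc C W X Y \<star> Ident C Z)"
    and triangle: "X \<in> Ob C \<Longrightarrow> Y \<in> Ob C
      \<Longrightarrow> (Ident C X \<star> LUnit C Y) \<cdot> Assoc C X (UnitO C) Y = RUnit C X \<star> Ident C Y"

locale cat_functor = C: category C + D: category D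
  for C :: "('o, 'a, 'x) cat_scheme" and D :: "('p, 'b, 'y) cat_scheme" +
  fixes Fo :: "'o \<Rightarrow> 'p" and Fa :: "'a \<Rightarrow> 'b"
  assumes F_Ob: "X \<in> Ob C \<Longrightarrow> Fo X \<in> Ob D"
    and F_Hom: "f \<in> Hom C X Y \<Longrightarrow> Fa f \<in> Hom D (Fo X) (Fo Y)"
    and F_Ident: "X \<in> Ob C \<Longrightarrow> Fa (Ident C X) = Ident D (Fo X)"
    and F_Comp: "f \<in> Hom C X Y \<Longrightarrow> g \<in> Hom C Y Z \<Longrightarrow> Fa (g \<cdot>\<^bsub>C\<^esub> f) = Fa g \<cdot>\<^bsub>D\<^esub> Fa f"

locale monoidal_functor = C: monoidal_category C + D: monoidal_category D + cat_functor C D Fo Fa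
  for C :: "('o, 'a, 'x) moncat_scheme" and D :: "('p, 'b, 'y) moncat_scheme"
    and Fo :: "'o \<Rightarrow> 'p" and Fa :: "'a \<Rightarrow> 'b" +
  fixes \<phi> :: "'o \<Rightarrow> 'o \<Rightarrow> 'b" and \<phi>0 :: 'b
  assumes phi_Hom: "X \<in> Ob C \<Longrightarrow> Y \<in> Ob C \<Longrightarrow> \<phi> X Y \<in> Hom D (Fo X \<diamondop>\<^bsub>D\<^esub> Fo Y) (Fo (X \<diamondop>\<^bsub>C\<^esub> Y))"
    and phi0_Hom: "\<phi>0 \<in> Hom D (UnitO D) (Fo (UnitO C))"
    and phi_natural: "f \<in> Hom C X X' \<Longrightarrow> g \<in> Hom C Y Y'
      \<Longrightarrow> \<phi> X' Y' \<cdot>\<^bsub>D\<^esub> (Fa f \<star>\<^bsub>D\<^esub> Fa g) = Fa (f \<star>\<^bsub>C\<^esub> g) \<cdot>\<^bsub>D\<^esub> \<phi> X Y"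
    and phi_assoc: "X \<in> Ob C \<Longrightarrow> Y \<in> Ob C \<Longrightarrow> Z \<in> Ob C
      \<Longrightarrow> Fa (Assoc C X Y Z) \<cdot>\<^bsub>D\<^esub> \<phi> (X \<diamondop>\<^bsub>C\<^esub> Y) Z \<cdot>\<^bsub>D\<^esub> (\<phi> X Y \<star>\<^bsub>D\<^esub> Ident D (Fo Z)) =
          \<phi> X (Y \<diamondop>\<^bsub>C\<^esub> Z) \<cdot>\<^bsub>D\<^esub> (Ident D (Fo X) \<star>\<^bsub>D\<^esub> \<phi> Y Z) \<cdot>\<^bsub>D\<^esub> Assoc D (Fo X) (Fo Y) (Fo Z)"
    and phi_lunit: "X \<in> Ob C
      \<Longrightarrow> Fa (LUnit C X) \<cdot>\<^bsub>D\<^esub> \<phi> (UnitO C) X \<cdot>\<^bsub>D\<^esub> (\<phi>0 \<star>\<^bsub>D\<^esub> Ident D (Fo X)) = LUnit D (Fo X)"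
    and phi_runit: "X \<in> Ob C
      \<Longrightarrow> Fa (RUnit C X) \<cdot>\<^bsub>D\<^esub> \<phi> X (UnitO C) \<cdot>\<^bsub>D\<^esub> (Ident D (Fo X) \<star>\<^bsub>D\<^esub> \<phi>0) = RUnit D (Fo X)"

locale opmonoidal_functor = C: monoidal_category C + D: monoidal_category D + cat_functor C D Fo Fa
  for C :: "('o, 'a, 'x) moncat_scheme" and D :: "('p, 'b, 'y) moncat_scheme"
    and Fo :: "'o \<Rightarrow> 'p" and Fa :: "'a \<Rightarrow> 'b" +
  fixes \<psi> :: "'o \<Rightarrow> 'o \<Rightarrow> 'b" and \<psi>0 :: 'b
  assumes psi_Hom: "X \<in> Ob C \<Longrightarrow> Y \<in> Ob C \<Longrightarrow> \<psi> X Y \<in> Hom D (Fo (X \<diamondop>\<^bsub>C\<^esub> Y)) (Fo X \<diamondop>\<^bsub>D\<^esub> Fo Y)"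
    and psi0_Hom: "\<psi>0 \<in> Hom D (Fo (UnitO C)) (UnitO D)"
    and psi_natural: "f \<in> Hom C X X' \<Longrightarrow> g \<in> Hom C Y Y'
      \<Longrightarrow> \<psi> X' Y' \<cdot>\<^bsub>D\<^esub> Fa (f \<star>\<^bsub>C\<^esub> g) = (Fa f \<star>\<^bsub>D\<^esub> Fa g) \<cdot>\<^bsub>D\<^esub> \<psi> X Y"
    and psi_assoc: "X \<in> Ob C \<Longrightarrow> Y \<in> Ob C \<Longrightarrow> Z \<in> Ob C
      \<Longrightarrow> (Ident D (Fo X) \<star>\<^bsub>D\<^esub> \<psi> Y Z) \<cdot>\<^bsub>D\<^esub> \<psi> X (Y \<diamondop>\<^bsub>C\<^esub> Z) \<cdot>\<^bsub>D\<^esub> Fa (Assoc C X Y Z) =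
          Assoc D (Fo X) (Fo Y) (Fo Z) \<cdot>\<^bsub>D\<^esub> (\<psi> X Y \<star>\<^bsub>D\<^esub> Ident D (Fo Z)) \<cdot>\<^bsub>D\<^esub> \<psi> (X \<diamondop>\<^bsub>C\<^esub> Y) Z"
    and psi_lunit: "X \<in> Ob C
      \<Longrightarrow> LUnit D (Fo X) \<cdot>\<^bsub>D\<^esub> (\<psi>0 \<star>\<^bsub>D\<^esub> Ident D (Fo X)) \<cdot>\<^bsub>D\<^esub> \<psi> (UnitO C) X = Fa (LUnit C X)"
    and psi_runit: "X \<in> Ob C
      \<Longrightarrow> RUnit D (Fo X) \<cdot>\<^bsub>D\<^esub> (Ident D (Fo X) \<star>\<^bsub>D\<^esub> \<psi>0) \<cdot>\<^bsub>D\<^esub> \<psi> X (UnitO C) = Fa (RUnit C X)"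


section \<open>The monoidal category of modules\<close>

text \<open>An arrow is a function on carriers (undefined outside) together with its domain and codomain.\<close>

datatype ('o, 'u) arrow = Arrow (src: 'o) (fn: "'u \<Rightarrow> 'u") (tgt: 'o)

definition mod_cat :: "'u::infinite ring \<Rightarrow> (('u, 'u) module, (('u, 'u) module, 'u) arrow) moncat" where
  "mod_cat k = \<lparr>
     Ob = {M. Module.module k M},
     Arr = {Arrow M f N | M f N. Module.module k M \<and> Module.module k N \<and>
              f \<in> linear_maps k M N \<inter> extensional (carrier M)},
     Dom = src, Cod = tgt,
     Ident = (\<lambda>M. Arrow M (restrict id (carrier M)) M),
     Comp = (\<lambda>g f. Arrow (src f) (compose (carrier (src f)) (fn g) (fn f)) (tgt g)),
     TensO = tensor k,
     TensA = (\<lambda>f g. Arrow (tensor k (src f) (src g))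
                (restrict (tmap k (tgt f) (tgt g) (fn f) (fn g)) (carrier (tensor k (src f) (src g))))
                (tensor k (tgt f) (tgt g))),
     UnitO = reg_module k,
     Assoc = (\<lambda>M N P. Arrow (tensor k (tensor k M N) P)
                (restrict (tassoc k M N P) (carrier (tensor k (tensor k M N) P)))
                (tensor k M (tensor k N P))),
     LUnit = (\<lambda>M. Arrow (tensor k (reg_module k) M)
                (restrict (tlift M (\<lambda>a m. a \<odot>\<^bsub>M\<^esub> m)) (carrier (tensor k (reg_module k) M))) M),
     RUnit = (\<lambda>M. Arrow (tensor k M (reg_module k))
                (restrict (tlift M (\<lambda>m a. a \<odot>\<^bsub>M\<^esub> m)) (carrier (tensor k M (reg_module k)))) M)\<rparr>"


section \<open>Essentially strong (op)monoidal functors to modules\<close>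

text \<open>The actions \<open>b \<cdot> m\<close> and \<open>m \<cdot> b\<close> of \<open>F(I)\<close> on \<open>F(X)\<close>, for \<open>(F, \<phi>)\<close> monoidal.\<close>

definition unit_lact where
  "unit_lact k C Fo Fa \<phi> X b m =
     fn (Fa (LUnit C X)) (fn (\<phi> (UnitO C) X) (tens k (Fo (UnitO C)) (Fo X) b m))"

definition unit_ract where
  "unit_ract k C Fo Fa \<phi> X m b =
     fn (Fa (RUnit C X)) (fn (\<phi> X (UnitO C)) (tens k (Fo X) (Fo (UnitO C)) m b))"

text \<open>
  The \<open>k\<close>-linear map \<open>F(X) \<otimes>\<^bsub>F(I)\<^esub> F(Y) \<rightarrow> F(X \<diamondop> Y)\<close> induced by \<open>\<phi> X Y\<close> is the unique
  \<open>\<theta>\<close> whose composition with the projection from \<open>F(X) \<otimes> F(Y)\<close> is \<open>\<phi> X Y\<close>.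
\<close>

definition ess_strong_monoidal ::
  "'u::infinite ring \<Rightarrow> ('o, 'a, 'x) moncat_scheme \<Rightarrow> ('o \<Rightarrow> ('u, 'u) module)
     \<Rightarrow> ('a \<Rightarrow> (('u, 'u) module, 'u) arrow) \<Rightarrow> ('o \<Rightarrow> 'o \<Rightarrow> (('u, 'u) module, 'u) arrow)
     \<Rightarrow> (('u, 'u) module, 'u) arrow \<Rightarrow> bool" where
  "ess_strong_monoidal k C Fo Fa \<phi> \<phi>0 \<longleftrightarrow>
     monoidal_functor C (mod_cat k) Fo Fa \<phi> \<phi>0 \<and>
     (\<forall>X\<in>Ob C. \<forall>Y\<in>Ob C.
       let B = Fo (UnitO C); ra = unit_ract k C Fo Fa \<phi> X; la = unit_lact k C Fo Fa \<phi> Y;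
           T = tensor k (Fo X) (Fo Y) in
       \<exists>\<theta> \<in> linear_isos k (tensor_over k (Fo X) (Fo Y) B ra la) (Fo (X \<diamondop>\<^bsub>C\<^esub> Y)).
         \<forall>t\<in>carrier T. \<theta> (balancing k (Fo X) (Fo Y) B ra la +>\<^bsub>T\<^esub> t) = fn (\<phi> X Y) t)"

text \<open>The \<open>F(I)\<close>-coactions \<open>F(X) \<rightarrow> F(I) \<otimes> F(X)\<close> and \<open>F(X) \<rightarrow> F(X) \<otimes> F(I)\<close>, for \<open>(F, \<psi>)\<close> opmonoidal.\<close>

definition unit_lcoact where
  "unit_lcoact C Fo Fa \<psi> X m = fn (\<psi> (UnitO C) X) (fn (Fa (inv_arr C (LUnit C X))) m)"

definition unit_rcoact where
  "unit_rcoact C Fo Fa \<psi> X m = fn (\<psi> X (UnitO C)) (fn (Fa (inv_arr C (RUnit C X))) m)"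

text \<open>
  The cotensor product is a submodule of \<open>F(X) \<otimes> F(Y)\<close>; the induced map is \<open>\<psi> X Y\<close> with
  its codomain restricted to it.
\<close>

definition ess_strong_opmonoidal ::
  "'u::infinite ring \<Rightarrow> ('o, 'a, 'x) moncat_scheme \<Rightarrow> ('o \<Rightarrow> ('u, 'u) module)
     \<Rightarrow> ('a \<Rightarrow> (('u, 'u) module, 'u) arrow) \<Rightarrow> ('o \<Rightarrow> 'o \<Rightarrow> (('u, 'u) module, 'u) arrow)
     \<Rightarrow> (('u, 'u) module, 'u) arrow \<Rightarrow> bool" where
  "ess_strong_opmonoidal k C Fo Fa \<psi> \<psi>0 \<longleftrightarrow>
     opmonoidal_functor C (mod_cat k) Fo Fa \<psi> \<psi>0 \<and>
     (\<forall>X\<in>Ob C. \<forall>Y\<in>Ob C.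
       fn (\<psi> X Y) \<in> linear_isos k (Fo (X \<diamondop>\<^bsub>C\<^esub> Y))
         (cotensor k (Fo X) (Fo Y) (Fo (UnitO C))
            (unit_rcoact C Fo Fa \<psi> X) (unit_lcoact C Fo Fa \<psi> Y)))"


section \<open>Prebialgebras\<close>

record 'u prebialg = "('u, 'u) module" +
  comult :: "'u \<Rightarrow> 'u"
  counit :: "'u \<Rightarrow> 'u"

text \<open>The multiplication of the tensor product algebra \<open>H \<otimes> H\<close>.\<close>

definition tmult :: "'u::infinite ring \<Rightarrow> 'u prebialg \<Rightarrow> 'u \<Rightarrow> 'u \<Rightarrow> 'u" where
  "tmult k H s t = tlift (tensor k H H) (\<lambda>a b. tlift (tensor k H H)
     (\<lambda>c d. tens k H H (a \<otimes>\<^bsub>H\<^esub> c) (b \<otimes>\<^bsub>H\<^esub> d)) t) s"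

locale prebialgebra = Module.module k H + ring H
  for k :: "'u::infinite ring" and H :: "'u prebialg" +
  assumes smult_mult_left: "\<lbrakk>a \<in> carrier k; x \<in> carrier H; y \<in> carrier H\<rbrakk>
      \<Longrightarrow> (a \<odot>\<^bsub>H\<^esub> x) \<otimes>\<^bsub>H\<^esub> y = a \<odot>\<^bsub>H\<^esub> (x \<otimes>\<^bsub>H\<^esub> y)"
    and smult_mult_right: "\<lbrakk>a \<in> carrier k; x \<in> carrier H; y \<in> carrier H\<rbrakk>
      \<Longrightarrow> x \<otimes>\<^bsub>H\<^esub> (a \<odot>\<^bsub>H\<^esub> y) = a \<odot>\<^bsub>H\<^esub> (x \<otimes>\<^bsub>H\<^esub> y)"
    and comult_linear: "comult H \<in> linear_maps k H (tensor k H H)"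
    and counit_linear: "counit H \<in> linear_maps k H (reg_module k)"
    and comult_coassoc: "h \<in> carrier H \<Longrightarrow>
      tassoc k H H H (tmap k (tensor k H H) H (comult H) id (comult H h)) =
      tmap k H (tensor k H H) id (comult H) (comult H h)"
    and counit_left: "h \<in> carrier H \<Longrightarrow> tlift H (\<lambda>a b. counit H a \<odot>\<^bsub>H\<^esub> b) (comult H h) = h"
    and counit_right: "h \<in> carrier H \<Longrightarrow> tlift H (\<lambda>a b. counit H b \<odot>\<^bsub>H\<^esub> a) (comult H h) = h"
    and comult_mult: "\<lbrakk>x \<in> carrier H; y \<in> carrier H\<rbrakk>
      \<Longrightarrow> comult H (x \<otimes>\<^bsub>H\<^esub> y) = tmult k H (comult H x) (comult H y)"

definition ax_lm :: "'u::infinite ring \<Rightarrow> 'u prebialg \<Rightarrow> bool" where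
  "ax_lm k H \<longleftrightarrow> (\<forall>x\<in>carrier H. \<forall>y\<in>carrier H. \<forall>z\<in>carrier H.
     counit H (x \<otimes>\<^bsub>H\<^esub> y \<otimes>\<^bsub>H\<^esub> z) =
     tlift k (\<lambda>y1 y2. counit H (x \<otimes>\<^bsub>H\<^esub> y1) \<otimes>\<^bsub>k\<^esub> counit H (y2 \<otimes>\<^bsub>H\<^esub> z)) (comult H y))"

definition ax_rm :: "'u::infinite ring \<Rightarrow> 'u prebialg \<Rightarrow> bool" where
  "ax_rm k H \<longleftrightarrow> (\<forall>x\<in>carrier H. \<forall>y\<in>carrier H. \<forall>z\<in>carrier H.
     counit H (x \<otimes>\<^bsub>H\<^esub> y \<otimes>\<^bsub>H\<^esub> z) =
     tlift k (\<lambda>y1 y2. counit H (x \<otimes>\<^bsub>H\<^esub> y2) \<otimes>\<^bsub>k\<^esub> counit H (y1 \<otimes>\<^bsub>H\<^esub> z)) (comult H y))"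

text \<open>\<open>\<Delta>\<^sup>2(1)\<close>, and the right-hand sides of the next two axioms, are elements of \<open>(H \<otimes> H) \<otimes> H\<close>.\<close>

definition comult2_one :: "'u::infinite ring \<Rightarrow> 'u prebialg \<Rightarrow> 'u" where
  "comult2_one k H = tmap k (tensor k H H) H (comult H) id (comult H \<one>\<^bsub>H\<^esub>)"

definition ax_lc :: "'u::infinite ring \<Rightarrow> 'u prebialg \<Rightarrow> bool" where
  "ax_lc k H \<longleftrightarrow> comult2_one k H =
     (let T = tensor k (tensor k H H) H in
      tlift T (\<lambda>a b. tlift T (\<lambda>c d. tens k (tensor k H H) H (tens k H H a (b \<otimes>\<^bsub>H\<^esub> c)) d)
        (comult H \<one>\<^bsub>H\<^esub>)) (comult H \<one>\<^bsub>H\<^esub>))"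

definition ax_rc :: "'u::infinite ring \<Rightarrow> 'u prebialg \<Rightarrow> bool" where
  "ax_rc k H \<longleftrightarrow> comult2_one k H =
     (let T = tensor k (tensor k H H) H in
      tlift T (\<lambda>a b. tlift T (\<lambda>c d. tens k (tensor k H H) H (tens k H H a (c \<otimes>\<^bsub>H\<^esub> b)) d)
        (comult H \<one>\<^bsub>H\<^esub>)) (comult H \<one>\<^bsub>H\<^esub>))"

definition comonoidal_prebialgebra :: "'u::infinite ring \<Rightarrow> 'u prebialg \<Rightarrow> bool" where
  "comonoidal_prebialgebra k H \<longleftrightarrow> prebialgebra k H \<and> ax_lc k H \<and> ax_rc k H"


section \<open>The monoidal category of right comodules\<close>

record 'u comod =
  und :: "('u, 'u) module"
  coact :: "'u \<Rightarrow> 'u"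

definition comodule :: "'u::infinite ring \<Rightarrow> 'u prebialg \<Rightarrow> 'u comod \<Rightarrow> bool" where
  "comodule k H M \<longleftrightarrow> Module.module k (und M) \<and>
     coact M \<in> linear_maps k (und M) (tensor k (und M) H) \<and>
     (\<forall>m\<in>carrier (und M).
        tassoc k (und M) H H (tmap k (tensor k (und M) H) H (coact M) id (coact M m)) =
        tmap k (und M) (tensor k H H) id (comult H) (coact M m)) \<and>
     (\<forall>m\<in>carrier (und M). tlift (und M) (\<lambda>m0 m1. counit H m1 \<odot>\<^bsub>und M\<^esub> m0) (coact M m) = m)"

definition comodule_maps ::
  "'u::infinite ring \<Rightarrow> 'u prebialg \<Rightarrow> 'u comod \<Rightarrow> 'u comod \<Rightarrow> ('u \<Rightarrow> 'u) set" where
  "comodule_maps k H M N = {f \<in> linear_maps k (und M) (und N).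
     \<forall>m\<in>carrier (und M). coact N (f m) = tmap k (und N) H f id (coact M m)}"

definition eps_s :: "'u::infinite ring \<Rightarrow> 'u prebialg \<Rightarrow> 'u \<Rightarrow> 'u" where
  "eps_s k H h = tlift H (\<lambda>a b. counit H (h \<otimes>\<^bsub>H\<^esub> b) \<odot>\<^bsub>H\<^esub> a) (comult H \<one>\<^bsub>H\<^esub>)"

definition Hs_module :: "'u::infinite ring \<Rightarrow> 'u prebialg \<Rightarrow> ('u, 'u) module" where
  "Hs_module k H = \<lparr>carrier = eps_s k H ` carrier H, mult = mult H, one = one H,
     zero = zero H, add = add H, smult = smult H\<rparr>"

text \<open>
  The coaction on \<open>H\<^sub>s\<close> is \<open>\<Delta>\<close>, but its values have to be given as elements of \<open>H\<^sub>s \<otimes> H\<close>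
  rather than \<open>H \<otimes> H\<close>. As \<open>\<epsilon>\<^sub>s\<close> is the identity on \<open>H\<^sub>s\<close>, the map \<open>\<epsilon>\<^sub>s \<otimes> H\<close> with values in \<open>H\<^sub>s \<otimes> H\<close>
  sends an element of the image of \<open>H\<^sub>s \<otimes> H\<close> in \<open>H \<otimes> H\<close> to its unique preimage.
\<close>

definition Hs_comod :: "'u::infinite ring \<Rightarrow> 'u prebialg \<Rightarrow> 'u comod" where
  "Hs_comod k H = \<lparr>und = Hs_module k H,
     coact = (\<lambda>y. tmap k (Hs_module k H) H (eps_s k H) id (comult H y))\<rparr>"

definition rpi :: "'u::infinite ring \<Rightarrow> 'u prebialg \<Rightarrow> 'u comod \<Rightarrow> 'u comod \<Rightarrow> 'u \<Rightarrow> 'u" where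
  "rpi k H M N =
     (let T = tensor k (und M) (und N) in
      tlift T (\<lambda>m n. tlift T (\<lambda>m0 m1. tlift T (\<lambda>n0 n1.
        counit H (m1 \<otimes>\<^bsub>H\<^esub> n1) \<odot>\<^bsub>T\<^esub> tens k (und M) (und N) m0 n0) (coact N n)) (coact M m)))"

definition rtensor_module ::
  "'u::infinite ring \<Rightarrow> 'u prebialg \<Rightarrow> 'u comod \<Rightarrow> 'u comod \<Rightarrow> ('u, 'u) module" where
  "rtensor_module k H M N = (tensor k (und M) (und N))
     \<lparr>carrier := rpi k H M N ` carrier (tensor k (und M) (und N))\<rparr>"

text \<open>
  As for \<open>H\<^sub>s\<close>, the idempotent \<open>\<pi>\<close> is inserted in \<open>m \<otimes> n \<mapsto> m\<^sub>[\<^sub>0\<^sub>] \<otimes> n\<^sub>[\<^sub>0\<^sub>] \<otimes> m\<^sub>[\<^sub>1\<^sub>]n\<^sub>[\<^sub>1\<^sub>]\<close>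
  in order to express the values as elements of \<open>(M \<otimes>\<^sup>r N) \<otimes> H\<close>; likewise in \<open>rassoc\<close>.
\<close>

definition rtensor :: "'u::infinite ring \<Rightarrow> 'u prebialg \<Rightarrow> 'u comod \<Rightarrow> 'u comod \<Rightarrow> 'u comod" where
  "rtensor k H M N =
     (let R = rtensor_module k H M N; T = tensor k R H in
      \<lparr>und = R,
       coact = tlift T (\<lambda>m n. tlift T (\<lambda>m0 m1. tlift T (\<lambda>n0 n1.
         tens k R H (rpi k H M N (tens k (und M) (und N) m0 n0)) (m1 \<otimes>\<^bsub>H\<^esub> n1))
           (coact N n)) (coact M m))\<rparr>)"

text \<open>\<open>(m \<otimes> n) \<otimes> p \<mapsto> m \<otimes> (n \<otimes> p)\<close>, restricted to \<open>(M \<otimes>\<^sup>r N) \<otimes>\<^sup>r P\<close>, with values in \<open>M \<otimes> (N \<otimes>\<^sup>r P)\<close>.\<close>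

definition rassoc ::
  "'u::infinite ring \<Rightarrow> 'u prebialg \<Rightarrow> 'u comod \<Rightarrow> 'u comod \<Rightarrow> 'u comod \<Rightarrow> 'u \<Rightarrow> 'u" where
  "rassoc k H M N P =
     (let R = und (rtensor k H N P); T = tensor k (und M) R in
      tlift T (\<lambda>s p. tlift T (\<lambda>m n.
        tens k (und M) R m (rpi k H N P (tens k (und N) (und P) n p))) s))"

definition comod_cat :: "'u::infinite ring \<Rightarrow> 'u prebialg \<Rightarrow> ('u comod, ('u comod, 'u) arrow) moncat" where
  "comod_cat k H = \<lparr>
     Ob = {M. comodule k H M},
     Arr = {Arrow M f N | M f N. comodule k H M \<and> comodule k H N \<and>
              f \<in> comodule_maps k H M N \<inter> extensional (carrier (und M))},
     Dom = src, Cod = tgt,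
     Ident = (\<lambda>M. Arrow M (restrict id (carrier (und M))) M),
     Comp = (\<lambda>g f. Arrow (src f) (compose (carrier (und (src f))) (fn g) (fn f)) (tgt g)),
     TensO = rtensor k H,
     TensA = (\<lambda>f g. Arrow (rtensor k H (src f) (src g))
                (restrict (tmap k (und (tgt f)) (und (tgt g)) (fn f) (fn g))
                   (carrier (und (rtensor k H (src f) (src g)))))
                (rtensor k H (tgt f) (tgt g))),
     UnitO = Hs_comod k H,
     Assoc = (\<lambda>M N P. Arrow (rtensor k H (rtensor k H M N) P)
                (restrict (rassoc k H M N P) (carrier (und (rtensor k H (rtensor k H M N) P))))
                (rtensor k H M (rtensor k H N P))),
     LUnit = (\<lambda>M. Arrow (rtensor k H (Hs_comod k H) M)
                (restrict
                  (tlift (und M) (\<lambda>y m. tlift (und M)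
                     (\<lambda>m0 m1. counit H (y \<otimes>\<^bsub>H\<^esub> m1) \<odot>\<^bsub>und M\<^esub> m0) (coact M m)))
                  (carrier (und (rtensor k H (Hs_comod k H) M)))) M),
     RUnit = (\<lambda>M. Arrow (rtensor k H M (Hs_comod k H))
                (restrict
                  (tlift (und M) (\<lambda>m y. tlift (und M)
                     (\<lambda>m0 m1. counit H (m1 \<otimes>\<^bsub>H\<^esub> y) \<odot>\<^bsub>und M\<^esub> m0) (coact M m)))
                  (carrier (und (rtensor k H M (Hs_comod k H))))) M)\<rparr>"


section \<open>The forgetful functor\<close>

definition U_arr :: "('u comod, 'u) arrow \<Rightarrow> (('u, 'u) module, 'u) arrow" where
  "U_arr f = Arrow (und (src f)) (fn f) (und (tgt f))"

definition U_mon :: "'u::infinite ring \<Rightarrow> 'u prebialg \<Rightarrow> 'u comod \<Rightarrow> 'u comod \<Rightarrow> (('u, 'u) module, 'u) arrow" where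
  "U_mon k H M N = (let T = tensor k (und M) (und N) in
     Arrow T (restrict (rpi k H M N) (carrier T)) (und (rtensor k H M N)))"

definition U_mon0 :: "'u::infinite ring \<Rightarrow> 'u prebialg \<Rightarrow> (('u, 'u) module, 'u) arrow" where
  "U_mon0 k H = Arrow (reg_module k) (\<lambda>x\<in>carrier k. x \<odot>\<^bsub>H\<^esub> \<one>\<^bsub>H\<^esub>) (und (Hs_comod k H))"

definition U_opmon :: "'u::infinite ring \<Rightarrow> 'u prebialg \<Rightarrow> 'u comod \<Rightarrow> 'u comod \<Rightarrow> (('u, 'u) module, 'u) arrow" where
  "U_opmon k H M N = (let R = und (rtensor k H M N) in
     Arrow R (restrict id (carrier R)) (tensor k (und M) (und N)))"

definition U_opmon0 :: "'u::infinite ring \<Rightarrow> 'u prebialg \<Rightarrow> (('u, 'u) module, 'u) arrow" where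
  "U_opmon0 k H = (let S = und (Hs_comod k H) in
     Arrow S (restrict (counit H) (carrier S)) (reg_module k))"

end

theory Submission
  imports Defs
begin

text \<open>
  The proof rests on a presentation of \<open>M \<otimes>\<^sup>r N\<close> by generators. It is the image of the idempotent \<open>\<pi>\<close> on
  \<open>M \<otimes> N\<close>, so it is spanned by the elements \<open>dot M N m n = \<pi>(m \<otimes> n)\<close>, and on these all structure looks as on
  an ordinary tensor product: the coaction is \<open>dot m\<^sub>0 n\<^sub>0 \<otimes> m\<^sub>1n\<^sub>1\<close> (\<open>sw_dot\<close>), the tensor product of comodule
  maps sends \<open>dot m n\<close> to \<open>dot (f m) (g n)\<close> (\<open>tmap_dot\<close>), and the associativity constraint sends
  \<open>dot (dot m n) p\<close> to \<open>dot m (dot n p)\<close> (\<open>rassoc_dot\<close>). As linear maps out of \<open>M \<otimes>\<^sup>r N\<close> are determined by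
  their values on generators (\<open>rtensor_ext\<close>), naturality, the pentagon and the coherence conditions for
  the functor become equations between such expressions.

  That the image of \<open>\<pi>\<close> is a comodule has a general reason. The coaction \<open>m\<^sub>0 \<otimes> n\<^sub>0 \<otimes> m\<^sub>1n\<^sub>1\<close> on \<open>M \<otimes> N\<close> is
  coassociative, because \<open>\<Delta>\<close> is multiplicative, but it is not counital. For every coassociative coaction \<open>\<rho>\<close>
  the map \<open>(id \<otimes> \<epsilon>)\<rho>\<close> is idempotent and \<open>\<rho>\<close> restricts to a counital coaction on its image. The unit object
  \<open>H\<^sub>s\<close> is treated in the same way, as the image of the idempotent \<open>\<epsilon>\<^sub>s\<close> of \<open>H\<close> (\<open>coaction_retract\<close>).

  The axioms (lc) and (rc) enter through \<open>H\<^sub>s\<close>. They say that \<open>\<Delta>(y)\<close> equals both \<open>1\<^sub>1 \<otimes> 1\<^sub>2y\<close> and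
  \<open>1\<^sub>1 \<otimes> y1\<^sub>2\<close> for \<open>y\<close> in \<open>H\<^sub>s\<close>, and they yield \<open>h\<^sub>1\<epsilon>(yh\<^sub>2) = yh\<close> and \<open>h\<^sub>1\<epsilon>(h\<^sub>2y) = hy\<close>
  (\<open>hsw_counit_mult\<close>). With \<open>y \<triangleright> m = \<epsilon>(ym\<^sub>1)m\<^sub>0\<close> and \<open>m \<triangleleft> y = \<epsilon>(m\<^sub>1y)m\<^sub>0\<close> it follows that
  \<open>dot (m \<triangleleft> y) n = dot m (y \<triangleright> n)\<close> (\<open>dot_balanced\<close>) and \<open>1 \<triangleleft> y = y = y \<triangleright> 1\<close>. The unit constraints are
  \<open>dot y m \<mapsto> y \<triangleright> m\<close> and \<open>dot m y \<mapsto> m \<triangleleft> y\<close>. The balancedness of \<open>dot\<close> is the triangle identity, and it shows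
  that \<open>m \<mapsto> dot 1 m\<close> and \<open>m \<mapsto> dot m 1\<close> are inverse to them.

  For the essential strength, the kernel of \<open>\<pi>\<close> has to be the submodule that defines \<open>M \<otimes>\<^sub>B N\<close> for
  \<open>B = H\<^sub>s\<close>, and the image of \<open>\<pi>\<close> has to be the equalizer that defines the cotensor product. One inclusion
  is in both cases a consequence of balancedness. For the other one, (lm) says that
  \<open>\<pi>(m \<otimes> n) = m \<triangleleft> 1\<^sub>1 \<otimes> 1\<^sub>2 \<triangleright> n\<close>, whereas \<open>m \<otimes> n = m \<otimes> 1\<^sub>1 \<triangleright> (1\<^sub>2 \<triangleright> n)\<close>. As \<open>1\<^sub>1\<close> lies in
  \<open>H\<^sub>s\<close>, the two sums agree modulo the balancing relations, and they agree on elements of the equalizer. Under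
  (rm) the same holds for \<open>\<pi>(m \<otimes> n) = m \<triangleleft> 1\<^sub>2 \<otimes> 1\<^sub>1 \<triangleright> n\<close> and \<open>m \<otimes> n = (m \<triangleleft> 1\<^sub>2) \<triangleleft> 1\<^sub>1 \<otimes> n\<close>.
\<close>

section \<open>Linear and bilinear maps\<close>

lemma linear_mapsI:
  assumes "\<And>x. x \<in> carrier M \<Longrightarrow> f x \<in> carrier N"
    and "\<And>x y. x \<in> carrier M \<Longrightarrow> y \<in> carrier M \<Longrightarrow> f (x \<oplus>\<^bsub>M\<^esub> y) = f x \<oplus>\<^bsub>N\<^esub> f y"
    and "\<And>a x. a \<in> carrier k \<Longrightarrow> x \<in> carrier M \<Longrightarrow> f (a \<odot>\<^bsub>M\<^esub> x) = a \<odot>\<^bsub>N\<^esub> f x"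
  shows "f \<in> linear_maps k M N"
  using assms by (simp add: linear_maps_def)

lemma linear_mapsD:
  assumes "f \<in> linear_maps k M N"
  shows "x \<in> carrier M \<Longrightarrow> f x \<in> carrier N"
    and "x \<in> carrier M \<Longrightarrow> y \<in> carrier M \<Longrightarrow> f (x \<oplus>\<^bsub>M\<^esub> y) = f x \<oplus>\<^bsub>N\<^esub> f y"
    and "a \<in> carrier k \<Longrightarrow> x \<in> carrier M \<Longrightarrow> f (a \<odot>\<^bsub>M\<^esub> x) = a \<odot>\<^bsub>N\<^esub> f x"
  using assms by (auto simp: linear_maps_def)

lemma linear_maps_cong:
  assumes "f \<in> linear_maps k M N" "Module.module k M" "\<And>x. x \<in> carrier M \<Longrightarrow> f x = g x"
  shows "g \<in> linear_maps k M N"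
proof -
  interpret Module.module k M by fact
  show ?thesis using assms
    by (intro linear_mapsI) (simp_all add: linear_mapsD flip: assms(3))
qed

context cring
begin

lemmas scalar_simps = m_closed a_closed one_closed zero_closed l_one r_one

end

context Module.module
begin

lemmas module_simps = M.a_closed M.zero_closed smult_closed smult_one M.l_zero M.r_zero
  smult_r_null smult_l_null
lemmas add_assoc = M.a_assoc
lemmas add_comm = M.a_comm
lemmas add_lcomm = M.a_lcomm

lemma smult_comm:
  "a \<in> carrier R \<Longrightarrow> b \<in> carrier R \<Longrightarrow> x \<in> carrier M \<Longrightarrow> a \<odot>\<^bsub>M\<^esub> (b \<odot>\<^bsub>M\<^esub> x) = b \<odot>\<^bsub>M\<^esub> (a \<odot>\<^bsub>M\<^esub> x)"
  by (simp add: m_comm flip: smult_assoc1)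

end

text \<open>
  The rules in \<open>lin\<close> are syntax-directed: each of them removes the outermost operation from an expression that
  depends linearly on the bound variable. They decide the multilinearity of nested Sweedler expressions.
\<close>

named_theorems lin

locale base =
  fixes k :: "'u::infinite ring"
  assumes cring_k: "cring k"
begin

abbreviation "kmod \<equiv> Module.module k"
abbreviation "Lin \<equiv> linear_maps k"
abbreviation Tensor (infixr \<open>\<boxtimes>\<close> 70) where "M \<boxtimes> N \<equiv> tensor k M N"
abbreviation "K \<equiv> reg_module k"

lemmas scalar_simps [simp] = cring.scalar_simps [OF cring_k]

lemmas module_simps [simp] = module.module_simps [of k]
lemmas module_add_assoc = module.add_assoc [of k]
lemmas module_add_comm = module.add_comm [of k]
lemmas module_add_lcomm = module.add_lcomm [of k]
lemmas module_smult_add = Module.module.smult_r_distr [of k]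
lemmas module_add_smult = Module.module.smult_l_distr [of k]
lemmas module_smult_smult = Module.module.smult_assoc1 [of k]
lemmas module_smult_comm = module.smult_comm [of k]
lemmas module_rules = module_add_assoc module_add_comm module_add_lcomm module_smult_add
  module_add_smult module_smult_smult module_smult_comm

lemma add_neg_one:
  assumes "kmod M" "x \<in> carrier M"
  shows "x \<oplus>\<^bsub>M\<^esub> ((\<ominus>\<^bsub>k\<^esub> \<one>\<^bsub>k\<^esub>) \<odot>\<^bsub>M\<^esub> x) = \<zero>\<^bsub>M\<^esub>"
proof -
  interpret Module.module k M by fact
  show ?thesis using assms(2) by (simp add: smult_l_minus M.r_neg)
qed

lemma neg_one_closed [simp]: "\<ominus>\<^bsub>k\<^esub> \<one>\<^bsub>k\<^esub> \<in> carrier k"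
proof -
  interpret cring k by (rule cring_k)
  show ?thesis by simp
qed

lemma kmod_reg [simp]: "kmod K"
proof -
  interpret cring k by (rule cring_k)
  have "x \<oplus>\<^bsub>k\<^esub> (\<ominus>\<^bsub>k\<^esub> x) = \<zero>\<^bsub>k\<^esub>" if "x \<in> carrier k" for x using that by (rule r_neg)
  then show ?thesis
    by (intro moduleI abelian_groupI)
      (auto simp: reg_module_def cring_k a_ac m_assoc l_distr r_distr intro: a_inv_closed l_neg)
qed

lemma reg_simps [simp]:
  "carrier K = carrier k" "zero K = zero k" "add K = add k" "smult K = mult k"
  by (simp_all add: reg_module_def)

lemma lin_zero: "f \<in> Lin M N \<Longrightarrow> kmod M \<Longrightarrow> kmod N \<Longrightarrow> f \<zero>\<^bsub>M\<^esub> = \<zero>\<^bsub>N\<^esub>"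
  by (metis linear_mapsD(1,3) module_simps(2,8) scalar_simps(4))

lemma lin_id [lin]: "(\<lambda>x. x) \<in> Lin M M"
  by (rule linear_mapsI) auto

lemma lin_comp: "g \<in> Lin N P \<Longrightarrow> f \<in> Lin M N \<Longrightarrow> (\<lambda>x. g (f x)) \<in> Lin M P"
  by (rule linear_mapsI) (auto simp: linear_mapsD)

lemma lin_smult1 [lin]:
  "f \<in> Lin A K \<Longrightarrow> m \<in> carrier P \<Longrightarrow> kmod P \<Longrightarrow> (\<lambda>x. f x \<odot>\<^bsub>P\<^esub> m) \<in> Lin A P"
  using linear_mapsD(1)[of f k A K] linear_mapsD(2,3)[of f k A K]
  by (intro linear_mapsI) (auto simp: module_rules)

lemma lin_smult2 [lin]:
  "a \<in> carrier k \<Longrightarrow> f \<in> Lin A P \<Longrightarrow> kmod P \<Longrightarrow> (\<lambda>x. a \<odot>\<^bsub>P\<^esub> f x) \<in> Lin A P"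
  using linear_mapsD(1)[of f k A P] linear_mapsD(2,3)[of f k A P]
  by (intro linear_mapsI) (auto simp: module_smult_add module_smult_comm)

definition bilin where
  "bilin M N P \<beta> \<longleftrightarrow> (\<forall>n\<in>carrier N. (\<lambda>m. \<beta> m n) \<in> Lin M P) \<and> (\<forall>m\<in>carrier M. (\<lambda>n. \<beta> m n) \<in> Lin N P)"

lemma bilinI [lin]:
  "\<lbrakk>\<And>n. n \<in> carrier N \<Longrightarrow> (\<lambda>m. \<beta> m n) \<in> Lin M P; \<And>m. m \<in> carrier M \<Longrightarrow> (\<lambda>n. \<beta> m n) \<in> Lin N P\<rbrakk>
    \<Longrightarrow> bilin M N P \<beta>"
  by (simp add: bilin_def)

lemma bilinD:
  assumes "bilin M N P \<beta>"
  shows "n \<in> carrier N \<Longrightarrow> (\<lambda>m. \<beta> m n) \<in> Lin M P" "m \<in> carrier M \<Longrightarrow> \<beta> m \<in> Lin N P"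
  using assms by (auto simp: bilin_def)

lemma bilin_closed: "bilin M N P \<beta> \<Longrightarrow> m \<in> carrier M \<Longrightarrow> n \<in> carrier N \<Longrightarrow> \<beta> m n \<in> carrier P"
  by (meson bilinD(2) linear_mapsD(1))

lemma bilin_Pi: "bilin M N P \<beta> \<Longrightarrow> \<beta> \<in> carrier M \<rightarrow> carrier N \<rightarrow> carrier P"
  by (auto simp: bilin_closed)

lemma bilin_simps:
  assumes "bilin M N P \<beta>"
  shows "m \<in> carrier M \<Longrightarrow> m' \<in> carrier M \<Longrightarrow> n \<in> carrier N \<Longrightarrow> \<beta> (m \<oplus>\<^bsub>M\<^esub> m') n = \<beta> m n \<oplus>\<^bsub>P\<^esub> \<beta> m' n"
    and "m \<in> carrier M \<Longrightarrow> n \<in> carrier N \<Longrightarrow> n' \<in> carrier N \<Longrightarrow> \<beta> m (n \<oplus>\<^bsub>N\<^esub> n') = \<beta> m n \<oplus>\<^bsub>P\<^esub> \<beta> m n'"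
    and "a \<in> carrier k \<Longrightarrow> m \<in> carrier M \<Longrightarrow> n \<in> carrier N \<Longrightarrow> \<beta> (a \<odot>\<^bsub>M\<^esub> m) n = a \<odot>\<^bsub>P\<^esub> \<beta> m n"
    and "a \<in> carrier k \<Longrightarrow> m \<in> carrier M \<Longrightarrow> n \<in> carrier N \<Longrightarrow> \<beta> m (a \<odot>\<^bsub>N\<^esub> n) = a \<odot>\<^bsub>P\<^esub> \<beta> m n"
  using linear_mapsD[OF bilinD(1)[OF assms]] linear_mapsD[OF bilinD(2)[OF assms]] by auto

section \<open>Tensor products\<close>

declare in_listsD [rule del] in_listsI [rule del]

abbreviation "pairs M N \<equiv> lists (carrier M \<times> carrier N)"

lemma tensor_eq_pairs:
  assumes "kmod M" "kmod N" "tensor_eq k M N xs ys"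
  shows "xs \<in> pairs M N \<and> ys \<in> pairs M N"
  using assms(3) by induction (use assms(1,2) in auto)

lemma tclass_eqI: "tensor_eq k M N xs ys \<Longrightarrow> tclass k M N xs = tclass k M N ys"
proof -
  assume "tensor_eq k M N xs ys"
  then have "tensor_eq k M N xs = tensor_eq k M N ys"
    by (intro ext) (meson tensor_eq.sym tensor_eq.trans)
  then show ?thesis by (simp add: tclass_def)
qed

lemma tdecode_tclass: "xs \<in> pairs M N \<Longrightarrow> tensor_eq k M N xs (tdecode (tclass k M N xs))"
  unfolding tclass_def tdecode_def inv_into_f_f[OF inj_tcode UNIV_I]
  by (rule someI[where x = xs]) (rule tensor_eq.refl)

definition fsum where
  "fsum P \<beta> xs = foldr (\<lambda>(m, n) s. \<beta> m n \<oplus>\<^bsub>P\<^esub> s) xs \<zero>\<^bsub>P\<^esub>"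

lemma fsum_simps [simp]:
  "fsum P \<beta> [] = \<zero>\<^bsub>P\<^esub>" "fsum P \<beta> ((m, n) # xs) = \<beta> m n \<oplus>\<^bsub>P\<^esub> fsum P \<beta> xs"
  by (simp_all add: fsum_def)

lemma tlift_fsum: "tlift P \<beta> t = fsum P \<beta> (tdecode t)"
  by (simp add: tlift_def fsum_def)

lemma Pi2_mem: "\<beta> \<in> A \<rightarrow> B \<rightarrow> C \<Longrightarrow> a \<in> A \<Longrightarrow> b \<in> B \<Longrightarrow> \<beta> a b \<in> C"
  by auto

lemma fsum_closed:
  "kmod P \<Longrightarrow> \<beta> \<in> carrier M \<rightarrow> carrier N \<rightarrow> carrier P \<Longrightarrow> xs \<in> pairs M N \<Longrightarrow> fsum P \<beta> xs \<in> carrier P"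
  by (induction xs) (auto simp: Pi2_mem)

lemma fsum_append:
  assumes "kmod P" and \<beta>: "\<beta> \<in> carrier M \<rightarrow> carrier N \<rightarrow> carrier P"
    and "xs \<in> pairs M N" "ys \<in> pairs M N"
  shows "fsum P \<beta> (xs @ ys) = fsum P \<beta> xs \<oplus>\<^bsub>P\<^esub> fsum P \<beta> ys"
  using assms(3)
proof (induction xs)
  case Nil
  then show ?case using fsum_closed[OF assms(1) \<beta> assms(4)] assms(1) by simp
next
  case (Cons x xs)
  obtain m n where "x = (m, n)" by force
  moreover from this have "\<beta> m n \<in> carrier P" using \<beta> Cons by (auto dest!: funcset_mem)
  ultimately show ?case
    using Cons fsum_closed[OF assms(1) \<beta> assms(4)] fsum_closed[OF assms(1) \<beta>, of xs] assms(1)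
    by (simp add: module_add_assoc)
qed

lemma fsum_tensor_eq:
  assumes M: "kmod M" "kmod N" and P: "kmod P" and \<beta>: "bilin M N P \<beta>" and "tensor_eq k M N xs ys"
  shows "fsum P \<beta> xs = fsum P \<beta> ys"
  using assms(5)
proof induction
  case (append xs xs' ys ys')
  then show ?case
    using tensor_eq_pairs[OF M] fsum_append[OF P bilin_Pi[OF \<beta>]] by metis
next
  case (commute xs ys)
  then show ?case
    using fsum_append[OF P bilin_Pi[OF \<beta>]] fsum_closed[OF P bilin_Pi[OF \<beta>]]
      module_add_comm[OF P] by metis
next
  case (zero n)
  have "\<beta> (\<zero>\<^bsub>k\<^esub> \<odot>\<^bsub>M\<^esub> \<zero>\<^bsub>M\<^esub>) n = \<zero>\<^bsub>k\<^esub> \<odot>\<^bsub>P\<^esub> \<beta> \<zero>\<^bsub>M\<^esub> n"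
    using zero M by (intro bilin_simps[OF \<beta>]) auto
  then show ?case using zero M P bilin_closed[OF \<beta>, of "\<zero>\<^bsub>M\<^esub>" n] by simp
qed (use bilin_simps[OF \<beta>] bilin_closed[OF \<beta>] M P in \<open>simp_all add: module_add_assoc\<close>)

lemma carrier_tensor: "carrier (M \<boxtimes> N) = tclass k M N ` pairs M N"
  by (simp add: tensor_def)

lemma tdecode_pairs:
  assumes "kmod M" "kmod N" "t \<in> carrier (M \<boxtimes> N)"
  shows "tdecode t \<in> pairs M N"
  using assms tensor_eq_pairs[OF assms(1,2) tdecode_tclass] by (auto simp: carrier_tensor)

lemma tclass_append:
  assumes "kmod M" "kmod N" "xs \<in> pairs M N" "ys \<in> pairs M N"
  shows "tclass k M N xs \<oplus>\<^bsub>M \<boxtimes> N\<^esub> tclass k M N ys = tclass k M N (xs @ ys)"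
  unfolding tensor_def using assms
  by (auto intro!: tclass_eqI tensor_eq.append intro: tensor_eq.sym[OF tdecode_tclass])

lemma tensor_zero: "\<zero>\<^bsub>M \<boxtimes> N\<^esub> = tclass k M N []"
  by (simp add: tensor_def)

lemma map_pairs: "(\<And>m. m \<in> carrier M \<Longrightarrow> h m \<in> carrier M) \<Longrightarrow> xs \<in> pairs M N \<Longrightarrow> map (\<lambda>(m, n). (h m, n)) xs \<in> pairs M N"
  by (induction xs) auto

lemma tensor_eq_smult:
  assumes "kmod M" "kmod N" "a \<in> carrier k" "tensor_eq k M N xs ys"
  shows "tensor_eq k M N (map (\<lambda>(m, n). (a \<odot>\<^bsub>M\<^esub> m, n)) xs) (map (\<lambda>(m, n). (a \<odot>\<^bsub>M\<^esub> m, n)) ys)"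
proof -
  have map: "map (\<lambda>(m, n). (a \<odot>\<^bsub>M\<^esub> m, n)) xs \<in> pairs M N" if "xs \<in> pairs M N" for xs
    using that assms by (intro map_pairs) auto
  show ?thesis using assms(4)
  proof induction
    case (refl xs)
    then show ?case by (intro tensor_eq.refl map)
  next
    case (commute xs ys)
    then show ?case by (simp only: map_append) (intro tensor_eq.commute map)
  next
    case (append xs xs' ys ys')
    then show ?case by (simp add: tensor_eq.append)
  next
    case (scalar b m n)
    then show ?case using assms(1,2,3) tensor_eq.scalar[of b k "a \<odot>\<^bsub>M\<^esub> m" M n N]
      by (simp add: module_smult_comm)
  qed (use assms(1,2,3) in \<open>auto simp: module_smult_add intro: tensor_eq.intros\<close>)
qed

lemma tclass_smult:
  assumes "kmod M" "kmod N" "xs \<in> pairs M N" "a \<in> carrier k"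
  shows "a \<odot>\<^bsub>M \<boxtimes> N\<^esub> tclass k M N xs = tclass k M N (map (\<lambda>(m, n). (a \<odot>\<^bsub>M\<^esub> m, n)) xs)"
  unfolding tensor_def using assms
  by (auto intro!: tclass_eqI tensor_eq_smult intro: tensor_eq.sym[OF tdecode_tclass])

lemma tensor_eq_zero_map:
  assumes "kmod M" "kmod N" "xs \<in> pairs M N"
  shows "tensor_eq k M N (map (\<lambda>(m, n). (\<zero>\<^bsub>M\<^esub>, n)) xs) []"
  using assms(3)
proof (induction xs)
  case Nil
  then show ?case by (auto intro: tensor_eq.refl)
next
  case (Cons x xs)
  then have "tensor_eq k M N ([(\<zero>\<^bsub>M\<^esub>, snd x)] @ map (\<lambda>(m, n). (\<zero>\<^bsub>M\<^esub>, n)) xs) ([] @ [])"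
    by (intro tensor_eq.append tensor_eq.zero) auto
  then show ?case by (simp add: case_prod_unfold)
qed

text \<open>
  With two scalar multiplications for \<open>f\<close> and \<open>g\<close> this is the distributivity of scalars over formal sums; with
  \<open>-1\<close> and \<open>1\<close> it provides additive inverses.
\<close>

lemma tensor_eq_add_map:
  assumes "kmod M" "kmod N" "xs \<in> pairs M N"
    and "\<And>m. m \<in> carrier M \<Longrightarrow> f m \<in> carrier M" "\<And>m. m \<in> carrier M \<Longrightarrow> g m \<in> carrier M"
  shows "tensor_eq k M N (map (\<lambda>(m, n). (f m \<oplus>\<^bsub>M\<^esub> g m, n)) xs)
    (map (\<lambda>(m, n). (f m, n)) xs @ map (\<lambda>(m, n). (g m, n)) xs)"
  using assms(3)
proof (induction xs)
  case Nil
  then show ?case by (auto intro: tensor_eq.refl)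
next
  case (Cons x xs)
  obtain m n where x: "x = (m, n)" by force
  have mn: "m \<in> carrier M" "n \<in> carrier N" using Cons x by auto
  have l: "map (\<lambda>(m, n). (h m, n)) xs \<in> pairs M N" if "\<And>m. m \<in> carrier M \<Longrightarrow> h m \<in> carrier M" for h
    using that Cons by (intro map_pairs) auto
  have "tensor_eq k M N ([(f m \<oplus>\<^bsub>M\<^esub> g m, n)] @ map (\<lambda>(m, n). (f m \<oplus>\<^bsub>M\<^esub> g m, n)) xs)
     ([(f m, n), (g m, n)] @ (map (\<lambda>(m, n). (f m, n)) xs @ map (\<lambda>(m, n). (g m, n)) xs))"
    using Cons x mn assms(4,5) by (intro tensor_eq.append tensor_eq.add_left) auto
  moreover have "tensor_eq k M N (([(f m, n)] @ ([(g m, n)] @ map (\<lambda>(m, n). (f m, n)) xs)) @ map (\<lambda>(m, n). (g m, n)) xs)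
     (([(f m, n)] @ (map (\<lambda>(m, n). (f m, n)) xs @ [(g m, n)])) @ map (\<lambda>(m, n). (g m, n)) xs)"
    using mn assms(4,5) l[of f] l[of g] by (intro tensor_eq.append tensor_eq.refl tensor_eq.commute) auto
  ultimately show ?case by (auto simp: x intro: tensor_eq.trans)
qed

lemma kmod_tensor [simp]:
  assumes M: "kmod M" "kmod N"
  shows "kmod (M \<boxtimes> N)"
proof -
  let ?c = "tclass k M N" and ?s = "\<lambda>a. map (\<lambda>(m, n). (a \<odot>\<^bsub>M\<^esub> m, n))"
  have s: "?s a xs \<in> pairs M N" if "a \<in> carrier k" "xs \<in> pairs M N" for a xs
    using that M by (intro map_pairs) auto
  have c: "tensor_eq k M N (xs @ ys) (ys @ xs)" if "xs \<in> pairs M N" "ys \<in> pairs M N" for xs ys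
    using that by (rule tensor_eq.commute)
  have neg: "?c (?s (\<ominus>\<^bsub>k\<^esub> \<one>\<^bsub>k\<^esub>) xs @ xs) = ?c []" if xs: "xs \<in> pairs M N" for xs
  proof -
    have "tensor_eq k M N (map (\<lambda>(m, n). ((\<ominus>\<^bsub>k\<^esub> \<one>\<^bsub>k\<^esub>) \<odot>\<^bsub>M\<^esub> m \<oplus>\<^bsub>M\<^esub> m, n)) xs)
       (?s (\<ominus>\<^bsub>k\<^esub> \<one>\<^bsub>k\<^esub>) xs @ map (\<lambda>(m, n). (m, n)) xs)"
      using xs M by (intro tensor_eq_add_map) auto
    moreover have "map (\<lambda>(m, n). ((\<ominus>\<^bsub>k\<^esub> \<one>\<^bsub>k\<^esub>) \<odot>\<^bsub>M\<^esub> m \<oplus>\<^bsub>M\<^esub> m, n)) xs = map (\<lambda>(m, n). (\<zero>\<^bsub>M\<^esub>, n)) xs"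
      using xs M add_neg_one[OF M(1)]
      by (intro map_cong) (auto simp: module_add_comm[OF M(1)] dest!: in_listsD)
    ultimately have "tensor_eq k M N (map (\<lambda>(m, n). (\<zero>\<^bsub>M\<^esub>, n)) xs) (?s (\<ominus>\<^bsub>k\<^esub> \<one>\<^bsub>k\<^esub>) xs @ xs)"
      by simp
    from tclass_eqI[OF this] tclass_eqI[OF tensor_eq_zero_map[OF M xs]] show ?thesis
      by (simp only:)
  qed
  have "abelian_group (M \<boxtimes> N)"
  proof (rule abelian_groupI)
    show "\<exists>y\<in>carrier (M \<boxtimes> N). y \<oplus>\<^bsub>M \<boxtimes> N\<^esub> x = \<zero>\<^bsub>M \<boxtimes> N\<^esub>" if x: "x \<in> carrier (M \<boxtimes> N)" for x
    proof -
      obtain xs where xs: "xs \<in> pairs M N" "x = ?c xs" using x unfolding carrier_tensor by blast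
      have s: "?s (\<ominus>\<^bsub>k\<^esub> \<one>\<^bsub>k\<^esub>) xs \<in> pairs M N" using xs by (intro s) auto
      then have "?c (?s (\<ominus>\<^bsub>k\<^esub> \<one>\<^bsub>k\<^esub>) xs) \<oplus>\<^bsub>M \<boxtimes> N\<^esub> x = \<zero>\<^bsub>M \<boxtimes> N\<^esub>"
        using neg[OF xs(1)] tclass_append[OF M s xs(1)] xs(2) by (simp only: tensor_zero)
      moreover have "?c (?s (\<ominus>\<^bsub>k\<^esub> \<one>\<^bsub>k\<^esub>) xs) \<in> carrier (M \<boxtimes> N)"
        unfolding carrier_tensor using s by (rule imageI)
      ultimately show ?thesis by blast
    qed
  qed (use M in \<open>auto simp: carrier_tensor tclass_append tensor_zero intro!: tclass_eqI c\<close>)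
  moreover have "tensor_eq k M N (?s (a \<oplus>\<^bsub>k\<^esub> b) xs) (?s a xs @ ?s b xs)"
    if "a \<in> carrier k" "b \<in> carrier k" "xs \<in> pairs M N" for a b xs
  proof -
    have e: "?s (a \<oplus>\<^bsub>k\<^esub> b) xs = map (\<lambda>(m, n). (a \<odot>\<^bsub>M\<^esub> m \<oplus>\<^bsub>M\<^esub> b \<odot>\<^bsub>M\<^esub> m, n)) xs"
      using that M by (intro map_cong) (auto simp: module_add_smult dest!: in_listsD)
    show ?thesis unfolding e using that M by (intro tensor_eq_add_map) auto
  qed
  moreover have "?s (a \<otimes>\<^bsub>k\<^esub> b) xs = ?s a (?s b xs)"
    if "a \<in> carrier k" "b \<in> carrier k" "xs \<in> pairs M N" for a b xs
    using that(3) by (induction xs) (use that(1,2) M in \<open>auto simp: module_smult_smult\<close>)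
  moreover have "?s \<one>\<^bsub>k\<^esub> xs = xs" if "xs \<in> pairs M N" for xs
    using that by (induction xs) (use M in auto)
  ultimately show ?thesis
    using cring_k M s
    by (intro moduleI) (auto simp: carrier_tensor tclass_smult tclass_append simp del: map_map intro!: tclass_eqI)
qed

lemma tens_closed [simp]: "m \<in> carrier M \<Longrightarrow> n \<in> carrier N \<Longrightarrow> tens k M N m n \<in> carrier (M \<boxtimes> N)"
  by (auto simp: tens_def carrier_tensor)

lemma bilin_tens: "kmod M \<Longrightarrow> kmod N \<Longrightarrow> bilin M N (M \<boxtimes> N) (tens k M N)"
  unfolding tens_def
  by (intro bilinI linear_mapsI)
    (auto simp: carrier_tensor tclass_append tclass_smult intro!: tclass_eqI intro: tensor_eq.intros)

lemma lin_tens1 [lin]: "f \<in> Lin A M \<Longrightarrow> n \<in> carrier N \<Longrightarrow> kmod M \<Longrightarrow> kmod N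
    \<Longrightarrow> (\<lambda>x. tens k M N (f x) n) \<in> Lin A (M \<boxtimes> N)"
  using lin_comp[OF bilinD(1)[OF bilin_tens]] by blast

lemma lin_tens2 [lin]: "m \<in> carrier M \<Longrightarrow> f \<in> Lin A N \<Longrightarrow> kmod M \<Longrightarrow> kmod N
    \<Longrightarrow> (\<lambda>x. tens k M N m (f x)) \<in> Lin A (M \<boxtimes> N)"
  using lin_comp[OF bilinD(2)[OF bilin_tens]] by blast

lemma tlift_tens:
  assumes "kmod M" "kmod N" "kmod P" "bilin M N P \<beta>" "m \<in> carrier M" "n \<in> carrier N"
  shows "tlift P \<beta> (tens k M N m n) = \<beta> m n"
proof -
  have "fsum P \<beta> (tdecode (tens k M N m n)) = fsum P \<beta> [(m, n)]"
    using assms unfolding tens_def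
    by (intro fsum_tensor_eq[of M N]) (auto intro: tensor_eq.sym[OF tdecode_tclass])
  then show ?thesis using assms bilin_closed[OF assms(4)] by (simp add: tlift_fsum)
qed

lemma tlift_closed:
  assumes "kmod M" "kmod N" "kmod P" "\<And>m n. m \<in> carrier M \<Longrightarrow> n \<in> carrier N \<Longrightarrow> \<beta> m n \<in> carrier P"
    "t \<in> carrier (M \<boxtimes> N)"
  shows "tlift P \<beta> t \<in> carrier P"
  unfolding tlift_fsum using assms(4) tdecode_pairs[OF assms(1,2,5)] by (intro fsum_closed[OF assms(3)]) auto

lemma tlift_cong:
  assumes "kmod M" "kmod N" "\<And>m n. m \<in> carrier M \<Longrightarrow> n \<in> carrier N \<Longrightarrow> \<beta> m n = \<gamma> m n"
    "t \<in> carrier (M \<boxtimes> N)"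
  shows "tlift P \<beta> t = tlift P \<gamma> t"
proof -
  have "fsum P \<beta> xs = fsum P \<gamma> xs" if "xs \<in> pairs M N" for xs
    using that by (induction xs) (auto simp: assms(3))
  then show ?thesis using tdecode_pairs[OF assms(1,2,4)] by (simp add: tlift_fsum)
qed

text \<open>
  \<open>tlift P \<beta> t\<close> is a finite sum of values of \<open>\<beta>\<close> over a representative of \<open>t\<close>, so a linear map moves inside.
\<close>

lemma lin_push:
  assumes "kmod M" "kmod N" "kmod P" "kmod Q" and \<beta>: "\<And>m n. m \<in> carrier M \<Longrightarrow> n \<in> carrier N \<Longrightarrow> \<beta> m n \<in> carrier P"
    and f: "f \<in> Lin P Q" and t: "t \<in> carrier (M \<boxtimes> N)"
  shows "f (tlift P \<beta> t) = tlift Q (\<lambda>m n. f (\<beta> m n)) t"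
proof -
  have Pi: "\<beta> \<in> carrier M \<rightarrow> carrier N \<rightarrow> carrier P" using \<beta> by auto
  have "f (fsum P \<beta> xs) = fsum Q (\<lambda>m n. f (\<beta> m n)) xs" if "xs \<in> pairs M N" for xs
    using that
  proof (induction xs)
    case Nil
    then show ?case using lin_zero[OF f assms(3,4)] by simp
  next
    case (Cons x xs)
    obtain m n where "x = (m, n)" by force
    with Cons show ?case using \<beta>[of m n] fsum_closed[OF assms(3) Pi, of xs]
      by (simp add: linear_mapsD[OF f])
  qed
  then show ?thesis using tdecode_pairs[OF assms(1,2) t] by (simp add: tlift_fsum)
qed

lemma fsum_add:
  assumes P: "kmod P" and \<beta>: "\<beta> \<in> carrier M \<rightarrow> carrier N \<rightarrow> carrier P"
    and \<gamma>: "\<gamma> \<in> carrier M \<rightarrow> carrier N \<rightarrow> carrier P" and "xs \<in> pairs M N"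
  shows "fsum P (\<lambda>m n. \<beta> m n \<oplus>\<^bsub>P\<^esub> \<gamma> m n) xs = fsum P \<beta> xs \<oplus>\<^bsub>P\<^esub> fsum P \<gamma> xs"
  using assms(4)
proof (induction xs)
  case Nil
  then show ?case using P by simp
next
  case (Cons x xs)
  obtain m n where x: "x = (m, n)" by force
  have "\<beta> m n \<in> carrier P" "\<gamma> m n \<in> carrier P" using \<beta> \<gamma> Cons x by (auto dest!: funcset_mem)
  with Cons x show ?case using fsum_closed[OF P \<beta>, of xs] fsum_closed[OF P \<gamma>, of xs] P
    by (simp add: module_add_assoc module_add_lcomm)
qed

lemma tlift_add:
  assumes "kmod M" "kmod N" "kmod P" "\<And>m n. m \<in> carrier M \<Longrightarrow> n \<in> carrier N \<Longrightarrow> \<beta> m n \<in> carrier P"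
   "\<And>m n. m \<in> carrier M \<Longrightarrow> n \<in> carrier N \<Longrightarrow> \<gamma> m n \<in> carrier P" "t \<in> carrier (M \<boxtimes> N)"
  shows "tlift P (\<lambda>m n. \<beta> m n \<oplus>\<^bsub>P\<^esub> \<gamma> m n) t = tlift P \<beta> t \<oplus>\<^bsub>P\<^esub> tlift P \<gamma> t"
  unfolding tlift_fsum using assms(4,5) tdecode_pairs[OF assms(1,2,6)] by (intro fsum_add[OF assms(3)]) auto

lemma tlift_zero:
  assumes "kmod M" "kmod N" "kmod P" "t \<in> carrier (M \<boxtimes> N)"
  shows "tlift P (\<lambda>m n. \<zero>\<^bsub>P\<^esub>) t = \<zero>\<^bsub>P\<^esub>"
proof -
  have "fsum P (\<lambda>m n. \<zero>\<^bsub>P\<^esub>) xs = \<zero>\<^bsub>P\<^esub>" for xs :: "('u \<times> 'u) list"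
    by (induction xs) (use assms in auto)
  then show ?thesis by (simp add: tlift_fsum)
qed

lemma tlift_swap:
  assumes "kmod M" "kmod N" "kmod M'" "kmod N'" "kmod P"
   "\<And>m n m' n'. m \<in> carrier M \<Longrightarrow> n \<in> carrier N \<Longrightarrow> m' \<in> carrier M' \<Longrightarrow> n' \<in> carrier N' \<Longrightarrow> \<beta> m n m' n' \<in> carrier P"
   "s \<in> carrier (M \<boxtimes> N)" "t \<in> carrier (M' \<boxtimes> N')"
  shows "tlift P (\<lambda>m n. tlift P (\<beta> m n) t) s = tlift P (\<lambda>m' n'. tlift P (\<lambda>m n. \<beta> m n m' n') s) t"
proof -
  have "fsum P (\<lambda>m n. tlift P (\<beta> m n) t) xs = tlift P (\<lambda>m' n'. fsum P (\<lambda>m n. \<beta> m n m' n') xs) t"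
    if "xs \<in> pairs M N" for xs
    using that
  proof (induction xs)
    case Nil
    then show ?case using assms tlift_zero[of M' N' P t] by simp
  next
    case (Cons x xs)
    obtain m n where "x = (m, n)" by force
    moreover have "fsum P (\<lambda>m n. \<beta> m n m' n') xs \<in> carrier P" if "m' \<in> carrier M'" "n' \<in> carrier N'" for m' n'
      using Cons that assms(6) by (intro fsum_closed[OF assms(5)]) auto
    ultimately show ?case using Cons assms(6)
      by (simp add: tlift_add[OF assms(3,4,5) _ _ assms(8)])
  qed
  then show ?thesis using assms tdecode_pairs[of M N s] by (simp add: tlift_fsum)
qed

lemma lin_tlift:
  assumes "kmod M" "kmod N" "kmod P" "bilin M N P \<beta>"
  shows "tlift P \<beta> \<in> Lin (M \<boxtimes> N) P"
proof (rule linear_mapsI)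
  fix s t assume st: "s \<in> carrier (M \<boxtimes> N)" "t \<in> carrier (M \<boxtimes> N)"
  have "fsum P \<beta> (tdecode (s \<oplus>\<^bsub>M \<boxtimes> N\<^esub> t)) = fsum P \<beta> (tdecode s @ tdecode t)"
    using tdecode_pairs[OF assms(1,2)] st unfolding tensor_def
    by (intro fsum_tensor_eq[OF assms]) (auto intro: tensor_eq.sym[OF tdecode_tclass])
  then show "tlift P \<beta> (s \<oplus>\<^bsub>M \<boxtimes> N\<^esub> t) = tlift P \<beta> s \<oplus>\<^bsub>P\<^esub> tlift P \<beta> t"
    using fsum_append[OF assms(3) bilin_Pi[OF assms(4)]] tdecode_pairs[OF assms(1,2)] st
    by (simp add: tlift_fsum)
next
  fix a t assume at: "a \<in> carrier k" "t \<in> carrier (M \<boxtimes> N)"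
  let ?s = "map (\<lambda>(m, n). (a \<odot>\<^bsub>M\<^esub> m, n)) (tdecode t)"
  have "?s \<in> pairs M N" using at assms(1) tdecode_pairs[OF assms(1,2)] by (intro map_pairs) auto
  then have "fsum P \<beta> (tdecode (a \<odot>\<^bsub>M \<boxtimes> N\<^esub> t)) = fsum P \<beta> ?s"
    using assms at unfolding tensor_def
    by (intro fsum_tensor_eq[of M N]) (auto intro: tensor_eq.sym[OF tdecode_tclass] simp del: map_map)
  moreover have "fsum P \<beta> (map (\<lambda>(m, n). (a \<odot>\<^bsub>M\<^esub> m, n)) xs) = a \<odot>\<^bsub>P\<^esub> fsum P \<beta> xs" if "xs \<in> pairs M N" for xs
    using that
  proof (induction xs)
    case (Cons x xs)
    obtain m n where "x = (m, n)" by force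
    with Cons show ?case using at(1) assms bilin_closed[OF assms(4)]
      fsum_closed[OF assms(3) bilin_Pi[OF assms(4)], of xs]
      by (simp add: module_smult_add bilin_simps[OF assms(4)])
  qed (use assms at in simp)
  ultimately show "tlift P \<beta> (a \<odot>\<^bsub>M \<boxtimes> N\<^esub> t) = a \<odot>\<^bsub>P\<^esub> tlift P \<beta> t"
    using tdecode_pairs[OF assms(1,2) at(2)] by (simp add: tlift_fsum)
qed (use assms bilin_closed[OF assms(4)] in \<open>blast intro: tlift_closed\<close>)

lemma tensor_induct [consumes 3, case_names zero add]:
  assumes M: "kmod M" "kmod N" and t: "t \<in> carrier (M \<boxtimes> N)"
    and zero: "Q \<zero>\<^bsub>M \<boxtimes> N\<^esub>"
    and add: "\<And>m n t. m \<in> carrier M \<Longrightarrow> n \<in> carrier N \<Longrightarrow> t \<in> carrier (M \<boxtimes> N) \<Longrightarrow> Q t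
      \<Longrightarrow> Q (tens k M N m n \<oplus>\<^bsub>M \<boxtimes> N\<^esub> t)"
  shows "Q t"
proof -
  have "Q (tclass k M N xs)" if "xs \<in> pairs M N" for xs
    using that
  proof (induction xs)
    case Nil
    then show ?case using zero by (simp add: tensor_zero)
  next
    case (Cons x xs)
    obtain m n where "x = (m, n)" by force
    moreover have "tclass k M N ([(m, n)] @ xs) = tens k M N m n \<oplus>\<^bsub>M \<boxtimes> N\<^esub> tclass k M N xs"
      using Cons \<open>x = (m, n)\<close> unfolding tens_def by (intro tclass_append[symmetric] M) auto
    ultimately show ?case using Cons add[of m n "tclass k M N xs"] by (auto simp: carrier_tensor)
  qed
  then show ?thesis using t by (auto simp: carrier_tensor)
qed

lemma tensor_ext:
  assumes "kmod M" "kmod N" "kmod P" "f \<in> Lin (M \<boxtimes> N) P" "g \<in> Lin (M \<boxtimes> N) P"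
    and "\<And>m n. m \<in> carrier M \<Longrightarrow> n \<in> carrier N \<Longrightarrow> f (tens k M N m n) = g (tens k M N m n)"
    and "t \<in> carrier (M \<boxtimes> N)"
  shows "f t = g t"
  using assms(1,2,7)
  by (induction rule: tensor_induct) (use assms in \<open>auto simp: lin_zero linear_mapsD\<close>)

lemma tlift_id:
  assumes "kmod M" "kmod N" "t \<in> carrier (M \<boxtimes> N)"
  shows "tlift (M \<boxtimes> N) (tens k M N) t = t"
  by (rule tensor_ext[of M N "M \<boxtimes> N" _ "\<lambda>x. x"])
    (use assms in \<open>auto simp: tlift_tens bilin_tens intro: lin_tlift lin_id\<close>)

lemma lin_tlift_param:
  assumes "kmod M" "kmod N" "kmod P"
    "\<And>m n. m \<in> carrier M \<Longrightarrow> n \<in> carrier N \<Longrightarrow> (\<lambda>x. \<beta> x m n) \<in> Lin A P" "t \<in> carrier (M \<boxtimes> N)"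
  shows "(\<lambda>x. tlift P (\<beta> x) t) \<in> Lin A P"
proof (rule linear_mapsI)
  note b = linear_mapsD[OF assms(4)]
  show "tlift P (\<beta> x) t \<in> carrier P" if "x \<in> carrier A" for x
    using assms b that by (auto intro: tlift_closed)
  show "tlift P (\<beta> (x \<oplus>\<^bsub>A\<^esub> y)) t = tlift P (\<beta> x) t \<oplus>\<^bsub>P\<^esub> tlift P (\<beta> y) t"
    if "x \<in> carrier A" "y \<in> carrier A" for x y
    using that b assms by (subst tlift_add[of M N, symmetric]) (auto intro!: tlift_cong[of M N])
  show "tlift P (\<beta> (a \<odot>\<^bsub>A\<^esub> x)) t = a \<odot>\<^bsub>P\<^esub> tlift P (\<beta> x) t"
    if "a \<in> carrier k" "x \<in> carrier A" for a x
    using that b assms lin_smult2[OF that(1) lin_id assms(3)]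
    by (subst lin_push[of M N P P]) (auto intro!: tlift_cong[of M N])
qed

end

context base
begin

section \<open>Functoriality of the tensor product\<close>

declare lin_id [simp]

lemma tmap_lin [simp]:
  assumes "kmod M" "kmod N" "kmod M'" "kmod N'" "f \<in> Lin M M'" "g \<in> Lin N N'"
  shows "tmap k M' N' f g \<in> Lin (M \<boxtimes> N) (M' \<boxtimes> N')"
  unfolding tmap_def using assms
  by (intro lin_tlift bilinI lin_tens1 lin_tens2) (auto simp: linear_mapsD)

lemma tmap_tens:
  assumes "kmod M" "kmod N" "kmod M'" "kmod N'" "f \<in> Lin M M'" "g \<in> Lin N N'"
    "m \<in> carrier M" "n \<in> carrier N"
  shows "tmap k M' N' f g (tens k M N m n) = tens k M' N' (f m) (g n)"
  unfolding tmap_def using assms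
  by (intro tlift_tens[of M N] bilinI lin_tens1 lin_tens2) (auto simp: linear_mapsD)

lemma tlift_tmap:
  assumes "kmod M" "kmod N" "kmod M'" "kmod N'" "kmod P" "f \<in> Lin M M'" "g \<in> Lin N N'"
    "bilin M' N' P \<beta>" "t \<in> carrier (M \<boxtimes> N)"
  shows "tlift P \<beta> (tmap k M' N' f g t) = tlift P (\<lambda>m n. \<beta> (f m) (g n)) t"
  unfolding tmap_def using assms
  by (subst lin_push[of M N "M' \<boxtimes> N'" P "\<lambda>m n. tens k M' N' (f m) (g n)", OF _ _ _ _ _ lin_tlift])
    (auto simp: linear_mapsD tlift_tens intro!: tlift_cong[of M N])

lemma tmap_cong:
  assumes "kmod M" "kmod N" "\<And>m. m \<in> carrier M \<Longrightarrow> f m = f' m" "\<And>n. n \<in> carrier N \<Longrightarrow> g n = g' n"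
    "t \<in> carrier (M \<boxtimes> N)"
  shows "tmap k M' N' f g t = tmap k M' N' f' g' t"
  unfolding tmap_def using assms by (intro tlift_cong[of M N]) auto

lemma tassoc_bilin:
  assumes "kmod M" "kmod N" "kmod P"
  shows "bilin (M \<boxtimes> N) P (M \<boxtimes> N \<boxtimes> P)
    (\<lambda>s p. tlift (M \<boxtimes> N \<boxtimes> P) (\<lambda>m n. tens k M (N \<boxtimes> P) m (tens k N P n p)) s)"
  using assms
  by (intro bilinI lin_tlift lin_tlift_param[of M N] lin_tens1 lin_tens2 lin_id) auto

lemma tassoc_lin [simp]:
  "kmod M \<Longrightarrow> kmod N \<Longrightarrow> kmod P \<Longrightarrow> tassoc k M N P \<in> Lin ((M \<boxtimes> N) \<boxtimes> P) (M \<boxtimes> N \<boxtimes> P)"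
  unfolding tassoc_def Let_def by (intro lin_tlift tassoc_bilin kmod_tensor) auto

lemma tassoc_tens_left:
  assumes "kmod M" "kmod N" "kmod P" "s \<in> carrier (M \<boxtimes> N)" "p \<in> carrier P"
  shows "tassoc k M N P (tens k (M \<boxtimes> N) P s p)
    = tlift (M \<boxtimes> N \<boxtimes> P) (\<lambda>m n. tens k M (N \<boxtimes> P) m (tens k N P n p)) s"
  unfolding tassoc_def Let_def using assms tassoc_bilin[OF assms(1-3)]
  by (subst tlift_tens[of "M \<boxtimes> N" P]) auto

lemma tassoc_tens:
  assumes "kmod M" "kmod N" "kmod P" "m \<in> carrier M" "n \<in> carrier N" "p \<in> carrier P"
  shows "tassoc k M N P (tens k (M \<boxtimes> N) P (tens k M N m n) p) = tens k M (N \<boxtimes> P) m (tens k N P n p)"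
  using assms
  by (subst tassoc_tens_left) (auto intro!: tlift_tens bilinI lin_tens1 lin_tens2 lin_id)

definition tassoc_inv where
  "tassoc_inv M N P = (let T = (M \<boxtimes> N) \<boxtimes> P in
     tlift T (\<lambda>m s. tlift T (\<lambda>n p. tens k (M \<boxtimes> N) P (tens k M N m n) p) s))"

lemma tassoc_inv_bilin:
  assumes "kmod M" "kmod N" "kmod P"
  shows "bilin M (N \<boxtimes> P) ((M \<boxtimes> N) \<boxtimes> P)
    (\<lambda>m s. tlift ((M \<boxtimes> N) \<boxtimes> P) (\<lambda>n p. tens k (M \<boxtimes> N) P (tens k M N m n) p) s)"
  using assms
  by (intro bilinI lin_tlift lin_tlift_param[of N P] lin_tens1 lin_tens2 lin_id) auto

lemma tassoc_inv_lin [simp]: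
  "kmod M \<Longrightarrow> kmod N \<Longrightarrow> kmod P \<Longrightarrow> tassoc_inv M N P \<in> Lin (M \<boxtimes> N \<boxtimes> P) ((M \<boxtimes> N) \<boxtimes> P)"
  unfolding tassoc_inv_def Let_def by (intro lin_tlift tassoc_inv_bilin kmod_tensor) auto

lemma tassoc_inv_tens:
  assumes "kmod M" "kmod N" "kmod P" "m \<in> carrier M" "n \<in> carrier N" "p \<in> carrier P"
  shows "tassoc_inv M N P (tens k M (N \<boxtimes> P) m (tens k N P n p)) = tens k (M \<boxtimes> N) P (tens k M N m n) p"
  unfolding tassoc_inv_def Let_def using assms
  by (subst tlift_tens[OF _ _ _ tassoc_inv_bilin])
    (auto intro!: tlift_tens bilinI lin_tens1 lin_tens2 lin_id)

lemma lin_tassoc [lin]: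
  "h \<in> Lin A ((M \<boxtimes> N) \<boxtimes> P) \<Longrightarrow> kmod M \<Longrightarrow> kmod N \<Longrightarrow> kmod P
    \<Longrightarrow> (\<lambda>x. tassoc k M N P (h x)) \<in> Lin A (M \<boxtimes> N \<boxtimes> P)"
  by (rule lin_comp[OF tassoc_lin])

lemma lin_tassoc_inv [lin]:
  "h \<in> Lin A (M \<boxtimes> N \<boxtimes> P) \<Longrightarrow> kmod M \<Longrightarrow> kmod N \<Longrightarrow> kmod P
    \<Longrightarrow> (\<lambda>x. tassoc_inv M N P (h x)) \<in> Lin A ((M \<boxtimes> N) \<boxtimes> P)"
  by (rule lin_comp[OF tassoc_inv_lin])

text \<open>Fixing all factors but one leaves a linear map in the remaining factor, so \<open>tensor_ext\<close> can be iterated.\<close>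

lemma tensor_ext_left:
  assumes "kmod M" "kmod N" "kmod P" "kmod Q" "f \<in> Lin ((M \<boxtimes> N) \<boxtimes> P) Q" "g \<in> Lin ((M \<boxtimes> N) \<boxtimes> P) Q"
    and "\<And>m n p. m \<in> carrier M \<Longrightarrow> n \<in> carrier N \<Longrightarrow> p \<in> carrier P
      \<Longrightarrow> f (tens k (M \<boxtimes> N) P (tens k M N m n) p) = g (tens k (M \<boxtimes> N) P (tens k M N m n) p)"
    and "t \<in> carrier ((M \<boxtimes> N) \<boxtimes> P)"
  shows "f t = g t"
proof (rule tensor_ext[of "M \<boxtimes> N" P Q])
  fix s p assume sp: "s \<in> carrier (M \<boxtimes> N)" "p \<in> carrier P"
  have L: "(\<lambda>s. h (tens k (M \<boxtimes> N) P s p)) \<in> Lin (M \<boxtimes> N) Q" if "h \<in> Lin ((M \<boxtimes> N) \<boxtimes> P) Q" for h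
    using sp assms(1-4) by (intro lin_comp[OF that] lin_tens1 lin_id) auto
  show "f (tens k (M \<boxtimes> N) P s p) = g (tens k (M \<boxtimes> N) P s p)"
    by (rule tensor_ext[of M N Q "\<lambda>s. f (tens k (M \<boxtimes> N) P s p)" "\<lambda>s. g (tens k (M \<boxtimes> N) P s p)"])
      (use sp assms(1-4,7) L[OF assms(5)] L[OF assms(6)] in auto)
qed (use assms in auto)

lemma tensor_ext_right:
  assumes "kmod M" "kmod N" "kmod P" "kmod Q" "f \<in> Lin (M \<boxtimes> N \<boxtimes> P) Q" "g \<in> Lin (M \<boxtimes> N \<boxtimes> P) Q"
    and "\<And>m n p. m \<in> carrier M \<Longrightarrow> n \<in> carrier N \<Longrightarrow> p \<in> carrier P
      \<Longrightarrow> f (tens k M (N \<boxtimes> P) m (tens k N P n p)) = g (tens k M (N \<boxtimes> P) m (tens k N P n p))"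
    and "t \<in> carrier (M \<boxtimes> N \<boxtimes> P)"
  shows "f t = g t"
proof (rule tensor_ext[of M "N \<boxtimes> P" Q])
  fix m s assume sp: "s \<in> carrier (N \<boxtimes> P)" "m \<in> carrier M"
  have L: "(\<lambda>s. h (tens k M (N \<boxtimes> P) m s)) \<in> Lin (N \<boxtimes> P) Q" if "h \<in> Lin (M \<boxtimes> N \<boxtimes> P) Q" for h
    using sp assms(1-4) by (intro lin_comp[OF that] lin_tens2 lin_id) auto
  show "f (tens k M (N \<boxtimes> P) m s) = g (tens k M (N \<boxtimes> P) m s)"
    by (rule tensor_ext[of N P Q "\<lambda>s. f (tens k M (N \<boxtimes> P) m s)" "\<lambda>s. g (tens k M (N \<boxtimes> P) m s)"])
      (use sp assms(1-4,7) L[OF assms(5)] L[OF assms(6)] in auto)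
qed (use assms in auto)

lemma tensor_ext_left4:
  assumes "kmod L" "kmod M" "kmod N" "kmod P" "kmod Q"
    "f \<in> Lin (((L \<boxtimes> M) \<boxtimes> N) \<boxtimes> P) Q" "g \<in> Lin (((L \<boxtimes> M) \<boxtimes> N) \<boxtimes> P) Q"
    and "\<And>l m n p. l \<in> carrier L \<Longrightarrow> m \<in> carrier M \<Longrightarrow> n \<in> carrier N \<Longrightarrow> p \<in> carrier P
      \<Longrightarrow> f (tens k ((L \<boxtimes> M) \<boxtimes> N) P (tens k (L \<boxtimes> M) N (tens k L M l m) n) p)
        = g (tens k ((L \<boxtimes> M) \<boxtimes> N) P (tens k (L \<boxtimes> M) N (tens k L M l m) n) p)"
    and "t \<in> carrier (((L \<boxtimes> M) \<boxtimes> N) \<boxtimes> P)"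
  shows "f t = g t"
proof (rule tensor_ext[of "(L \<boxtimes> M) \<boxtimes> N" P Q])
  fix s p assume sp: "s \<in> carrier ((L \<boxtimes> M) \<boxtimes> N)" "p \<in> carrier P"
  have L: "(\<lambda>s. h (tens k ((L \<boxtimes> M) \<boxtimes> N) P s p)) \<in> Lin ((L \<boxtimes> M) \<boxtimes> N) Q" if "h \<in> Lin (((L \<boxtimes> M) \<boxtimes> N) \<boxtimes> P) Q" for h
    using sp assms(1-4) by (intro lin_comp[OF that] lin_tens1 lin_id) (auto simp: assms(5))
  show "f (tens k ((L \<boxtimes> M) \<boxtimes> N) P s p) = g (tens k ((L \<boxtimes> M) \<boxtimes> N) P s p)"
    by (rule tensor_ext_left[of L M N Q "\<lambda>s. f (tens k ((L \<boxtimes> M) \<boxtimes> N) P s p)" "\<lambda>s. g (tens k ((L \<boxtimes> M) \<boxtimes> N) P s p)"])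
      (use sp assms(1-5,8) L[OF assms(6)] L[OF assms(7)] in auto)
qed (use assms in auto)

lemma tassoc_inverse:
  assumes "kmod M" "kmod N" "kmod P"
  shows "t \<in> carrier ((M \<boxtimes> N) \<boxtimes> P) \<Longrightarrow> tassoc_inv M N P (tassoc k M N P t) = t"
    and "u \<in> carrier (M \<boxtimes> N \<boxtimes> P) \<Longrightarrow> tassoc k M N P (tassoc_inv M N P u) = u"
proof -
  show "tassoc_inv M N P (tassoc k M N P t) = t" if "t \<in> carrier ((M \<boxtimes> N) \<boxtimes> P)"
    by (rule tensor_ext_left[of M N P "(M \<boxtimes> N) \<boxtimes> P" _ "\<lambda>x. x"])
      (use assms that in \<open>auto simp: tassoc_tens tassoc_inv_tens intro: lin_tassoc_inv lin_tassoc\<close>)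
  show "tassoc k M N P (tassoc_inv M N P u) = u" if "u \<in> carrier (M \<boxtimes> N \<boxtimes> P)"
    by (rule tensor_ext_right[of M N P "M \<boxtimes> N \<boxtimes> P" _ "\<lambda>x. x"])
      (use assms that in \<open>auto simp: tassoc_tens tassoc_inv_tens intro: lin_tassoc_inv lin_tassoc\<close>)
qed

lemma lunit_bilin: "kmod M \<Longrightarrow> bilin K M M (\<lambda>a m. a \<odot>\<^bsub>M\<^esub> m)"
  by (intro bilinI lin_smult1 lin_smult2 lin_id) auto

lemma runit_bilin: "kmod M \<Longrightarrow> bilin M K M (\<lambda>m a. a \<odot>\<^bsub>M\<^esub> m)"
  by (intro bilinI lin_smult1 lin_smult2 lin_id) auto

lemma unit_lin [simp]:
  "kmod M \<Longrightarrow> tlift M (\<lambda>a m. a \<odot>\<^bsub>M\<^esub> m) \<in> Lin (K \<boxtimes> M) M"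
  "kmod M \<Longrightarrow> tlift M (\<lambda>m a. a \<odot>\<^bsub>M\<^esub> m) \<in> Lin (M \<boxtimes> K) M"
  by (intro lin_tlift lunit_bilin runit_bilin; simp)+

lemma unit_tens:
  "kmod M \<Longrightarrow> a \<in> carrier k \<Longrightarrow> m \<in> carrier M \<Longrightarrow> tlift M (\<lambda>a m. a \<odot>\<^bsub>M\<^esub> m) (tens k K M a m) = a \<odot>\<^bsub>M\<^esub> m"
  "kmod M \<Longrightarrow> a \<in> carrier k \<Longrightarrow> m \<in> carrier M \<Longrightarrow> tlift M (\<lambda>m a. a \<odot>\<^bsub>M\<^esub> m) (tens k M K m a) = a \<odot>\<^bsub>M\<^esub> m"
  using tlift_tens[OF _ _ _ lunit_bilin] tlift_tens[OF _ _ _ runit_bilin] by auto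

lemma lin_unit [lin]:
  "h \<in> Lin A (M \<boxtimes> K) \<Longrightarrow> kmod M \<Longrightarrow> (\<lambda>x. tlift M (\<lambda>m a. a \<odot>\<^bsub>M\<^esub> m) (h x)) \<in> Lin A M"
  by (rule lin_comp[OF unit_lin(2)]) simp_all

lemma tens_smult:
  assumes "kmod M" "kmod N" "a \<in> carrier k" "m \<in> carrier M" "n \<in> carrier N"
  shows "tens k M N (a \<odot>\<^bsub>M\<^esub> m) n = a \<odot>\<^bsub>M \<boxtimes> N\<^esub> tens k M N m n"
    and "tens k M N m (a \<odot>\<^bsub>N\<^esub> n) = a \<odot>\<^bsub>M \<boxtimes> N\<^esub> tens k M N m n"
  using bilin_simps(3,4)[OF bilin_tens[OF assms(1,2)]] assms by auto

lemma unit_inverse: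
  assumes "kmod M"
  shows "t \<in> carrier (K \<boxtimes> M) \<Longrightarrow> tens k K M \<one>\<^bsub>k\<^esub> (tlift M (\<lambda>a m. a \<odot>\<^bsub>M\<^esub> m) t) = t"
    and "u \<in> carrier (M \<boxtimes> K) \<Longrightarrow> tens k M K (tlift M (\<lambda>m a. a \<odot>\<^bsub>M\<^esub> m) u) \<one>\<^bsub>k\<^esub> = u"
proof -
  have e: "tens k K M \<one>\<^bsub>k\<^esub> (a \<odot>\<^bsub>M\<^esub> m) = tens k K M a m" "tens k M K (a \<odot>\<^bsub>M\<^esub> m) \<one>\<^bsub>k\<^esub> = tens k M K m a"
    if "a \<in> carrier k" "m \<in> carrier M" for a m
    using that tens_smult[of K M a "\<one>\<^bsub>k\<^esub>" m] tens_smult[of M K a m "\<one>\<^bsub>k\<^esub>"] assms by auto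
  show "tens k K M \<one>\<^bsub>k\<^esub> (tlift M (\<lambda>a m. a \<odot>\<^bsub>M\<^esub> m) t) = t" if "t \<in> carrier (K \<boxtimes> M)"
    by (rule tensor_ext[of K M "K \<boxtimes> M" _ "\<lambda>x. x"])
      (use assms that in \<open>auto simp: unit_tens e intro: lin_tens2 lin_unit\<close>)
  show "tens k M K (tlift M (\<lambda>m a. a \<odot>\<^bsub>M\<^esub> m) u) \<one>\<^bsub>k\<^esub> = u" if "u \<in> carrier (M \<boxtimes> K)"
    by (rule tensor_ext[of M K "M \<boxtimes> K" _ "\<lambda>x. x"])
      (use assms that in \<open>auto simp: unit_tens e intro: lin_tens1 lin_unit\<close>)
qed

end


section \<open>Inverse arrows\<close>

context category
begin

lemma inverse_arrows_unique:
  assumes "inverse_arrows C f g" "inverse_arrows C f h"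
  shows "g = h"
proof -
  have f: "f \<in> Hom C (Dom C f) (Cod C f)" and g: "g \<in> Hom C (Cod C f) (Dom C f)"
    and h: "h \<in> Hom C (Cod C f) (Dom C f)"
    using assms by (auto simp: inverse_arrows_def Hom_def)
  have "g = Ident C (Dom C f) \<cdot> g" using Ident_Comp[OF g] by simp
  also have "\<dots> = (h \<cdot> f) \<cdot> g" using assms by (simp add: inverse_arrows_def)
  also have "\<dots> = h \<cdot> (f \<cdot> g)" by (rule Comp_assoc[OF g f h])
  also have "\<dots> = h" using assms Comp_Ident[OF h] by (simp add: inverse_arrows_def)
  finally show ?thesis .
qed

lemma inv_arr_eq: "inverse_arrows C f g \<Longrightarrow> inv_arr C f = g"
  unfolding inv_arr_def using inverse_arrows_unique by blast

end


section \<open>Modules form a monoidal category\<close>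

context base
begin

abbreviation "\<M> \<equiv> mod_cat k"
abbreviation mod_comp (infixr \<open>\<bullet>\<close> 65) where "g \<bullet> f \<equiv> g \<cdot>\<^bsub>\<M>\<^esub> f"
abbreviation mod_tens (infixr \<open>\<otimes>\<^sub>\<M>\<close> 75) where "f \<otimes>\<^sub>\<M> g \<equiv> f \<star>\<^bsub>\<M>\<^esub> g"
abbreviation mod_tenso (infixr \<open>\<diamondop>\<^sub>\<M>\<close> 75) where "M \<diamondop>\<^sub>\<M> N \<equiv> M \<diamondop>\<^bsub>\<M>\<^esub> N"

text \<open>
  Arrows are extensional functions; with the restriction built in, two arrows are equal as soon as their functions
  agree on the carrier.
\<close>

definition marr where
  "marr M f N = Arrow M (restrict f (carrier M)) N"

lemma marr_simps [simp]: "src (marr M f N) = M" "tgt (marr M f N) = N" "fn (marr M f N) = restrict f (carrier M)"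
  by (simp_all add: marr_def)

lemma marr_eqI: "(\<And>x. x \<in> carrier M \<Longrightarrow> f x = g x) \<Longrightarrow> marr M f N = marr M g N"
  by (auto simp: marr_def restrict_def)

lemma marr_ext:
  assumes "kmod M" "kmod N" "kmod P" "f \<in> Lin (M \<boxtimes> N) P" "g \<in> Lin (M \<boxtimes> N) P"
    and "\<And>m n. m \<in> carrier M \<Longrightarrow> n \<in> carrier N \<Longrightarrow> f (tens k M N m n) = g (tens k M N m n)"
  shows "marr (M \<boxtimes> N) f P = marr (M \<boxtimes> N) g P"
  using assms by (intro marr_eqI) (rule tensor_ext)

lemma marr_ext_left:
  assumes "kmod M" "kmod N" "kmod P" "kmod Q" "f \<in> Lin ((M \<boxtimes> N) \<boxtimes> P) Q" "g \<in> Lin ((M \<boxtimes> N) \<boxtimes> P) Q"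
    and "\<And>m n p. m \<in> carrier M \<Longrightarrow> n \<in> carrier N \<Longrightarrow> p \<in> carrier P
      \<Longrightarrow> f (tens k (M \<boxtimes> N) P (tens k M N m n) p) = g (tens k (M \<boxtimes> N) P (tens k M N m n) p)"
  shows "marr ((M \<boxtimes> N) \<boxtimes> P) f Q = marr ((M \<boxtimes> N) \<boxtimes> P) g Q"
  using assms by (intro marr_eqI) (rule tensor_ext_left)

lemma marr_ext_left4:
  assumes "kmod L" "kmod M" "kmod N" "kmod P" "kmod Q"
    "f \<in> Lin (((L \<boxtimes> M) \<boxtimes> N) \<boxtimes> P) Q" "g \<in> Lin (((L \<boxtimes> M) \<boxtimes> N) \<boxtimes> P) Q"
    and "\<And>l m n p. l \<in> carrier L \<Longrightarrow> m \<in> carrier M \<Longrightarrow> n \<in> carrier N \<Longrightarrow> p \<in> carrier P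
      \<Longrightarrow> f (tens k ((L \<boxtimes> M) \<boxtimes> N) P (tens k (L \<boxtimes> M) N (tens k L M l m) n) p)
        = g (tens k ((L \<boxtimes> M) \<boxtimes> N) P (tens k (L \<boxtimes> M) N (tens k L M l m) n) p)"
  shows "marr (((L \<boxtimes> M) \<boxtimes> N) \<boxtimes> P) f Q = marr (((L \<boxtimes> M) \<boxtimes> N) \<boxtimes> P) g Q"
  using assms by (intro marr_eqI) (rule tensor_ext_left4)

lemma marr_Hom [simp]:
  assumes "kmod M" "kmod N" "f \<in> Lin M N"
  shows "marr M f N \<in> Hom \<M> M N"
proof -
  have "restrict f (carrier M) \<in> Lin M N"
    by (rule linear_maps_cong[OF assms(3,1)]) simp
  then show ?thesis using assms by (auto simp: Hom_def mod_cat_def marr_def)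
qed

lemma mod_HomE:
  assumes "\<phi> \<in> Hom \<M> M N"
  obtains f where "f \<in> Lin M N" "\<phi> = marr M f N" "kmod M" "kmod N"
proof -
  from assms obtain f where f: "\<phi> = Arrow M f N" "kmod M" "kmod N" "f \<in> Lin M N" "f \<in> extensional (carrier M)"
    by (auto simp: Hom_def mod_cat_def)
  then have "\<phi> = marr M f N" by (simp add: marr_def extensional_restrict)
  with f show ?thesis using that by blast
qed

lemma marr_comp [simp]:
  assumes "f \<in> Lin M N"
  shows "marr N g P \<bullet> marr M f N = marr M (\<lambda>x. g (f x)) P"
  using linear_mapsD(1)[OF assms]
  by (auto simp: mod_cat_def marr_def compose_def restrict_def)

lemma mod_cat_Ob [simp]: "M \<in> Ob \<M> \<longleftrightarrow> kmod M"
  by (simp add: mod_cat_def)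

lemma mod_cat_simps [simp]:
  "TensO \<M> M N = M \<boxtimes> N" "UnitO \<M> = K"
  "Ident \<M> M = marr M (\<lambda>x. x) M"
  "Assoc \<M> M N P = marr ((M \<boxtimes> N) \<boxtimes> P) (tassoc k M N P) (M \<boxtimes> N \<boxtimes> P)"
  "LUnit \<M> M = marr (K \<boxtimes> M) (tlift M (\<lambda>a m. a \<odot>\<^bsub>M\<^esub> m)) M"
  "RUnit \<M> M = marr (M \<boxtimes> K) (tlift M (\<lambda>m a. a \<odot>\<^bsub>M\<^esub> m)) M"
  by (simp_all add: mod_cat_def marr_def id_def)

lemma marr_tens [simp]:
  assumes "kmod M" "kmod N"
  shows "marr M f M' \<otimes>\<^sub>\<M> marr N g N' = marr (M \<boxtimes> N) (tmap k M' N' f g) (M' \<boxtimes> N')"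
  by (simp add: mod_cat_def) (auto simp: marr_def intro!: restrict_ext tmap_cong[OF assms])

lemma marr_inverse:
  assumes "kmod M" "kmod N" "f \<in> Lin M N" "g \<in> Lin N M"
    "\<And>x. x \<in> carrier M \<Longrightarrow> g (f x) = x" "\<And>y. y \<in> carrier N \<Longrightarrow> f (g y) = y"
  shows "inverse_arrows \<M> (marr M f N) (marr N g M)"
  using marr_Hom[OF assms(1-3)] marr_Hom[OF assms(2,1,4)] assms(3-6)
  by (auto simp: inverse_arrows_def Hom_def intro: marr_eqI)

lemma marr_Iso:
  assumes "kmod M" "kmod N" "f \<in> Lin M N" "g \<in> Lin N M"
    "\<And>x. x \<in> carrier M \<Longrightarrow> g (f x) = x" "\<And>y. y \<in> carrier N \<Longrightarrow> f (g y) = y"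
  shows "marr M f N \<in> Iso \<M> M N"
  using marr_inverse[OF assms] marr_Hom[OF assms(1-3)] by (auto simp: Iso_def)

lemma category_mod_cat: "category \<M>"
proof
  show "Dom \<M> f \<in> Ob \<M>" "Cod \<M> f \<in> Ob \<M>" if "f \<in> Arr \<M>" for f
    using that by (auto simp: mod_cat_def)
  show "Ident \<M> A \<in> Hom \<M> A A" if "A \<in> Ob \<M>" for A
    using that by auto
  fix \<phi> \<chi> \<omega> W X Y Z
  assume "\<phi> \<in> Hom \<M> X Y"
  then obtain f where f: "f \<in> Lin X Y" "\<phi> = marr X f Y" "kmod X" "kmod Y" by (rule mod_HomE)
  then show "\<phi> \<bullet> Ident \<M> X = \<phi>" "Ident \<M> Y \<bullet> \<phi> = \<phi>"
    by auto
  assume "\<chi> \<in> Hom \<M> Y Z"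
  then obtain g where g: "g \<in> Lin Y Z" "\<chi> = marr Y g Z" "kmod Z" by (rule mod_HomE)
  have gf: "(\<lambda>x. g (f x)) \<in> Lin X Z" by (rule lin_comp[OF g(1) f(1)])
  then show "\<chi> \<bullet> \<phi> \<in> Hom \<M> X Z" using f g by simp
  assume "\<omega> \<in> Hom \<M> W X"
  then obtain h where h: "h \<in> Lin W X" "\<omega> = marr W h X" "kmod W" by (rule mod_HomE)
  have "(\<lambda>x. f (h x)) \<in> Lin W Y" by (rule lin_comp[OF f(1) h(1)])
  then show "(\<chi> \<bullet> \<phi>) \<bullet> \<omega> = \<chi> \<bullet> \<phi> \<bullet> \<omega>"
    using f g h gf by simp
qed

lemma monoidal_mod_cat: "monoidal_category \<M>"
proof (intro monoidal_category.intro category_mod_cat monoidal_category_axioms.intro)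
  fix X X' X'' Y Y' Y'' \<phi> \<phi>' \<chi> \<chi>'
  assume "\<phi> \<in> Hom \<M> X X'" "\<chi> \<in> Hom \<M> Y Y'"
  then obtain f g where f: "f \<in> Lin X X'" "\<phi> = marr X f X'" "kmod X" "kmod X'"
    and g: "g \<in> Lin Y Y'" "\<chi> = marr Y g Y'" "kmod Y" "kmod Y'" by (elim mod_HomE)
  then show "\<phi> \<otimes>\<^sub>\<M> \<chi> \<in> Hom \<M> (X \<diamondop>\<^sub>\<M> Y) (X' \<diamondop>\<^sub>\<M> Y')"
    by simp
  assume "\<phi>' \<in> Hom \<M> X' X''" "\<chi>' \<in> Hom \<M> Y' Y''"
  then obtain f' g' where f': "f' \<in> Lin X' X''" "\<phi>' = marr X' f' X''" "kmod X''"
    and g': "g' \<in> Lin Y' Y''" "\<chi>' = marr Y' g' Y''" "kmod Y''" by (elim mod_HomE)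
  have "(\<lambda>x. f' (f x)) \<in> Lin X X''" "(\<lambda>x. g' (g x)) \<in> Lin Y Y''"
    by (rule lin_comp[OF f'(1) f(1)], rule lin_comp[OF g'(1) g(1)])
  then show "(\<phi>' \<bullet> \<phi>) \<otimes>\<^sub>\<M> (\<chi>' \<bullet> \<chi>) =
       (\<phi>' \<otimes>\<^sub>\<M> \<chi>') \<bullet> (\<phi> \<otimes>\<^sub>\<M> \<chi>)"
    using f g f' g' by (auto simp: tmap_tens linear_mapsD(1) intro!: marr_ext lin_comp[OF tmap_lin tmap_lin])
next
  fix X Y assume "X \<in> Ob \<M>" "Y \<in> Ob \<M>"
  then show "Ident \<M> X \<otimes>\<^sub>\<M> Ident \<M> Y = Ident \<M> (X \<diamondop>\<^sub>\<M> Y)"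
    by (auto simp: tmap_tens intro!: marr_ext)
next
  fix X Y Z assume "X \<in> Ob \<M>" "Y \<in> Ob \<M>" "Z \<in> Ob \<M>"
  then show "Assoc \<M> X Y Z \<in> Iso \<M> ((X \<diamondop>\<^sub>\<M> Y) \<diamondop>\<^sub>\<M> Z)
     (X \<diamondop>\<^sub>\<M> Y \<diamondop>\<^sub>\<M> Z)"
    by (auto simp: tassoc_inverse intro!: marr_Iso[of _ _ _ "tassoc_inv X Y Z"])
next
  fix X X' Y Y' Z Z' f g h
  assume "f \<in> Hom \<M> X X'" "g \<in> Hom \<M> Y Y'" "h \<in> Hom \<M> Z Z'"
  then show "Assoc \<M> X' Y' Z' \<bullet> ((f \<otimes>\<^sub>\<M> g) \<otimes>\<^sub>\<M> h) =
       (f \<otimes>\<^sub>\<M> g \<otimes>\<^sub>\<M> h) \<bullet> Assoc \<M> X Y Z"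
    by (auto elim!: mod_HomE simp: tmap_tens tassoc_tens linear_mapsD(1)
        intro!: marr_ext_left lin_comp[OF tassoc_lin tmap_lin] lin_comp[OF tmap_lin tassoc_lin])
next
  fix X assume X: "X \<in> Ob \<M>"
  from X show "LUnit \<M> X \<in> Iso \<M> (UnitO \<M> \<diamondop>\<^sub>\<M> X) X"
    by (auto simp: unit_inverse unit_tens intro!: marr_Iso[of _ _ _ "tens k K X \<one>\<^bsub>k\<^esub>"] intro: lin_tens2)
  from X show "RUnit \<M> X \<in> Iso \<M> (X \<diamondop>\<^sub>\<M> UnitO \<M>) X"
    by (auto simp: unit_inverse unit_tens intro!: marr_Iso[of _ _ _ "\<lambda>x. tens k X K x \<one>\<^bsub>k\<^esub>"] intro: lin_tens1)
next
  fix f X X' assume "f \<in> Hom \<M> X X'"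
  then show "LUnit \<M> X' \<bullet> (Ident \<M> (UnitO \<M>) \<otimes>\<^sub>\<M> f) =
       f \<bullet> LUnit \<M> X"
    "RUnit \<M> X' \<bullet> (f \<otimes>\<^sub>\<M> Ident \<M> (UnitO \<M>)) =
       f \<bullet> RUnit \<M> X"
    by (auto elim!: mod_HomE simp: tmap_tens unit_tens linear_mapsD intro!: marr_ext lin_comp[OF _ unit_lin(1)] lin_comp[OF _ unit_lin(2)]
        lin_comp[OF unit_lin(1) tmap_lin] lin_comp[OF unit_lin(2) tmap_lin])
next
  fix W X Y Z assume "W \<in> Ob \<M>" "X \<in> Ob \<M>" "Y \<in> Ob \<M>" "Z \<in> Ob \<M>"
  then show "Assoc \<M> W X (Y \<diamondop>\<^sub>\<M> Z) \<bullet> Assoc \<M> (W \<diamondop>\<^sub>\<M> X) Y Z =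
       (Ident \<M> W \<otimes>\<^sub>\<M> Assoc \<M> X Y Z) \<bullet>
       Assoc \<M> W (X \<diamondop>\<^sub>\<M> Y) Z \<bullet>
       (Assoc \<M> W X Y \<otimes>\<^sub>\<M> Ident \<M> Z)"
    by (auto simp: tmap_tens tassoc_tens lin_comp[OF tassoc_lin tmap_lin] intro!: marr_ext_left4
        lin_comp[OF tmap_lin lin_comp[OF tassoc_lin tmap_lin]] lin_comp[OF tassoc_lin tassoc_lin])
next
  fix X Y assume "X \<in> Ob \<M>" "Y \<in> Ob \<M>"
  then show "(Ident \<M> X \<otimes>\<^sub>\<M> LUnit \<M> Y) \<bullet>
       Assoc \<M> X (UnitO \<M>) Y = RUnit \<M> X \<otimes>\<^sub>\<M> Ident \<M> Y"
    by (auto simp: tmap_tens tassoc_tens unit_tens tens_smult intro!: marr_ext_left lin_comp[OF tmap_lin tassoc_lin])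
qed (auto)

end

section \<open>Coactions in Sweedler notation\<close>

locale prebialg = base k + prebialgebra k H for k :: "'u::infinite ring" and H :: "'u prebialg"
begin

abbreviation H_mult (infixl \<open>**\<close> 75) where "x ** y \<equiv> x \<otimes>\<^bsub>H\<^esub> y"
abbreviation \<Delta> where "\<Delta> \<equiv> comult H"
abbreviation \<epsilon> where "\<epsilon> \<equiv> counit H"
abbreviation \<eta> where "\<eta> \<equiv> \<one>\<^bsub>H\<^esub>"

lemma kmod_H [simp]: "kmod H"
  by (rule module_axioms)

lemma counit_closed [simp]: "x \<in> carrier H \<Longrightarrow> \<epsilon> x \<in> carrier k"
  using linear_mapsD(1)[OF counit_linear] by simp

lemma lin_counit [lin]: "f \<in> Lin A H \<Longrightarrow> (\<lambda>x. \<epsilon> (f x)) \<in> Lin A K"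
  by (rule lin_comp[OF counit_linear])

lemma lin_hmult1 [lin]: "f \<in> Lin A H \<Longrightarrow> c \<in> carrier H \<Longrightarrow> (\<lambda>x. f x ** c) \<in> Lin A H"
  using linear_mapsD[of f k A H]
  by (intro linear_mapsI) (auto simp: l_distr smult_mult_left)

lemma lin_hmult2 [lin]: "f \<in> Lin A H \<Longrightarrow> c \<in> carrier H \<Longrightarrow> (\<lambda>x. c ** f x) \<in> Lin A H"
  using linear_mapsD[of f k A H]
  by (intro linear_mapsI) (auto simp: r_distr smult_mult_right)

definition coaction where
  "coaction X \<rho> \<longleftrightarrow> kmod X \<and> \<rho> \<in> Lin X (X \<boxtimes> H)"

text \<open>
  Sweedler notation: \<open>sw X \<rho> P (\<lambda>x\<^sub>0 x\<^sub>1. E) x\<close> is the sum of the values of \<open>E\<close> over \<open>\<rho>(x) = x\<^sub>0 \<otimes> x\<^sub>1\<close> in \<open>P\<close>.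
  The module \<open>X\<close> is an argument so that the congruence and linearity rules can refer to the range of \<open>x\<^sub>0\<close>.
\<close>

definition sw where
  "sw X \<rho> P \<beta> x = tlift P \<beta> (\<rho> x)"

abbreviation "hsw P \<beta> h \<equiv> sw H \<Delta> P \<beta> h"
abbreviation "csw M P \<beta> m \<equiv> sw (und M) (coact M) P \<beta> m"

lemma coactionD: "coaction X \<rho> \<Longrightarrow> kmod X" "coaction X \<rho> \<Longrightarrow> x \<in> carrier X \<Longrightarrow> \<rho> x \<in> carrier (X \<boxtimes> H)"
  by (auto simp: coaction_def linear_mapsD(1))

lemma coaction_H [simp]: "coaction H \<Delta>"
  by (simp add: coaction_def comult_linear)

lemma sw_closed [simp]:
  "coaction X \<rho> \<Longrightarrow> kmod P \<Longrightarrow> (\<And>a b. a \<in> carrier X \<Longrightarrow> b \<in> carrier H \<Longrightarrow> \<beta> a b \<in> carrier P)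
    \<Longrightarrow> x \<in> carrier X \<Longrightarrow> sw X \<rho> P \<beta> x \<in> carrier P"
  unfolding sw_def by (rule tlift_closed[of X H]) (auto simp: coactionD)

lemma sw_cong:
  "coaction X \<rho> \<Longrightarrow> x \<in> carrier X \<Longrightarrow> (\<And>a b. a \<in> carrier X \<Longrightarrow> b \<in> carrier H \<Longrightarrow> \<beta> a b = \<gamma> a b)
    \<Longrightarrow> sw X \<rho> P \<beta> x = sw X \<rho> P \<gamma> x"
  unfolding sw_def by (rule tlift_cong[of X H]) (auto simp: coactionD)

lemma lin_sw1 [lin]:
  "coaction X \<rho> \<Longrightarrow> kmod P \<Longrightarrow> bilin X H P \<beta> \<Longrightarrow> f \<in> Lin A X \<Longrightarrow> (\<lambda>x. sw X \<rho> P \<beta> (f x)) \<in> Lin A P"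
  unfolding sw_def coaction_def by (blast intro: lin_comp[OF lin_tlift lin_comp] kmod_H)

lemma lin_sw2 [lin]:
  "coaction X \<rho> \<Longrightarrow> kmod P \<Longrightarrow> (\<And>a b. a \<in> carrier X \<Longrightarrow> b \<in> carrier H \<Longrightarrow> (\<lambda>y. \<beta> y a b) \<in> Lin A P)
    \<Longrightarrow> x \<in> carrier X \<Longrightarrow> (\<lambda>y. sw X \<rho> P (\<beta> y) x) \<in> Lin A P"
  unfolding sw_def by (rule lin_tlift_param[of X H]) (auto simp: coactionD)

lemma sw_push:
  "coaction X \<rho> \<Longrightarrow> kmod P \<Longrightarrow> kmod Q \<Longrightarrow> f \<in> Lin P Q
    \<Longrightarrow> (\<And>a b. a \<in> carrier X \<Longrightarrow> b \<in> carrier H \<Longrightarrow> \<beta> a b \<in> carrier P) \<Longrightarrow> x \<in> carrier X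
    \<Longrightarrow> f (sw X \<rho> P \<beta> x) = sw X \<rho> Q (\<lambda>a b. f (\<beta> a b)) x"
  unfolding sw_def by (rule lin_push[of X H]) (auto simp: coactionD)

lemma sw_swap:
  assumes "coaction X \<rho>" "coaction Y \<sigma>" "kmod P"
   "\<And>a b c d. a \<in> carrier X \<Longrightarrow> b \<in> carrier H \<Longrightarrow> c \<in> carrier Y \<Longrightarrow> d \<in> carrier H \<Longrightarrow> \<beta> a b c d \<in> carrier P"
   "x \<in> carrier X" "y \<in> carrier Y"
  shows "sw X \<rho> P (\<lambda>a b. sw Y \<sigma> P (\<beta> a b) y) x = sw Y \<sigma> P (\<lambda>c d. sw X \<rho> P (\<lambda>a b. \<beta> a b c d) x) y"
  unfolding sw_def by (rule tlift_swap[of X H Y H]) (use assms in \<open>auto simp: coactionD\<close>)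

text \<open>Linear operations commute with Sweedler sums; each of these rules moves one operation inside.\<close>

lemma sw_smult:
  "coaction X \<rho> \<Longrightarrow> kmod P \<Longrightarrow> c \<in> carrier k
    \<Longrightarrow> (\<And>a b. a \<in> carrier X \<Longrightarrow> b \<in> carrier H \<Longrightarrow> \<beta> a b \<in> carrier P) \<Longrightarrow> x \<in> carrier X
    \<Longrightarrow> c \<odot>\<^bsub>P\<^esub> sw X \<rho> P \<beta> x = sw X \<rho> P (\<lambda>a b. c \<odot>\<^bsub>P\<^esub> \<beta> a b) x"
  by (rule sw_push[of X \<rho> P P "\<lambda>y. c \<odot>\<^bsub>P\<^esub> y"]) (auto intro: lin_smult2 lin_id)

lemma sw_scalar:
  "coaction X \<rho> \<Longrightarrow> kmod P \<Longrightarrow> p \<in> carrier P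
    \<Longrightarrow> (\<And>a b. a \<in> carrier X \<Longrightarrow> b \<in> carrier H \<Longrightarrow> \<beta> a b \<in> carrier k) \<Longrightarrow> x \<in> carrier X
    \<Longrightarrow> sw X \<rho> K \<beta> x \<odot>\<^bsub>P\<^esub> p = sw X \<rho> P (\<lambda>a b. \<beta> a b \<odot>\<^bsub>P\<^esub> p) x"
  by (rule sw_push[of X \<rho> K P "\<lambda>y. y \<odot>\<^bsub>P\<^esub> p"]) (auto intro: lin_smult1 lin_id)

lemma sw_tens:
  "coaction X \<rho> \<Longrightarrow> kmod M \<Longrightarrow> kmod N \<Longrightarrow> n \<in> carrier N
    \<Longrightarrow> (\<And>a b. a \<in> carrier X \<Longrightarrow> b \<in> carrier H \<Longrightarrow> \<beta> a b \<in> carrier M) \<Longrightarrow> x \<in> carrier X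
    \<Longrightarrow> tens k M N (sw X \<rho> M \<beta> x) n = sw X \<rho> (M \<boxtimes> N) (\<lambda>a b. tens k M N (\<beta> a b) n) x"
  "coaction X \<rho> \<Longrightarrow> kmod M \<Longrightarrow> kmod N \<Longrightarrow> m \<in> carrier M
    \<Longrightarrow> (\<And>a b. a \<in> carrier X \<Longrightarrow> b \<in> carrier H \<Longrightarrow> \<beta> a b \<in> carrier N) \<Longrightarrow> x \<in> carrier X
    \<Longrightarrow> tens k M N m (sw X \<rho> N \<beta> x) = sw X \<rho> (M \<boxtimes> N) (\<lambda>a b. tens k M N m (\<beta> a b)) x"
  by (rule sw_push[of X \<rho> M "M \<boxtimes> N" "\<lambda>y. tens k M N y n"] sw_push[of X \<rho> N "M \<boxtimes> N" "\<lambda>y. tens k M N m y"];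
      auto intro: lin_tens1 lin_tens2 lin_id)+

lemma sw_tensor:
  "coaction X \<rho> \<Longrightarrow> x \<in> carrier X \<Longrightarrow> sw X \<rho> (X \<boxtimes> H) (tens k X H) x = \<rho> x"
  by (simp add: sw_def tlift_id coactionD)

definition trilin where
  "trilin X Y Z P \<phi> \<longleftrightarrow> (\<forall>b\<in>carrier Y. \<forall>c\<in>carrier Z. (\<lambda>a. \<phi> a b c) \<in> Lin X P) \<and> (\<forall>a\<in>carrier X. bilin Y Z P (\<phi> a))"

lemma trilinI [lin]:
  "\<lbrakk>\<And>b c. b \<in> carrier Y \<Longrightarrow> c \<in> carrier Z \<Longrightarrow> (\<lambda>a. \<phi> a b c) \<in> Lin X P;
    \<And>a c. a \<in> carrier X \<Longrightarrow> c \<in> carrier Z \<Longrightarrow> (\<lambda>b. \<phi> a b c) \<in> Lin Y P;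
    \<And>a b. a \<in> carrier X \<Longrightarrow> b \<in> carrier Y \<Longrightarrow> (\<lambda>c. \<phi> a b c) \<in> Lin Z P\<rbrakk> \<Longrightarrow> trilin X Y Z P \<phi>"
  by (simp add: trilin_def bilin_def)

lemma trilinD:
  assumes "trilin X Y Z P \<phi>"
  shows "b \<in> carrier Y \<Longrightarrow> c \<in> carrier Z \<Longrightarrow> (\<lambda>a. \<phi> a b c) \<in> Lin X P"
    "a \<in> carrier X \<Longrightarrow> bilin Y Z P (\<phi> a)"
    "a \<in> carrier X \<Longrightarrow> b \<in> carrier Y \<Longrightarrow> c \<in> carrier Z \<Longrightarrow> \<phi> a b c \<in> carrier P"
  using assms bilin_closed[of Y Z P "\<phi> a"] by (auto simp: trilin_def)

lemma trilin_lift: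
  assumes "kmod X" "kmod Y" "kmod Z" "kmod P" "trilin X Y Z P \<phi>"
  shows "bilin X (Y \<boxtimes> Z) P (\<lambda>a. tlift P (\<phi> a))"
proof (rule bilinI)
  show "(\<lambda>a. tlift P (\<phi> a) t) \<in> Lin X P" if "t \<in> carrier (Y \<boxtimes> Z)" for t
    by (rule lin_tlift_param[of Y Z]) (use assms that in \<open>auto simp: trilinD\<close>)
  show "(\<lambda>t. tlift P (\<phi> a) t) \<in> Lin (Y \<boxtimes> Z) P" if "a \<in> carrier X" for a
    by (rule lin_tlift) (use assms that in \<open>auto simp: trilinD\<close>)
qed

text \<open>
  The two sides of the coassociativity axiom become the two iterated Sweedler sums when the linear map
  induced by a trilinear \<open>\<phi>\<close> is applied to them.
\<close>

lemma coassoc_left: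
  assumes X: "coaction X \<rho>" and P: "kmod P" and \<phi>: "trilin X H H P \<phi>" and x: "x \<in> carrier X"
  shows "tlift P (\<lambda>a. tlift P (\<phi> a)) (tassoc k X H H (tmap k (X \<boxtimes> H) H \<rho> id (\<rho> x)))
    = sw X \<rho> P (\<lambda>a b. sw X \<rho> P (\<lambda>a0 a1. \<phi> a0 a1 b) a) x"
proof -
  note kX [simp] = coactionD(1)[OF X]
  have \<rho>: "\<rho> \<in> Lin X (X \<boxtimes> H)" using X by (simp add: coaction_def)
  note b = trilin_lift[OF kX kmod_H kmod_H P \<phi>]
  note L = lin_tlift[OF kX kmod_tensor[OF kmod_H kmod_H] P b]
  have in1: "tlift P (\<lambda>a. tlift P (\<phi> a)) (tassoc k X H H (tens k (X \<boxtimes> H) H (\<rho> m) n))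
      = sw X \<rho> P (\<lambda>a0 a1. \<phi> a0 a1 n) m" if "m \<in> carrier X" "n \<in> carrier H" for m n
  proof -
    have "tlift P (\<lambda>a. tlift P (\<phi> a)) (tassoc k X H H (tens k (X \<boxtimes> H) H (\<rho> m) n))
      = tlift P (\<lambda>a. tlift P (\<phi> a)) (sw X \<rho> (X \<boxtimes> H \<boxtimes> H) (\<lambda>a0 a1. tens k X (H \<boxtimes> H) a0 (tens k H H a1 n)) m)"
      unfolding sw_def using that coactionD(2)[OF X] by (simp add: tassoc_tens_left)
    also have "\<dots> = sw X \<rho> P (\<lambda>a0 a1. tlift P (\<lambda>a. tlift P (\<phi> a)) (tens k X (H \<boxtimes> H) a0 (tens k H H a1 n))) m"
      using that by (intro sw_push[OF X _ P L]) auto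
    also have "\<dots> = sw X \<rho> P (\<lambda>a0 a1. \<phi> a0 a1 n) m"
      using that P by (intro sw_cong[OF X]) (auto simp: tlift_tens[OF _ _ _ b] tlift_tens[OF _ _ _ trilinD(2)[OF \<phi>]])
    finally show ?thesis .
  qed
  have "tlift P (\<lambda>a. tlift P (\<phi> a)) (tassoc k X H H (tmap k (X \<boxtimes> H) H \<rho> id (\<rho> x)))
    = sw X \<rho> P (\<lambda>m n. tlift P (\<lambda>a. tlift P (\<phi> a)) (tassoc k X H H (tens k (X \<boxtimes> H) H (\<rho> m) (id n)))) x"
  proof -
    have "tmap k (X \<boxtimes> H) H \<rho> id (\<rho> x) = sw X \<rho> ((X \<boxtimes> H) \<boxtimes> H) (\<lambda>m n. tens k (X \<boxtimes> H) H (\<rho> m) (id n)) x"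
      by (simp add: tmap_def sw_def)
    then show ?thesis
      using x coactionD(2)[OF X] P by (simp add: sw_push[OF X _ P lin_comp[OF L tassoc_lin]])
  qed
  also have "\<dots> = sw X \<rho> P (\<lambda>a b. sw X \<rho> P (\<lambda>a0 a1. \<phi> a0 a1 b) a) x"
    by (rule sw_cong[OF X x]) (simp add: in1)
  finally show ?thesis .
qed

lemma coassoc_right:
  assumes X: "coaction X \<rho>" and P: "kmod P" and \<phi>: "trilin X H H P \<phi>" and x: "x \<in> carrier X"
  shows "tlift P (\<lambda>a. tlift P (\<phi> a)) (tmap k X (H \<boxtimes> H) id \<Delta> (\<rho> x))
    = sw X \<rho> P (\<lambda>a b. hsw P (\<lambda>b1 b2. \<phi> a b1 b2) b) x"
proof -
  note kX [simp] = coactionD(1)[OF X]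
  note b = trilin_lift[OF kX kmod_H kmod_H P \<phi>]
  have "tlift P (\<lambda>a. tlift P (\<phi> a)) (tmap k X (H \<boxtimes> H) (\<lambda>x. x) \<Delta> (\<rho> x))
    = tlift P (\<lambda>m n. tlift P (\<phi> m) (\<Delta> n)) (\<rho> x)"
    using coactionD(2)[OF X x] P
    by (intro tlift_tmap[of X H X "H \<boxtimes> H" P "\<lambda>x. x" \<Delta> "\<lambda>a. tlift P (\<phi> a)"]) (simp_all add: b comult_linear)
  then show ?thesis by (simp add: sw_def id_def)
qed

text \<open>
  The counit axiom is left out, since the coaction \<open>m\<^sub>0 \<otimes> n\<^sub>0 \<otimes> m\<^sub>1n\<^sub>1\<close> on \<open>M \<otimes> N\<close> violates it.
\<close>

definition ncomod where
  "ncomod X \<rho> \<longleftrightarrow> coaction X \<rho> \<and>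
     (\<forall>x\<in>carrier X. tassoc k X H H (tmap k (X \<boxtimes> H) H \<rho> id (\<rho> x)) = tmap k X (H \<boxtimes> H) id \<Delta> (\<rho> x))"

lemma ncomod_coaction [simp]: "ncomod X \<rho> \<Longrightarrow> coaction X \<rho>"
  by (simp add: ncomod_def)

lemma ncomod_H [simp]: "ncomod H \<Delta>"
  by (simp add: ncomod_def comult_coassoc)

lemma sw_coassoc:
  assumes "ncomod X \<rho>" "kmod P" "trilin X H H P \<phi>" "x \<in> carrier X"
  shows "sw X \<rho> P (\<lambda>a b. sw X \<rho> P (\<lambda>a0 a1. \<phi> a0 a1 b) a) x = sw X \<rho> P (\<lambda>a b. hsw P (\<lambda>b1 b2. \<phi> a b1 b2) b) x"
  using assms coassoc_left[of X \<rho> P \<phi> x] coassoc_right[of X \<rho> P \<phi> x] by (simp add: ncomod_def)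

text \<open>
  Conversely it suffices to test coassociativity on the universal trilinear map; both sides are then
  recovered from \<open>coassoc_left\<close> and \<open>coassoc_right\<close>, because lifting it gives the identity.
\<close>

lemma ncomodI:
  assumes X: "coaction X \<rho>"
    and c: "\<And>P \<phi> x. P = X \<boxtimes> H \<boxtimes> H \<Longrightarrow> kmod P \<Longrightarrow> trilin X H H P \<phi> \<Longrightarrow> x \<in> carrier X \<Longrightarrow>
      sw X \<rho> P (\<lambda>a b. sw X \<rho> P (\<lambda>a0 a1. \<phi> a0 a1 b) a) x = sw X \<rho> P (\<lambda>a b. hsw P (\<lambda>b1 b2. \<phi> a b1 b2) b) x"
  shows "ncomod X \<rho>"
  unfolding ncomod_def
proof (intro conjI X ballI)
  fix x assume x: "x \<in> carrier X"
  note kX [simp] = coactionD(1)[OF X]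
  have \<rho>: "\<rho> \<in> Lin X (X \<boxtimes> H)" using X by (simp add: coaction_def)
  let ?T = "X \<boxtimes> H \<boxtimes> H" and ?\<phi> = "\<lambda>a b c. tens k X (H \<boxtimes> H) a (tens k H H b c)"
  have t: "trilin X H H ?T ?\<phi>" by (intro lin; simp)
  have id: "tlift ?T (\<lambda>a. tlift ?T (?\<phi> a)) u = u" if "u \<in> carrier ?T" for u
    by (rule tensor_ext_right[of X H H ?T _ "\<lambda>x. x"])
      (use that in \<open>auto simp: tlift_tens trilin_lift[OF _ _ _ _ t] trilinD(2)[OF t] intro: lin_tlift trilin_lift[OF _ _ _ _ t]\<close>)
  have 1: "tassoc k X H H (tmap k (X \<boxtimes> H) H \<rho> id (\<rho> x)) \<in> carrier ?T"
    using coactionD(2)[OF X x] \<rho> linear_mapsD(1)[OF tassoc_lin[of X H H]] linear_mapsD(1)[OF tmap_lin[of X H "X \<boxtimes> H" H \<rho> "\<lambda>x. x"]]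
    by (simp add: id_def)
  have 2: "tmap k X (H \<boxtimes> H) id \<Delta> (\<rho> x) \<in> carrier ?T"
    using coactionD(2)[OF X x] comult_linear linear_mapsD(1)[OF tmap_lin[of X H X "H \<boxtimes> H" "\<lambda>x. x" \<Delta>]]
    by (simp add: id_def)
  show "tassoc k X H H (tmap k (X \<boxtimes> H) H \<rho> id (\<rho> x)) = tmap k X (H \<boxtimes> H) id \<Delta> (\<rho> x)"
    using coassoc_left[OF X _ t x] coassoc_right[OF X _ t x] c[OF HOL.refl _ t x] id[OF 1] id[OF 2] by simp
qed

lemma hsw_counit_left:
  assumes "kmod P" "f \<in> Lin H P" "h \<in> carrier H"
  shows "hsw P (\<lambda>a b. \<epsilon> a \<odot>\<^bsub>P\<^esub> f b) h = f h"
proof -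
  have "f (hsw H (\<lambda>a b. \<epsilon> a \<odot>\<^bsub>H\<^esub> b) h) = hsw P (\<lambda>a b. f (\<epsilon> a \<odot>\<^bsub>H\<^esub> b)) h"
    using assms by (intro sw_push) auto
  also have "\<dots> = hsw P (\<lambda>a b. \<epsilon> a \<odot>\<^bsub>P\<^esub> f b) h"
    using assms by (intro sw_cong) (auto simp: linear_mapsD)
  finally show ?thesis using counit_left[OF assms(3)] by (simp add: sw_def)
qed

lemma hsw_counit_right:
  assumes "kmod P" "f \<in> Lin H P" "h \<in> carrier H"
  shows "hsw P (\<lambda>a b. \<epsilon> b \<odot>\<^bsub>P\<^esub> f a) h = f h"
proof -
  have "f (hsw H (\<lambda>a b. \<epsilon> b \<odot>\<^bsub>H\<^esub> a) h) = hsw P (\<lambda>a b. f (\<epsilon> b \<odot>\<^bsub>H\<^esub> a)) h"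
    using assms by (intro sw_push) auto
  also have "\<dots> = hsw P (\<lambda>a b. \<epsilon> b \<odot>\<^bsub>P\<^esub> f a) h"
    using assms by (intro sw_cong) (auto simp: linear_mapsD)
  finally show ?thesis using counit_right[OF assms(3)] by (simp add: sw_def)
qed

lemma hsw_mult:
  assumes P: "kmod P" and \<phi>: "bilin H H P \<phi>" and xy: "x \<in> carrier H" "y \<in> carrier H"
  shows "hsw P \<phi> (x ** y) = hsw P (\<lambda>a b. hsw P (\<lambda>c d. \<phi> (a ** c) (b ** d)) y) x"
proof -
  have "hsw P \<phi> (x ** y)
    = tlift P \<phi> (hsw (H \<boxtimes> H) (\<lambda>a b. hsw (H \<boxtimes> H) (\<lambda>c d. tens k H H (a ** c) (b ** d)) y) x)"
    by (simp add: sw_def comult_mult[OF xy] tmult_def)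
  also have "\<dots> = hsw P (\<lambda>a b. tlift P \<phi> (hsw (H \<boxtimes> H) (\<lambda>c d. tens k H H (a ** c) (b ** d)) y)) x"
    using xy P by (intro sw_push[OF _ _ _ lin_tlift[OF _ _ _ \<phi>]]) auto
  also have "\<dots> = hsw P (\<lambda>a b. hsw P (\<lambda>c d. tlift P \<phi> (tens k H H (a ** c) (b ** d))) y) x"
    using xy P by (intro sw_cong sw_push[OF _ _ _ lin_tlift[OF _ _ _ \<phi>]]) auto
  also have "\<dots> = hsw P (\<lambda>a b. hsw P (\<lambda>c d. \<phi> (a ** c) (b ** d)) y) x"
    using xy P by (intro sw_cong) (auto simp: tlift_tens[OF _ _ _ \<phi>])
  finally show ?thesis .
qed

end

section \<open>Retracts of coactions\<close>

lemma (in prebialg) trilin_bilin: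
  "kmod P \<Longrightarrow> bilin X H P \<phi> \<Longrightarrow> trilin X H H P (\<lambda>a b c. \<epsilon> b \<odot>\<^bsub>P\<^esub> \<phi> a c)"
  "kmod P \<Longrightarrow> bilin X H P \<phi> \<Longrightarrow> trilin X H H P (\<lambda>a b c. \<epsilon> c \<odot>\<^bsub>P\<^esub> \<phi> a b)"
  by (intro trilinI lin_smult1 lin_smult2 lin_counit lin_id; simp add: bilinD bilin_closed)+

text \<open>
  An idempotent \<open>e\<close> on \<open>X\<close> whose image is stable under \<open>\<rho>\<close>, and the coaction \<open>(e \<otimes> H)\<rho>\<close> on the image \<open>R\<close>. The
  factor \<open>e\<close> only turns elements of \<open>X \<otimes> H\<close> into elements of \<open>R \<otimes> H\<close>, which is a different set of codes. The record
  \<open>R\<close> and the coaction \<open>\<rho>'\<close> are parameters because they come from other definitions.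
\<close>

locale coaction_retract = prebialg k H
  for k :: "'u::infinite ring" and H :: "'u prebialg" +
  fixes X :: "('u, 'u, 'y) module_scheme" and \<rho> e :: "'u \<Rightarrow> 'u"
    and R :: "('u, 'u) module" and \<rho>' :: "'u \<Rightarrow> 'u"
  assumes ncomod_X: "ncomod X \<rho>"
    and e_lin: "e \<in> Lin X X"
    and e_idem: "x \<in> carrier X \<Longrightarrow> e (e x) = e x"
    and e_stable: "x \<in> carrier X \<Longrightarrow> sw X \<rho> (X \<boxtimes> H) (\<lambda>a b. tens k X H (e a) b) (e x) = \<rho> (e x)"
    and R_carrier: "carrier R = e ` carrier X"
    and R_ops: "zero R = zero X" "add R = add X" "smult R = smult X"
    and R_coact: "x \<in> carrier R \<Longrightarrow> \<rho>' x = sw X \<rho> (R \<boxtimes> H) (\<lambda>a b. tens k R H (e a) b) x"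
begin

lemma X_coaction [simp]: "coaction X \<rho>"
  by (rule ncomod_coaction[OF ncomod_X])

lemma X_kmod [simp]: "kmod X"
  by (rule coactionD(1)[OF X_coaction])

lemma e_closed [simp]: "x \<in> carrier X \<Longrightarrow> e x \<in> carrier X" "x \<in> carrier X \<Longrightarrow> e x \<in> carrier R"
  using linear_mapsD(1)[OF e_lin] by (auto simp: R_carrier)

lemma R_closed: "x \<in> carrier R \<Longrightarrow> x \<in> carrier X"
  by (auto simp: R_carrier)

lemma e_fix: "x \<in> carrier R \<Longrightarrow> e x = x"
  by (auto simp: R_carrier e_idem)

lemma R_smult_closed: "a \<in> carrier k \<Longrightarrow> x \<in> carrier R \<Longrightarrow> a \<odot>\<^bsub>X\<^esub> x \<in> carrier R"
  using linear_mapsD(3)[OF e_lin, of a x] e_closed(2)[of "a \<odot>\<^bsub>X\<^esub> x"] by (simp add: e_fix R_closed)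

lemma R_kmod [simp]: "kmod R"
proof (rule moduleI)
  have c: "x \<in> carrier R \<Longrightarrow> y \<in> carrier R \<Longrightarrow> x \<oplus>\<^bsub>X\<^esub> y \<in> carrier R" for x y
    using linear_mapsD(2)[OF e_lin, of x y] e_closed(2)[of "x \<oplus>\<^bsub>X\<^esub> y"] by (simp add: e_fix R_closed)
  have z: "\<zero>\<^bsub>X\<^esub> \<in> carrier R"
    using lin_zero[OF e_lin] e_closed(2)[of "\<zero>\<^bsub>X\<^esub>"] by simp
  show "cring k" by (rule cring_k)
  show "abelian_group R"
  proof (rule abelian_groupI)
    fix x assume x: "x \<in> carrier R"
    show "\<exists>y\<in>carrier R. y \<oplus>\<^bsub>R\<^esub> x = \<zero>\<^bsub>R\<^esub>"
      using x R_smult_closed[OF neg_one_closed x] add_neg_one[OF X_kmod R_closed[OF x]]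
      by (intro bexI[of _ "(\<ominus>\<^bsub>k\<^esub> \<one>\<^bsub>k\<^esub>) \<odot>\<^bsub>X\<^esub> x"]) (auto simp: R_ops module_add_comm R_closed)
  qed (use c z in \<open>auto simp: R_ops R_closed module_add_assoc module_add_comm[OF X_kmod]\<close>)
qed (auto simp: R_ops R_closed module_rules R_smult_closed)

lemma incl_lin: "f \<in> Lin A R \<Longrightarrow> f \<in> Lin A X"
  by (rule linear_mapsI) (auto simp: linear_mapsD R_closed R_ops[symmetric])

lemma restrict_lin: "f \<in> Lin X A \<Longrightarrow> f \<in> Lin R A"
  by (rule linear_mapsI) (auto simp: linear_mapsD R_closed R_ops)

lemma e_lin': "e \<in> Lin X R"
  by (rule linear_mapsI) (auto simp: linear_mapsD[OF e_lin] R_ops)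

lemma bilin_e: "bilin R H P \<phi> \<Longrightarrow> bilin X H P (\<lambda>a b. \<phi> (e a) b)"
  by (rule bilinI) (auto simp: bilinD intro: lin_comp[OF bilinD(1) e_lin'])

text \<open>Stability of the image under \<open>\<rho>\<close> says that \<open>e\<close> may be dropped inside Sweedler sums over its elements.\<close>

lemma sw_stable:
  assumes "kmod P" "bilin X H P \<phi>" "x \<in> carrier R"
  shows "sw X \<rho> P (\<lambda>a b. \<phi> (e a) b) x = sw X \<rho> P \<phi> x"
proof -
  have x: "x \<in> carrier X" "e x = x" using assms by (auto simp: R_closed e_fix)
  have "sw X \<rho> P \<phi> x = tlift P \<phi> (sw X \<rho> (X \<boxtimes> H) (\<lambda>a b. tens k X H (e a) b) x)"
    using e_stable[OF x(1)] x by (simp add: sw_def)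
  also have "\<dots> = sw X \<rho> P (\<lambda>a b. tlift P \<phi> (tens k X H (e a) b)) x"
    using assms x by (intro sw_push[OF _ _ _ lin_tlift[OF _ _ _ assms(2)]]) auto
  also have "\<dots> = sw X \<rho> P (\<lambda>a b. \<phi> (e a) b) x"
    using assms x by (intro sw_cong) (auto simp: tlift_tens)
  finally show ?thesis by simp
qed

lemma sw_R:
  assumes "kmod P" "bilin R H P \<phi>" "x \<in> carrier R"
  shows "sw R \<rho>' P \<phi> x = sw X \<rho> P (\<lambda>a b. \<phi> (e a) b) x"
proof -
  have x: "x \<in> carrier X" using assms by (auto simp: R_closed)
  have "sw R \<rho>' P \<phi> x = tlift P \<phi> (sw X \<rho> (R \<boxtimes> H) (\<lambda>a b. tens k R H (e a) b) x)"
    using R_coact[OF assms(3)] by (simp add: sw_def)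
  also have "\<dots> = sw X \<rho> P (\<lambda>a b. tlift P \<phi> (tens k R H (e a) b)) x"
    using assms x by (intro sw_push[OF _ _ _ lin_tlift[OF _ _ _ assms(2)]]) auto
  also have "\<dots> = sw X \<rho> P (\<lambda>a b. \<phi> (e a) b) x"
    using assms x by (intro sw_cong) (auto simp: tlift_tens)
  finally show ?thesis by simp
qed

lemma R_coaction: "coaction R \<rho>'"
  unfolding coaction_def
proof
  have "(\<lambda>x. sw X \<rho> (R \<boxtimes> H) (\<lambda>a b. tens k R H (e a) b) x) \<in> Lin R (R \<boxtimes> H)"
    by (rule restrict_lin) (intro lin_sw1 bilin_e bilin_tens lin_id; simp)
  then show "\<rho>' \<in> Lin R (R \<boxtimes> H)"
    by (rule linear_maps_cong) (auto simp: R_coact)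
qed simp

text \<open>
  Each application of \<open>\<rho>'\<close> is an application of \<open>\<rho>\<close> followed by \<open>e\<close>. The \<open>e\<close> between the two applications disappears by
  \<open>sw_stable\<close>, and what remains is the coassociativity of \<open>\<rho>\<close>.
\<close>

lemma R_ncomod: "ncomod R \<rho>'"
proof (rule ncomodI[OF R_coaction])
  fix T :: "('u, 'u) module" and t x
  assume T: "kmod T" and t: "trilin R H H T t" and x: "x \<in> carrier R"
  note [simp] = T
  have xX: "x \<in> carrier X" using x by (rule R_closed)
  have b1: "bilin R H T (\<lambda>a b. t a b c)" if "c \<in> carrier H" for c
    using t that by (auto simp: trilin_def bilin_def)
  have tr: "trilin X H H T (\<lambda>a b c. t (e a) b c)"
    by (rule trilinI) (auto intro: lin_comp[OF trilinD(1)[OF t] e_lin'] bilinD(1)[OF trilinD(2)[OF t]] bilinD(2)[OF trilinD(2)[OF t]])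
  have tr1: "(\<lambda>a. t (e a) b c) \<in> Lin X T" if "b \<in> carrier H" "c \<in> carrier H" for b c
    using that by (rule trilinD(1)[OF tr])
  have tr3: "(\<lambda>c. t (e a) b c) \<in> Lin H T" if "a \<in> carrier X" "b \<in> carrier H" for a b
    using that trilinD(2)[OF tr, of a] by (simp add: bilin_def)
  have b2: "bilin X H T (\<lambda>a b. sw X \<rho> T (\<lambda>a0 a1. t (e a0) a1 b) a)"
    by (intro bilinI lin_sw1 lin_sw2 bilin_e b1 lin_id; simp add: tr3)
  have b3: "bilin R H T (\<lambda>a b. sw R \<rho>' T (\<lambda>a0 a1. t a0 a1 b) a)"
    by (intro bilinI lin_sw1 lin_sw2 b1 lin_id R_coaction; simp add: bilinD(2)[OF trilinD(2)[OF t]])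
  have b4: "bilin R H T (\<lambda>a b. hsw T (t a) b)"
    by (intro bilinI lin_sw1 lin_sw2 lin_id trilinD(2)[OF t] trilinD(1)[OF t]; simp)
  have "sw R \<rho>' T (\<lambda>a b. sw R \<rho>' T (\<lambda>a0 a1. t a0 a1 b) a) x
    = sw X \<rho> T (\<lambda>a b. sw R \<rho>' T (\<lambda>a0 a1. t a0 a1 b) (e a)) x"
    by (rule sw_R[OF T b3 x])
  also have "\<dots> = sw X \<rho> T (\<lambda>a b. sw X \<rho> T (\<lambda>a0 a1. t (e a0) a1 b) (e a)) x"
    using xX by (intro sw_cong sw_R b1) auto
  also have "\<dots> = sw X \<rho> T (\<lambda>a b. sw X \<rho> T (\<lambda>a0 a1. t (e a0) a1 b) a) x"
    by (rule sw_stable[OF T b2 x])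
  also have "\<dots> = sw X \<rho> T (\<lambda>a b. hsw T (\<lambda>b1 b2. t (e a) b1 b2) b) x"
    by (rule sw_coassoc[OF ncomod_X T tr xX])
  also have "\<dots> = sw R \<rho>' T (\<lambda>a b. hsw T (\<lambda>b1 b2. t a b1 b2) b) x"
    by (rule sw_R[OF T b4 x, symmetric])
  finally show "sw R \<rho>' T (\<lambda>a b. sw R \<rho>' T (\<lambda>a0 a1. t a0 a1 b) a) x = sw R \<rho>' T (\<lambda>a b. hsw T (\<lambda>b1 b2. t a b1 b2) b) x" .
qed

end


section \<open>The counital part of a coassociative coaction\<close>

context prebialg
begin

text \<open>
  The map \<open>(id \<otimes> \<epsilon>)\<rho>\<close>, the projection onto the counital part of \<open>X\<close>.
\<close>

definition cpi where
  "cpi X \<rho> x = sw X \<rho> X (\<lambda>a b. \<epsilon> b \<odot>\<^bsub>X\<^esub> a) x"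

lemma cpi_bilin: "coaction X \<rho> \<Longrightarrow> bilin X H X (\<lambda>a b. \<epsilon> b \<odot>\<^bsub>X\<^esub> a)"
  using coactionD(1)[of X \<rho>] by (auto intro!: lin)

lemma cpi_lin: "coaction X \<rho> \<Longrightarrow> cpi X \<rho> \<in> Lin X X"
  unfolding cpi_def[abs_def] by (intro lin_sw1 cpi_bilin lin_id) (auto simp: coactionD)

lemma cpi_closed: "coaction X \<rho> \<Longrightarrow> x \<in> carrier X \<Longrightarrow> cpi X \<rho> x \<in> carrier X"
  by (rule linear_mapsD(1)[OF cpi_lin])

lemma lin_cpi:
  assumes "coaction X \<rho>" "kmod P" "f \<in> Lin X P" "x \<in> carrier X"
  shows "f (cpi X \<rho> x) = sw X \<rho> P (\<lambda>a b. \<epsilon> b \<odot>\<^bsub>P\<^esub> f a) x"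
proof -
  have "f (cpi X \<rho> x) = sw X \<rho> P (\<lambda>a b. f (\<epsilon> b \<odot>\<^bsub>X\<^esub> a)) x"
    unfolding cpi_def using assms coactionD(1)[OF assms(1)] by (intro sw_push) auto
  also have "\<dots> = sw X \<rho> P (\<lambda>a b. \<epsilon> b \<odot>\<^bsub>P\<^esub> f a) x"
    using assms by (intro sw_cong) (auto simp: linear_mapsD)
  finally show ?thesis .
qed

text \<open>
  By coassociativity a counit applied to any tensor factor but the first cancels, which makes \<open>cpi\<close> invisible
  before or after the coaction. In particular it is idempotent.
\<close>

lemma sw_cpi_inside:
  assumes X: "ncomod X \<rho>" and P: "kmod P" and \<phi>: "bilin X H P \<phi>" and x: "x \<in> carrier X"
  shows "sw X \<rho> P (\<lambda>a b. \<phi> (cpi X \<rho> a) b) x = sw X \<rho> P \<phi> x"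
proof -
  have c [simp]: "coaction X \<rho>" using X by simp
  have "sw X \<rho> P (\<lambda>a b. \<phi> (cpi X \<rho> a) b) x = sw X \<rho> P (\<lambda>a b. sw X \<rho> P (\<lambda>a0 a1. \<epsilon> a1 \<odot>\<^bsub>P\<^esub> \<phi> a0 b) a) x"
    using x P by (intro sw_cong lin_cpi bilinD(1)[OF \<phi>]) auto
  also have "\<dots> = sw X \<rho> P (\<lambda>a b. hsw P (\<lambda>b1 b2. \<epsilon> b1 \<odot>\<^bsub>P\<^esub> \<phi> a b2) b) x"
    by (rule sw_coassoc[OF X P trilin_bilin(1)[OF P \<phi>] x])
  also have "\<dots> = sw X \<rho> P \<phi> x"
    using x P by (intro sw_cong hsw_counit_left bilinD(2)[OF \<phi>]) auto
  finally show ?thesis .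
qed

lemma sw_cpi_arg:
  assumes X: "ncomod X \<rho>" and P: "kmod P" and \<phi>: "bilin X H P \<phi>" and x: "x \<in> carrier X"
  shows "sw X \<rho> P \<phi> (cpi X \<rho> x) = sw X \<rho> P \<phi> x"
proof -
  have c [simp]: "coaction X \<rho>" using X by simp
  have "sw X \<rho> P \<phi> (cpi X \<rho> x) = sw X \<rho> P (\<lambda>a b. \<epsilon> b \<odot>\<^bsub>P\<^esub> sw X \<rho> P \<phi> a) x"
    using x P by (intro lin_cpi lin_sw1 \<phi> lin_id) auto
  also have "\<dots> = sw X \<rho> P (\<lambda>a b. sw X \<rho> P (\<lambda>a0 a1. \<epsilon> b \<odot>\<^bsub>P\<^esub> \<phi> a0 a1) a) x"
    using x P by (intro sw_cong sw_smult) (auto simp: bilin_closed[OF \<phi>])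
  also have "\<dots> = sw X \<rho> P (\<lambda>a b. hsw P (\<lambda>b1 b2. \<epsilon> b2 \<odot>\<^bsub>P\<^esub> \<phi> a b1) b) x"
    by (rule sw_coassoc[OF X P trilin_bilin(2)[OF P \<phi>] x])
  also have "\<dots> = sw X \<rho> P \<phi> x"
    using x P by (intro sw_cong hsw_counit_right bilinD(2)[OF \<phi>]) auto
  finally show ?thesis .
qed

lemma cpi_idem: "ncomod X \<rho> \<Longrightarrow> x \<in> carrier X \<Longrightarrow> cpi X \<rho> (cpi X \<rho> x) = cpi X \<rho> x"
  unfolding cpi_def[of X \<rho> "cpi X \<rho> x"] using cpi_bilin[of X \<rho>] coactionD(1)[of X \<rho>]
  by (subst sw_cpi_arg) (auto simp: cpi_def coactionD)

lemma coaction_retract_cpi: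
  assumes "ncomod X \<rho>" "carrier R = cpi X \<rho> ` carrier X"
    "zero R = zero X" "add R = add X" "smult R = smult X"
    "\<And>x. x \<in> carrier R \<Longrightarrow> \<rho>' x = sw X \<rho> (R \<boxtimes> H) (\<lambda>a b. tens k R H (cpi X \<rho> a) b) x"
  shows "coaction_retract k H X \<rho> (cpi X \<rho>) R \<rho>'"
proof (unfold_locales, goal_cases)
  case (4 x)
  have "coaction X \<rho>" using assms(1) by simp
  with 4 show ?case
    using assms(1) cpi_closed[of X \<rho> x] coactionD(1)[of X \<rho>]
    by (subst sw_cpi_inside[OF _ _ bilin_tens]) (auto simp: sw_tensor)
qed (use assms in \<open>auto simp: cpi_lin cpi_idem\<close>)


section \<open>The tensor product of two coactions\<close>

text \<open>
  The coaction \<open>m \<otimes> n \<mapsto> m\<^sub>0 \<otimes> n\<^sub>0 \<otimes> m\<^sub>1n\<^sub>1\<close>.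
\<close>

definition tco where
  "tco X \<rho> Y \<sigma> = tlift ((X \<boxtimes> Y) \<boxtimes> H) (\<lambda>m n. sw X \<rho> ((X \<boxtimes> Y) \<boxtimes> H) (\<lambda>m0 m1. sw Y \<sigma> ((X \<boxtimes> Y) \<boxtimes> H)
     (\<lambda>n0 n1. tens k (X \<boxtimes> Y) H (tens k X Y m0 n0) (m1 ** n1)) n) m)"

lemma coaction_tco:
  assumes "coaction X \<rho>" "coaction Y \<sigma>"
  shows "coaction (X \<boxtimes> Y) (tco X \<rho> Y \<sigma>)"
  unfolding coaction_def tco_def
  using assms coactionD(1)[OF assms(1)] coactionD(1)[OF assms(2)]
  by (intro conjI lin_tlift lin; simp)

lemma tco_tens:
  assumes X: "coaction X \<rho>" and Y: "coaction Y \<sigma>" and "x \<in> carrier X" "y \<in> carrier Y"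
  shows "tco X \<rho> Y \<sigma> (tens k X Y x y) = sw X \<rho> ((X \<boxtimes> Y) \<boxtimes> H) (\<lambda>m0 m1. sw Y \<sigma> ((X \<boxtimes> Y) \<boxtimes> H)
     (\<lambda>n0 n1. tens k (X \<boxtimes> Y) H (tens k X Y m0 n0) (m1 ** n1)) y) x"
  unfolding tco_def using assms coactionD(1)[OF X] coactionD(1)[OF Y]
  by (subst tlift_tens[of X Y]) (auto intro!: lin)

lemma sw_tco:
  assumes X: "coaction X \<rho>" and Y: "coaction Y \<sigma>" and P: "kmod P" and \<phi>: "bilin (X \<boxtimes> Y) H P \<phi>"
    and x: "x \<in> carrier X" and y: "y \<in> carrier Y"
  shows "sw (X \<boxtimes> Y) (tco X \<rho> Y \<sigma>) P \<phi> (tens k X Y x y)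
    = sw X \<rho> P (\<lambda>m0 m1. sw Y \<sigma> P (\<lambda>n0 n1. \<phi> (tens k X Y m0 n0) (m1 ** n1)) y) x"
proof -
  note [simp] = coactionD(1)[OF X] coactionD(1)[OF Y] P X Y x y
  let ?T = "(X \<boxtimes> Y) \<boxtimes> H"
  have "sw (X \<boxtimes> Y) (tco X \<rho> Y \<sigma>) P \<phi> (tens k X Y x y)
    = tlift P \<phi> (sw X \<rho> ?T (\<lambda>m0 m1. sw Y \<sigma> ?T (\<lambda>n0 n1. tens k (X \<boxtimes> Y) H (tens k X Y m0 n0) (m1 ** n1)) y) x)"
    unfolding sw_def[of "X \<boxtimes> Y"] by (simp add: tco_tens)
  also have "\<dots> = sw X \<rho> P (\<lambda>m0 m1. tlift P \<phi> (sw Y \<sigma> ?T (\<lambda>n0 n1. tens k (X \<boxtimes> Y) H (tens k X Y m0 n0) (m1 ** n1)) y)) x"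
    by (intro sw_push[OF _ _ _ lin_tlift[OF _ _ _ \<phi>]]) auto
  also have "\<dots> = sw X \<rho> P (\<lambda>m0 m1. sw Y \<sigma> P (\<lambda>n0 n1. tlift P \<phi> (tens k (X \<boxtimes> Y) H (tens k X Y m0 n0) (m1 ** n1))) y) x"
    by (intro sw_cong sw_push[OF _ _ _ lin_tlift[OF _ _ _ \<phi>]]) auto
  also have "\<dots> = sw X \<rho> P (\<lambda>m0 m1. sw Y \<sigma> P (\<lambda>n0 n1. \<phi> (tens k X Y m0 n0) (m1 ** n1)) y) x"
    by (intro sw_cong) (auto simp: tlift_tens[OF _ _ _ \<phi>])
  finally show ?thesis .
qed

text \<open>
  Coassociativity of both factors turns the left-hand side into a sum over \<open>\<Delta>(m\<^sub>1)\<close> and \<open>\<Delta>(n\<^sub>1)\<close>, which is a sum over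
  \<open>\<Delta>(m\<^sub>1n\<^sub>1)\<close> because \<open>\<Delta>\<close> is multiplicative.
\<close>

lemma ncomod_tco:
  assumes X: "ncomod X \<rho>" and Y: "ncomod Y \<sigma>"
  shows "ncomod (X \<boxtimes> Y) (tco X \<rho> Y \<sigma>)"
proof (rule ncomodI)
  have cX [simp]: "coaction X \<rho>" and cY [simp]: "coaction Y \<sigma>" using X Y by auto
  have cXY [simp]: "coaction (X \<boxtimes> Y) (tco X \<rho> Y \<sigma>)" by (rule coaction_tco) auto
  then show "coaction (X \<boxtimes> Y) (tco X \<rho> Y \<sigma>)" .
  note [simp] = coactionD(1)[OF cX] coactionD(1)[OF cY]
  fix P :: "('u, 'u) module" and \<phi> t
  assume P [simp]: "kmod P" and \<phi>: "trilin (X \<boxtimes> Y) H H P \<phi>" and t: "t \<in> carrier (X \<boxtimes> Y)"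
  have l1: "(\<lambda>z. \<phi> (f z) b c) \<in> Lin A P" if "f \<in> Lin A (X \<boxtimes> Y)" "b \<in> carrier H" "c \<in> carrier H" for f b c and A :: "('u, 'u, 'z) module_scheme"
    using that by (intro lin_comp[OF trilinD(1)[OF \<phi>]])
  have l2: "(\<lambda>z. \<phi> a (f z) c) \<in> Lin A P" if "f \<in> Lin A H" "a \<in> carrier (X \<boxtimes> Y)" "c \<in> carrier H" for f a c and A :: "('u, 'u, 'z) module_scheme"
    using that by (intro lin_comp[OF bilinD(1)[OF trilinD(2)[OF \<phi>]]])
  have l3: "(\<lambda>z. \<phi> a b (f z)) \<in> Lin A P" if "f \<in> Lin A H" "a \<in> carrier (X \<boxtimes> Y)" "b \<in> carrier H" for f a b and A :: "('u, 'u, 'z) module_scheme"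
    using that by (intro lin_comp[OF bilinD(2)[OF trilinD(2)[OF \<phi>]]])
  note [simp] = trilinD(3)[OF \<phi>]
  show "sw (X \<boxtimes> Y) (tco X \<rho> Y \<sigma>) P (\<lambda>a b. sw (X \<boxtimes> Y) (tco X \<rho> Y \<sigma>) P (\<lambda>a0 a1. \<phi> a0 a1 b) a) t
    = sw (X \<boxtimes> Y) (tco X \<rho> Y \<sigma>) P (\<lambda>a b. hsw P (\<lambda>b1 b2. \<phi> a b1 b2) b) t"
  proof (rule tensor_ext[OF _ _ P _ _ _ t])
    fix x y assume xy [simp]: "x \<in> carrier X" "y \<in> carrier Y"
    let ?t = "tens k X Y"
    have "sw (X \<boxtimes> Y) (tco X \<rho> Y \<sigma>) P (\<lambda>a b. sw (X \<boxtimes> Y) (tco X \<rho> Y \<sigma>) P (\<lambda>a0 a1. \<phi> a0 a1 b) a) (?t x y)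
      = sw X \<rho> P (\<lambda>x0 x1. sw Y \<sigma> P (\<lambda>y0 y1.
          sw (X \<boxtimes> Y) (tco X \<rho> Y \<sigma>) P (\<lambda>a0 a1. \<phi> a0 a1 (x1 ** y1)) (?t x0 y0)) y) x"
      by (rule sw_tco) (auto intro!: lin l1 l2 l3)
    also have "\<dots> = sw X \<rho> P (\<lambda>x0 x1. sw Y \<sigma> P (\<lambda>y0 y1.
          sw X \<rho> P (\<lambda>x00 x01. sw Y \<sigma> P (\<lambda>y00 y01. \<phi> (?t x00 y00) (x01 ** y01) (x1 ** y1)) y0) x0) y) x"
      by (intro sw_cong sw_tco) (auto intro!: lin l1 l2 l3)
    also have "\<dots> = sw X \<rho> P (\<lambda>x0 x1. sw X \<rho> P (\<lambda>x00 x01. sw Y \<sigma> P (\<lambda>y0 y1.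
          sw Y \<sigma> P (\<lambda>y00 y01. \<phi> (?t x00 y00) (x01 ** y01) (x1 ** y1)) y0) y) x0) x"
      by (intro sw_cong sw_swap) auto
    also have "\<dots> = sw X \<rho> P (\<lambda>x0 x1. hsw P (\<lambda>h1 h2. sw Y \<sigma> P (\<lambda>y0 y1.
          sw Y \<sigma> P (\<lambda>y00 y01. \<phi> (?t x0 y00) (h1 ** y01) (h2 ** y1)) y0) y) x1) x"
      by (rule sw_coassoc[OF X]) (auto intro!: lin l1 l2 l3)
    also have "\<dots> = sw X \<rho> P (\<lambda>x0 x1. hsw P (\<lambda>h1 h2. sw Y \<sigma> P (\<lambda>y0 y1.
          hsw P (\<lambda>g1 g2. \<phi> (?t x0 y0) (h1 ** g1) (h2 ** g2)) y1) y) x1) x"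
      by (intro sw_cong sw_coassoc[OF Y]) (auto intro!: lin l1 l2 l3)
    also have "\<dots> = sw X \<rho> P (\<lambda>x0 x1. sw Y \<sigma> P (\<lambda>y0 y1. hsw P (\<lambda>h1 h2.
          hsw P (\<lambda>g1 g2. \<phi> (?t x0 y0) (h1 ** g1) (h2 ** g2)) y1) x1) y) x"
      by (intro sw_cong sw_swap) auto
    also have "\<dots> = sw X \<rho> P (\<lambda>x0 x1. sw Y \<sigma> P (\<lambda>y0 y1. hsw P (\<lambda>b1 b2. \<phi> (?t x0 y0) b1 b2) (x1 ** y1)) y) x"
      by (intro sw_cong hsw_mult[symmetric]) (auto intro!: lin l1 l2 l3)
    also have "\<dots> = sw (X \<boxtimes> Y) (tco X \<rho> Y \<sigma>) P (\<lambda>a b. hsw P (\<lambda>b1 b2. \<phi> a b1 b2) b) (?t x y)"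
      by (rule sw_tco[symmetric]) (auto intro!: lin l1 l2 l3)
    finally show "sw (X \<boxtimes> Y) (tco X \<rho> Y \<sigma>) P (\<lambda>a b. sw (X \<boxtimes> Y) (tco X \<rho> Y \<sigma>) P (\<lambda>a0 a1. \<phi> a0 a1 b) a) (?t x y)
      = sw (X \<boxtimes> Y) (tco X \<rho> Y \<sigma>) P (\<lambda>a b. hsw P (\<lambda>b1 b2. \<phi> a b1 b2) b) (?t x y)" .
  qed (auto intro!: lin l1 l2 l3)
qed

end

section \<open>The tensor product of comodules\<close>

context prebialg
begin

abbreviation "RT \<equiv> rtensor k H"
abbreviation "comod \<equiv> comodule k H"

text \<open>
  The generators of \<open>M \<otimes>\<^sup>r N\<close>.
\<close>

definition dot where
  "dot M N m n = rpi k H M N (tens k (und M) (und N) m n)"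

lemma comodule_iff:
  "comod M \<longleftrightarrow> ncomod (und M) (coact M) \<and> (\<forall>m\<in>carrier (und M). cpi (und M) (coact M) m = m)"
  by (auto simp: comodule_def ncomod_def coaction_def cpi_def sw_def)

lemma comodule_simps [simp]:
  "comod M \<Longrightarrow> kmod (und M)" "comod M \<Longrightarrow> ncomod (und M) (coact M)"
  "comod M \<Longrightarrow> coaction (und M) (coact M)"
  using coactionD(1)[of "und M" "coact M"] by (auto simp: comodule_iff)

lemma csw_counit:
  assumes "comod M" "kmod P" "f \<in> Lin (und M) P" "m \<in> carrier (und M)"
  shows "csw M P (\<lambda>a b. \<epsilon> b \<odot>\<^bsub>P\<^esub> f a) m = f m"
  using lin_cpi[of "und M" "coact M" P f m] assms by (simp add: comodule_iff)

lemma rpi_sw: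
  "rpi k H M N = tlift (und M \<boxtimes> und N) (\<lambda>m n. csw M (und M \<boxtimes> und N) (\<lambda>m0 m1. csw N (und M \<boxtimes> und N)
    (\<lambda>n0 n1. \<epsilon> (m1 ** n1) \<odot>\<^bsub>und M \<boxtimes> und N\<^esub> tens k (und M) (und N) m0 n0) n) m)"
  by (simp add: rpi_def sw_def Let_def)

lemma rpi_lin: "comod M \<Longrightarrow> comod N \<Longrightarrow> rpi k H M N \<in> Lin (und M \<boxtimes> und N) (und M \<boxtimes> und N)"
  unfolding rpi_sw
  by (intro lin_tlift lin; simp)

lemma dot_eq:
  assumes "comod M" "comod N" "m \<in> carrier (und M)" "n \<in> carrier (und N)"
  shows "dot M N m n = csw M (und M \<boxtimes> und N) (\<lambda>m0 m1. csw N (und M \<boxtimes> und N)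
    (\<lambda>n0 n1. \<epsilon> (m1 ** n1) \<odot>\<^bsub>und M \<boxtimes> und N\<^esub> tens k (und M) (und N) m0 n0) n) m"
  unfolding dot_def rpi_sw
  using assms by (subst tlift_tens[of "und M" "und N"]) (auto intro!: lin)

text \<open>
  The idempotent \<open>\<pi>\<close> is the projection onto the counital part of \<open>M \<otimes> N\<close>.
\<close>

lemma rpi_cpi:
  assumes "comod M" "comod N" "t \<in> carrier (und M \<boxtimes> und N)"
  shows "rpi k H M N t = cpi (und M \<boxtimes> und N) (tco (und M) (coact M) (und N) (coact N)) t"
proof (rule tensor_ext[OF _ _ _ _ _ _ assms(3)])
  have c: "coaction (und M \<boxtimes> und N) (tco (und M) (coact M) (und N) (coact N))"
    using assms by (intro coaction_tco) auto
  show "cpi (und M \<boxtimes> und N) (tco (und M) (coact M) (und N) (coact N)) \<in> Lin (und M \<boxtimes> und N) (und M \<boxtimes> und N)"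
    by (rule cpi_lin[OF c])
  fix m n assume mn: "m \<in> carrier (und M)" "n \<in> carrier (und N)"
  then show "rpi k H M N (tens k (und M) (und N) m n)
    = cpi (und M \<boxtimes> und N) (tco (und M) (coact M) (und N) (coact N)) (tens k (und M) (und N) m n)"
    using assms cpi_bilin[OF c] unfolding cpi_def by (subst sw_tco) (auto simp: dot_eq[unfolded dot_def])
qed (use assms rpi_lin in auto)

abbreviation "RM M N \<equiv> und (RT M N)"

lemma rtensor_ops:
  "zero (RM M N) = zero (und M \<boxtimes> und N)"
  "add (RM M N) = add (und M \<boxtimes> und N)"
  "smult (RM M N) = smult (und M \<boxtimes> und N)"
  by (simp_all add: rtensor_def Let_def rtensor_module_def)

lemma carrier_rtensor: "carrier (RM M N) = rpi k H M N ` carrier (und M \<boxtimes> und N)"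
  by (simp add: rtensor_def Let_def rtensor_module_def)

text \<open>
  The coaction of \<open>M \<otimes>\<^sup>r N\<close> is given by a formula on all of \<open>M \<otimes> N\<close>; that formula is \<open>\<pi> \<otimes> H\<close> after the tensor product
  coaction.
\<close>

lemma rtensor_coact:
  assumes M: "comod M" and N: "comod N" and t: "t \<in> carrier (und M \<boxtimes> und N)" and R: "kmod (RM M N)"
    and e: "rpi k H M N \<in> Lin (und M \<boxtimes> und N) (RM M N)"
  shows "coact (RT M N) t = sw (und M \<boxtimes> und N) (tco (und M) (coact M) (und N) (coact N)) (RM M N \<boxtimes> H)
      (\<lambda>a b. tens k (RM M N) H (rpi k H M N a) b) t"
proof (rule tensor_ext[OF _ _ _ _ _ _ t])
  note [simp] = M N R linear_mapsD(1)[OF e]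
  note le [lin] = lin_comp[OF e]
  have c [simp]: "coaction (und M \<boxtimes> und N) (tco (und M) (coact M) (und N) (coact N))"
    by (intro coaction_tco) auto
  have co: "coact (RT M N) = tlift (RM M N \<boxtimes> H) (\<lambda>m n. csw M (RM M N \<boxtimes> H) (\<lambda>m0 m1. csw N (RM M N \<boxtimes> H) (\<lambda>n0 n1.
         tens k (RM M N) H (rpi k H M N (tens k (und M) (und N) m0 n0)) (m1 ** n1)) n) m)"
    by (simp add: rtensor_def Let_def sw_def)
  have b: "bilin (und M) (und N) (RM M N \<boxtimes> H) (\<lambda>m n. csw M (RM M N \<boxtimes> H) (\<lambda>m0 m1. csw N (RM M N \<boxtimes> H) (\<lambda>n0 n1.
         tens k (RM M N) H (rpi k H M N (tens k (und M) (und N) m0 n0)) (m1 ** n1)) n) m)"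
    by (intro lin le; simp)
  show "coact (RT M N) \<in> Lin (und M \<boxtimes> und N) (RM M N \<boxtimes> H)"
    unfolding co by (intro lin_tlift b) auto
  show "sw (und M \<boxtimes> und N) (tco (und M) (coact M) (und N) (coact N)) (RM M N \<boxtimes> H)
      (\<lambda>a b. tens k (RM M N) H (rpi k H M N a) b) \<in> Lin (und M \<boxtimes> und N) (RM M N \<boxtimes> H)"
    by (intro lin le; simp)
  fix m n assume [simp]: "m \<in> carrier (und M)" "n \<in> carrier (und N)"
  have b2: "bilin (und M \<boxtimes> und N) H (RM M N \<boxtimes> H) (\<lambda>a b. tens k (RM M N) H (rpi k H M N a) b)"
    by (intro lin le; simp)
  show "coact (RT M N) (tens k (und M) (und N) m n) = sw (und M \<boxtimes> und N) (tco (und M) (coact M) (und N) (coact N)) (RM M N \<boxtimes> H)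
      (\<lambda>a b. tens k (RM M N) H (rpi k H M N a) b) (tens k (und M) (und N) m n)"
    unfolding co by (subst tlift_tens[OF _ _ _ b]; simp add: sw_tco b2)
qed (use M N R in auto)

lemma rtensor_retract:
  assumes M: "comod M" and N: "comod N"
  shows "coaction_retract k H (und M \<boxtimes> und N) (tco (und M) (coact M) (und N) (coact N)) (rpi k H M N)
    (RM M N) (coact (RT M N))"
proof -
  let ?X = "und M \<boxtimes> und N" and ?\<rho> = "tco (und M) (coact M) (und N) (coact N)"
  have n: "ncomod ?X ?\<rho>" using M N by (intro ncomod_tco) auto
  then have c: "coaction ?X ?\<rho>" by simp
  have car: "carrier (RM M N) = cpi ?X ?\<rho> ` carrier ?X"
    unfolding carrier_rtensor using rpi_cpi[OF M N] by (intro image_cong) auto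
  interpret P: coaction_retract k H ?X ?\<rho> "cpi ?X ?\<rho>" "RM M N"
    "sw ?X ?\<rho> (RM M N \<boxtimes> H) (\<lambda>a b. tens k (RM M N) H (cpi ?X ?\<rho> a) b)"
    by (rule coaction_retract_cpi[OF n car]) (auto simp: rtensor_ops)
  have e: "rpi k H M N \<in> Lin ?X (RM M N)"
    by (rule linear_maps_cong[OF P.e_lin' P.X_kmod]) (simp add: rpi_cpi[OF M N])
  show ?thesis
  proof
    show "rpi k H M N (rpi k H M N x) = rpi k H M N x" if "x \<in> carrier ?X" for x
      using that P.e_idem[OF that] rpi_cpi[OF M N that] rpi_cpi[OF M N cpi_closed[OF c that]] by simp
    show "sw ?X ?\<rho> (?X \<boxtimes> H) (\<lambda>a b. tens k ?X H (rpi k H M N a) b) (rpi k H M N x) = ?\<rho> (rpi k H M N x)"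
      if "x \<in> carrier ?X" for x
      using P.e_stable[OF that] that rpi_cpi[OF M N] cpi_closed[OF c that] sw_cong[OF c cpi_closed[OF c that],
        of "\<lambda>a b. tens k ?X H (rpi k H M N a) b" "\<lambda>a b. tens k ?X H (cpi ?X ?\<rho> a) b" "?X \<boxtimes> H"]
      by simp
    show "coact (RT M N) x = sw ?X ?\<rho> (RM M N \<boxtimes> H) (\<lambda>a b. tens k (RM M N) H (rpi k H M N a) b) x"
      if "x \<in> carrier (RM M N)" for x
      using P.R_closed[OF that] by (intro rtensor_coact M N e P.R_kmod)
  qed (use n rpi_lin[OF M N] carrier_rtensor in \<open>auto simp: rtensor_ops\<close>)
qed

lemma rpi_closed:
  assumes "comod M" "comod N"
  shows "t \<in> carrier (und M \<boxtimes> und N) \<Longrightarrow> rpi k H M N t \<in> carrier (RM M N)"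
    and "t \<in> carrier (RM M N) \<Longrightarrow> rpi k H M N t = t"
    and "t \<in> carrier (RM M N) \<Longrightarrow> t \<in> carrier (und M \<boxtimes> und N)"
    and "rpi k H M N \<in> Lin (und M \<boxtimes> und N) (RM M N)"
    and "f \<in> Lin (und M \<boxtimes> und N) A \<Longrightarrow> f \<in> Lin (RM M N) A"
    and "g \<in> Lin A (RM M N) \<Longrightarrow> g \<in> Lin A (und M \<boxtimes> und N)"
proof -
  interpret coaction_retract k H "und M \<boxtimes> und N" "tco (und M) (coact M) (und N) (coact N)" "rpi k H M N" "RM M N" "coact (RT M N)"
    by (rule rtensor_retract[OF assms])
  show "t \<in> carrier (und M \<boxtimes> und N) \<Longrightarrow> rpi k H M N t \<in> carrier (RM M N)"
    "t \<in> carrier (RM M N) \<Longrightarrow> rpi k H M N t = t"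
    "t \<in> carrier (RM M N) \<Longrightarrow> t \<in> carrier (und M \<boxtimes> und N)"
    "rpi k H M N \<in> Lin (und M \<boxtimes> und N) (RM M N)"
    "f \<in> Lin (und M \<boxtimes> und N) A \<Longrightarrow> f \<in> Lin (RM M N) A"
    "g \<in> Lin A (RM M N) \<Longrightarrow> g \<in> Lin A (und M \<boxtimes> und N)"
    by (auto simp: e_fix R_closed e_lin' restrict_lin incl_lin)
qed

lemma kmod_RM [simp]: "comod M \<Longrightarrow> comod N \<Longrightarrow> kmod (RM M N)"
  by (rule coaction_retract.R_kmod[OF rtensor_retract])

lemma comodule_rtensor [simp]:
  assumes M: "comod M" and N: "comod N"
  shows "comod (RT M N)"
proof -
  let ?X = "und M \<boxtimes> und N" and ?\<rho> = "tco (und M) (coact M) (und N) (coact N)"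
  interpret coaction_retract k H ?X ?\<rho> "rpi k H M N" "RM M N" "coact (RT M N)"
    by (rule rtensor_retract[OF M N])
  have "cpi (RM M N) (coact (RT M N)) t = t" if t: "t \<in> carrier (RM M N)" for t
  proof -
    have "cpi (RM M N) (coact (RT M N)) t = sw ?X ?\<rho> (RM M N) (\<lambda>a b. \<epsilon> b \<odot>\<^bsub>RM M N\<^esub> rpi k H M N a) t"
      unfolding cpi_def by (rule sw_R[OF R_kmod cpi_bilin[OF R_coaction] t])
    also have "\<dots> = rpi k H M N (cpi ?X ?\<rho> t)"
      by (rule lin_cpi[symmetric]) (auto simp: e_lin' R_closed t)
    also have "\<dots> = t" using rpi_cpi[OF M N R_closed[OF t]] e_fix[OF t] by simp
    finally show ?thesis .
  qed
  then show ?thesis using R_ncomod by (simp add: comodule_iff)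
qed

lemma dot_closed [simp]:
  "comod M \<Longrightarrow> comod N \<Longrightarrow> m \<in> carrier (und M) \<Longrightarrow> n \<in> carrier (und N) \<Longrightarrow> dot M N m n \<in> carrier (RM M N)"
  unfolding dot_def by (intro rpi_closed(1)) auto

lemma lin_dot1 [lin]:
  "f \<in> Lin A (und M) \<Longrightarrow> n \<in> carrier (und N) \<Longrightarrow> comod M \<Longrightarrow> comod N \<Longrightarrow> (\<lambda>x. dot M N (f x) n) \<in> Lin A (RM M N)"
  unfolding dot_def by (intro lin_comp[OF rpi_closed(4)] lin_tens1) auto

lemma lin_dot2 [lin]:
  "m \<in> carrier (und M) \<Longrightarrow> f \<in> Lin A (und N) \<Longrightarrow> comod M \<Longrightarrow> comod N \<Longrightarrow> (\<lambda>x. dot M N m (f x)) \<in> Lin A (RM M N)"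
  unfolding dot_def by (intro lin_comp[OF rpi_closed(4)] lin_tens2) auto


lemma rtensor_ext:
  assumes "comod M" "comod N" "kmod P" "f \<in> Lin (RM M N) P" "g \<in> Lin (RM M N) P"
    and "\<And>m n. m \<in> carrier (und M) \<Longrightarrow> n \<in> carrier (und N) \<Longrightarrow> f (dot M N m n) = g (dot M N m n)"
    and t: "t \<in> carrier (RM M N)"
  shows "f t = g t"
proof -
  have "f (rpi k H M N t) = g (rpi k H M N t)"
    by (rule tensor_ext[OF _ _ assms(3) lin_comp[OF assms(4) rpi_closed(4)] lin_comp[OF assms(5) rpi_closed(4)]])
      (use assms rpi_closed in \<open>auto simp: dot_def\<close>)
  then show ?thesis using assms by (simp add: rpi_closed)
qed

text \<open>
  The \<open>\<pi>\<close> inside \<open>dot\<close> may be dropped before the coaction by \<open>sw_cpi_arg\<close>, so that the coaction of \<open>m \<otimes> n\<close> is left; the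
  \<open>\<pi>\<close> contained in the coaction of \<open>M \<otimes>\<^sup>r N\<close> turns \<open>m\<^sub>0 \<otimes> n\<^sub>0\<close> back into a generator.
\<close>

lemma sw_dot:
  assumes M: "comod M" and N: "comod N" and P: "kmod P" and \<phi>: "bilin (RM M N) H P \<phi>"
    and m: "m \<in> carrier (und M)" and n: "n \<in> carrier (und N)"
  shows "sw (RM M N) (coact (RT M N)) P \<phi> (dot M N m n)
    = csw M P (\<lambda>m0 m1. csw N P (\<lambda>n0 n1. \<phi> (dot M N m0 n0) (m1 ** n1)) n) m"
proof -
  let ?X = "und M \<boxtimes> und N" and ?\<rho> = "tco (und M) (coact M) (und N) (coact N)"
  interpret coaction_retract k H ?X ?\<rho> "rpi k H M N" "RM M N" "coact (RT M N)"
    by (rule rtensor_retract[OF M N])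
  note b = bilin_e[OF \<phi>]
  have t: "tens k (und M) (und N) m n \<in> carrier ?X" using m n by simp
  have "sw (RM M N) (coact (RT M N)) P \<phi> (dot M N m n) = sw ?X ?\<rho> P (\<lambda>a b. \<phi> (rpi k H M N a) b) (dot M N m n)"
    by (rule sw_R[OF P \<phi>]) (use M N m n in simp)
  also have "\<dots> = sw ?X ?\<rho> P (\<lambda>a b. \<phi> (rpi k H M N a) b) (tens k (und M) (und N) m n)"
    unfolding dot_def rpi_cpi[OF M N t] by (rule sw_cpi_arg[OF ncomod_X P b t])
  also have "\<dots> = csw M P (\<lambda>m0 m1. csw N P (\<lambda>n0 n1. \<phi> (dot M N m0 n0) (m1 ** n1)) n) m"
    unfolding dot_def by (rule sw_tco) (use M N P b m n in auto)
  finally show ?thesis .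
qed

text \<open>A linear map on \<open>M \<otimes> N\<close> is evaluated at a generator by expanding the generator in \<open>M \<otimes> N\<close>.\<close>

lemma lin_dot_expand:
  assumes M: "comod M" and N: "comod N" and P: "kmod P" and f: "f \<in> Lin (und M \<boxtimes> und N) P"
    and m: "m \<in> carrier (und M)" and n: "n \<in> carrier (und N)"
  shows "f (dot M N m n) = csw M P (\<lambda>m0 m1. csw N P (\<lambda>n0 n1. \<epsilon> (m1 ** n1) \<odot>\<^bsub>P\<^esub> f (tens k (und M) (und N) m0 n0)) n) m"
proof -
  let ?X = "und M \<boxtimes> und N"
  note [simp] = M N P m n linear_mapsD(1)[OF f]
  have "f (dot M N m n) = csw M P (\<lambda>m0 m1. f (csw N ?X (\<lambda>n0 n1. \<epsilon> (m1 ** n1) \<odot>\<^bsub>?X\<^esub> tens k (und M) (und N) m0 n0) n)) m"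
    unfolding dot_eq[OF M N m n] by (intro sw_push[OF _ _ _ f]) auto
  also have "\<dots> = csw M P (\<lambda>m0 m1. csw N P (\<lambda>n0 n1. f (\<epsilon> (m1 ** n1) \<odot>\<^bsub>?X\<^esub> tens k (und M) (und N) m0 n0)) n) m"
    by (intro sw_cong sw_push[OF _ _ _ f]) auto
  also have "\<dots> = csw M P (\<lambda>m0 m1. csw N P (\<lambda>n0 n1. \<epsilon> (m1 ** n1) \<odot>\<^bsub>P\<^esub> f (tens k (und M) (und N) m0 n0)) n) m"
    by (intro sw_cong) (auto simp: linear_mapsD(3)[OF f])
  finally show ?thesis .
qed

end

section \<open>The unit object\<close>

text \<open>
  The axioms (lc) and (rc) equate two elements of \<open>(H \<otimes> H) \<otimes> H\<close>. Applying the linear map induced by a trilinear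
  \<open>\<psi>\<close> gives equations between Sweedler sums; the middle leg is \<open>f b c = bc\<close> or \<open>f b c = cb\<close>.
\<close>

lemma (in prebialg) comult2_one_lift:
  assumes P: "kmod P" and \<psi>: "trilin H H H P \<psi>"
    and f: "\<And>b c. b \<in> carrier H \<Longrightarrow> c \<in> carrier H \<Longrightarrow> f b c \<in> carrier H"
    and eq: "comult2_one k H = tlift ((H \<boxtimes> H) \<boxtimes> H) (\<lambda>a b. tlift ((H \<boxtimes> H) \<boxtimes> H)
      (\<lambda>c d. tens k (H \<boxtimes> H) H (tens k H H a (f b c)) d) (\<Delta> \<eta>)) (\<Delta> \<eta>)"
  shows "hsw P (\<lambda>a b. hsw P (\<lambda>a0 a1. \<psi> a0 a1 b) a) \<eta> = hsw P (\<lambda>a b. hsw P (\<lambda>c d. \<psi> a (f b c) d) \<eta>) \<eta>"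
proof -
  let ?T = "(H \<boxtimes> H) \<boxtimes> H" and ?F = "\<lambda>t. tlift P (\<lambda>a. tlift P (\<psi> a)) (tassoc k H H H t)"
  note b = trilin_lift[OF kmod_H kmod_H kmod_H P \<psi>]
  have L: "?F \<in> Lin ?T P"
    by (rule lin_comp[OF lin_tlift[OF _ _ _ b] tassoc_lin]) (auto simp: P)
  have "hsw P (\<lambda>a b. hsw P (\<lambda>a0 a1. \<psi> a0 a1 b) a) \<eta> = ?F (comult2_one k H)"
    using coassoc_left[OF coaction_H P \<psi>, of \<eta>] by (simp add: comult2_one_def)
  also have "\<dots> = ?F (hsw ?T (\<lambda>a b. hsw ?T (\<lambda>c d. tens k (H \<boxtimes> H) H (tens k H H a (f b c)) d) \<eta>) \<eta>)"
    by (simp add: eq sw_def)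
  also have "\<dots> = hsw P (\<lambda>a b. ?F (hsw ?T (\<lambda>c d. tens k (H \<boxtimes> H) H (tens k H H a (f b c)) d) \<eta>)) \<eta>"
    by (rule sw_push[OF _ _ _ L]) (auto simp: P f)
  also have "\<dots> = hsw P (\<lambda>a b. hsw P (\<lambda>c d. ?F (tens k (H \<boxtimes> H) H (tens k H H a (f b c)) d)) \<eta>) \<eta>"
    by (intro sw_cong sw_push[OF _ _ _ L]) (auto simp: P f)
  also have "\<dots> = hsw P (\<lambda>a b. hsw P (\<lambda>c d. \<psi> a (f b c) d) \<eta>) \<eta>"
    by (intro sw_cong) (auto simp: P f tassoc_tens tlift_tens[OF _ _ _ b] tlift_tens[OF _ _ _ trilinD(2)[OF \<psi>]])
  finally show ?thesis .
qed

locale comonoidal = prebialg k H for k :: "'u::infinite ring" and H :: "'u prebialg" +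
  assumes lc: "ax_lc k H" and rc: "ax_rc k H"
begin

lemma sw_lc:
  "kmod P \<Longrightarrow> trilin H H H P \<psi> \<Longrightarrow>
   hsw P (\<lambda>a b. hsw P (\<lambda>a0 a1. \<psi> a0 a1 b) a) \<eta> = hsw P (\<lambda>a b. hsw P (\<lambda>c d. \<psi> a (b ** c) d) \<eta>) \<eta>"
  by (rule comult2_one_lift) (use lc in \<open>auto simp: ax_lc_def Let_def\<close>)

lemma sw_rc:
  "kmod P \<Longrightarrow> trilin H H H P \<psi> \<Longrightarrow>
   hsw P (\<lambda>a b. hsw P (\<lambda>a0 a1. \<psi> a0 a1 b) a) \<eta> = hsw P (\<lambda>a b. hsw P (\<lambda>c d. \<psi> a (c ** b) d) \<eta>) \<eta>"
  by (rule comult2_one_lift[where f = "\<lambda>b c. c ** b"]) (use rc in \<open>auto simp: ax_rc_def Let_def\<close>)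

abbreviation "es \<equiv> eps_s k H"
abbreviation "S \<equiv> Hs_comod k H"
abbreviation "HM \<equiv> und S"

lemma es_sw: "es h = hsw H (\<lambda>a b. \<epsilon> (h ** b) \<odot>\<^bsub>H\<^esub> a) \<eta>"
  by (simp add: eps_s_def sw_def)

lemma es_closed [simp]: "h \<in> carrier H \<Longrightarrow> es h \<in> carrier H"
  by (simp add: es_sw)

lemma es_lin: "es \<in> Lin H H"
  unfolding es_sw[abs_def] by (intro lin; simp)

lemma lin_es [lin]: "f \<in> Lin A H \<Longrightarrow> (\<lambda>x. es (f x)) \<in> Lin A H"
  by (rule lin_comp[OF es_lin])

lemma es_push:
  assumes "kmod P" "f \<in> Lin H P" "h \<in> carrier H"
  shows "f (es h) = hsw P (\<lambda>a b. \<epsilon> (h ** b) \<odot>\<^bsub>P\<^esub> f a) \<eta>"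
proof -
  have "f (es h) = hsw P (\<lambda>a b. f (\<epsilon> (h ** b) \<odot>\<^bsub>H\<^esub> a)) \<eta>"
    unfolding es_sw using assms by (intro sw_push) auto
  also have "\<dots> = hsw P (\<lambda>a b. \<epsilon> (h ** b) \<odot>\<^bsub>P\<^esub> f a) \<eta>"
    using assms by (intro sw_cong) (auto simp: linear_mapsD)
  finally show ?thesis .
qed

text \<open>
  Since \<open>\<epsilon>\<^sub>s(h) = \<epsilon>(h1\<^sub>2)1\<^sub>1\<close>, its comultiplication is obtained from \<open>\<Delta>\<^sup>2(1)\<close> by applying \<open>\<epsilon>(h\<cdot>)\<close> to the last leg. The two
  expressions for \<open>\<Delta>\<^sup>2(1)\<close> in (lc) and (rc) give the two formulas.
\<close>

lemma hsw_es:
  assumes P: "kmod P" and \<phi>: "bilin H H P \<phi>" and h: "h \<in> carrier H"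
  shows "hsw P \<phi> (es h) = hsw P (\<lambda>a b. \<phi> a (b ** es h)) \<eta>"
    and "hsw P \<phi> (es h) = hsw P (\<lambda>a b. \<phi> a (es h ** b)) \<eta>"
proof -
  note [simp] = P h bilin_closed[OF \<phi>]
  have L: "hsw P \<phi> \<in> Lin H P" using lin_sw1[OF coaction_H P \<phi> lin_id] by simp
  note l1 = lin_comp[OF bilinD(1)[OF \<phi>]] and l2 = lin_comp[OF bilinD(2)[OF \<phi>]]
  have tr: "trilin H H H P (\<lambda>a b c. \<epsilon> (h ** c) \<odot>\<^bsub>P\<^esub> \<phi> a b)"
    by (intro lin l1 l2; simp add: bilinD[OF \<phi>])
  have 0: "hsw P \<phi> (es h) = hsw P (\<lambda>a b. hsw P (\<lambda>a0 a1. \<epsilon> (h ** b) \<odot>\<^bsub>P\<^esub> \<phi> a0 a1) a) \<eta>"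
    unfolding es_push[OF P L h] by (intro sw_cong sw_smult) auto
  have 1: "hsw P (\<lambda>c d. \<epsilon> (h ** d) \<odot>\<^bsub>P\<^esub> \<phi> a (b ** c)) \<eta> = \<phi> a (b ** es h)"
    and 2: "hsw P (\<lambda>c d. \<epsilon> (h ** d) \<odot>\<^bsub>P\<^esub> \<phi> a (c ** b)) \<eta> = \<phi> a (es h ** b)"
    if "a \<in> carrier H" "b \<in> carrier H" for a b
    using that by (intro es_push[symmetric] l2 lin; simp)+
  show "hsw P \<phi> (es h) = hsw P (\<lambda>a b. \<phi> a (b ** es h)) \<eta>"
    unfolding 0 sw_lc[OF P tr] by (intro sw_cong 1) auto
  show "hsw P \<phi> (es h) = hsw P (\<lambda>a b. \<phi> a (es h ** b)) \<eta>"
    unfolding 0 sw_rc[OF P tr] by (intro sw_cong 2) auto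
qed

text \<open>
  The first leg of \<open>\<Delta>(1)\<close> lies in \<open>H\<^sub>s\<close>, as one sees by applying \<open>\<epsilon>\<close> to the middle leg of (rc).
\<close>

lemma hsw_one_es:
  assumes P: "kmod P" and \<phi>: "bilin H H P \<phi>"
  shows "hsw P (\<lambda>a b. \<phi> (es a) b) \<eta> = hsw P \<phi> \<eta>"
proof -
  note [simp] = P bilin_closed[OF \<phi>]
  have "hsw P (\<lambda>a b. \<phi> (es a) b) \<eta> = hsw P (\<lambda>a b. hsw P (\<lambda>c d. \<epsilon> (a ** d) \<odot>\<^bsub>P\<^esub> \<phi> c b) \<eta>) \<eta>"
    by (intro sw_cong es_push bilinD(1)[OF \<phi>]) auto
  also have "\<dots> = hsw P (\<lambda>a b. hsw P (\<lambda>c d. \<epsilon> (c ** b) \<odot>\<^bsub>P\<^esub> \<phi> a d) \<eta>) \<eta>"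
    by (rule sw_swap) auto
  also have "\<dots> = hsw P (\<lambda>a b. hsw P (\<lambda>a0 a1. \<epsilon> a1 \<odot>\<^bsub>P\<^esub> \<phi> a0 b) a) \<eta>"
    by (rule sw_rc[OF P trilin_bilin(1)[OF P \<phi>], symmetric])
  also have "\<dots> = hsw P \<phi> \<eta>"
    by (intro sw_cong hsw_counit_right bilinD(1)[OF \<phi>]) auto
  finally show ?thesis .
qed

lemma es_idem: "h \<in> carrier H \<Longrightarrow> es (es h) = es h"
proof -
  assume h: "h \<in> carrier H"
  have "es (es h) = hsw H (\<lambda>a b. \<epsilon> (h ** b) \<odot>\<^bsub>H\<^esub> es a) \<eta>"
    using h by (intro es_push es_lin) auto
  also have "\<dots> = hsw H (\<lambda>a b. \<epsilon> (h ** b) \<odot>\<^bsub>H\<^esub> a) \<eta>"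
    by (rule hsw_one_es[of H "\<lambda>a b. \<epsilon> (h ** b) \<odot>\<^bsub>H\<^esub> a"]) (auto intro!: lin simp: h)
  finally show ?thesis by (simp add: es_sw)
qed

lemma es_one: "es \<eta> = \<eta>"
  unfolding es_sw using hsw_counit_right[of H "\<lambda>x. x" \<eta>] by (simp cong: sw_cong)

lemma Hs_ops:
  "zero HM = zero H" "add HM = add H" "smult HM = smult H"
  by (simp_all add: Hs_comod_def Hs_module_def)

lemma carrier_HM: "carrier HM = es ` carrier H"
  by (simp add: Hs_comod_def Hs_module_def)

text \<open>
  The image of \<open>\<epsilon>\<^sub>s\<close> is stable under \<open>\<Delta>\<close> because \<open>\<Delta>(y) = 1\<^sub>1 \<otimes> 1\<^sub>2y\<close> and \<open>1\<^sub>1 = \<epsilon>\<^sub>s(1\<^sub>1)\<close>.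
\<close>

lemma Hs_retract: "coaction_retract k H H \<Delta> es HM (coact S)"
proof
  show "hsw (H \<boxtimes> H) (\<lambda>a b. tens k H H (es a) b) (es h) = \<Delta> (es h)" if h: "h \<in> carrier H" for h
  proof -
    have "hsw (H \<boxtimes> H) (\<lambda>a b. tens k H H (es a) b) (es h) = hsw (H \<boxtimes> H) (\<lambda>a b. tens k H H (es a) (b ** es h)) \<eta>"
      by (rule hsw_es(1)) (auto intro!: lin simp: h)
    also have "\<dots> = hsw (H \<boxtimes> H) (\<lambda>a b. tens k H H a (b ** es h)) \<eta>"
      by (rule hsw_one_es) (auto intro!: lin simp: h)
    also have "\<dots> = hsw (H \<boxtimes> H) (tens k H H) (es h)"
      using h by (intro hsw_es(1)[symmetric] bilin_tens) auto
    finally show ?thesis using h by (simp add: sw_tensor)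
  qed
  show "coact S y = hsw (HM \<boxtimes> H) (\<lambda>a b. tens k HM H (es a) b) y" for y
    by (simp add: Hs_comod_def sw_def tmap_def)
qed (auto simp: es_lin es_idem carrier_HM Hs_ops)

sublocale Hs: coaction_retract k H H \<Delta> es HM "coact S"
  by (rule Hs_retract)

lemma HM_closed [simp]: "y \<in> carrier HM \<Longrightarrow> y \<in> carrier H"
  by (rule Hs.R_closed)

lemma one_HM [simp]: "\<eta> \<in> carrier HM"
  using Hs.e_closed(2)[of \<eta>] by (simp add: es_one)

lemma lin_HM: "(\<lambda>x. x) \<in> Lin HM H"
  by (rule Hs.restrict_lin) simp

lemma comod_S [simp]: "comod S"
proof -
  have "cpi HM (coact S) y = y" if y: "y \<in> carrier HM" for y
  proof -
    have "cpi HM (coact S) y = hsw HM (\<lambda>a b. \<epsilon> b \<odot>\<^bsub>HM\<^esub> es a) y"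
      unfolding cpi_def by (rule Hs.sw_R[OF Hs.R_kmod cpi_bilin[OF Hs.R_coaction] y])
    also have "\<dots> = es y"
      by (rule hsw_counit_right) (auto simp: Hs.e_lin' y)
    finally show ?thesis using Hs.e_fix[OF y] by simp
  qed
  then show ?thesis using Hs.R_ncomod by (simp add: comodule_iff)
qed

abbreviation "ssw P \<beta> y \<equiv> sw HM (coact S) P \<beta> y"

lemma ssw_hsw:
  assumes "kmod P" "bilin H H P \<phi>" "y \<in> carrier HM"
  shows "ssw P \<phi> y = hsw P \<phi> y"
proof -
  have "bilin HM H P \<phi>" using assms(2) by (auto simp: bilin_def Hs.restrict_lin)
  from Hs.sw_R[OF assms(1) this assms(3)] Hs.sw_stable[OF assms] show ?thesis by simp
qed

lemma ssw_one:
  assumes P: "kmod P" and \<phi>: "bilin HM H P \<phi>" and y: "y \<in> carrier HM"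
  shows "ssw P (\<lambda>a b. \<phi> a (b ** y)) \<eta> = ssw P \<phi> y"
    and "ssw P (\<lambda>a b. \<phi> a (y ** b)) \<eta> = ssw P \<phi> y"
proof -
  have y': "es y = y" "y \<in> carrier H" using y by (auto simp: Hs.e_fix)
  note b = Hs.bilin_e[OF \<phi>]
  have b1: "bilin HM H P (\<lambda>a b. \<phi> a (b ** y))" "bilin HM H P (\<lambda>a b. \<phi> a (y ** b))"
    using y by (auto intro!: bilinI lin_comp[OF bilinD(2)[OF \<phi>]] lin_hmult1 lin_hmult2 lin_id simp: bilinD(1)[OF \<phi>])
  show "ssw P (\<lambda>a b. \<phi> a (b ** y)) \<eta> = ssw P \<phi> y"
    using hsw_es(1)[OF P b y'(2)] Hs.sw_R[OF P \<phi> y] Hs.sw_R[OF P b1(1) one_HM] y' by simp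
  show "ssw P (\<lambda>a b. \<phi> a (y ** b)) \<eta> = ssw P \<phi> y"
    using hsw_es(2)[OF P b y'(2)] Hs.sw_R[OF P \<phi> y] Hs.sw_R[OF P b1(2) one_HM] y' by simp
qed

text \<open>
  Write \<open>y = \<epsilon>\<^sub>s(g) = \<epsilon>(g1\<^sub>2)1\<^sub>1\<close>. The two sides of the first identity arise from the two expressions for
  \<open>\<Delta>\<^sup>2(1)\<close> in (rc) by applying the trilinear map \<open>a \<otimes> b \<otimes> c \<mapsto> \<epsilon>(gc)\<epsilon>(bh\<^sub>2) f(ah\<^sub>1)\<close>: the coproduct on the left-hand
  side is absorbed by \<open>\<Delta>(a)\<Delta>(h) = \<Delta>(ah)\<close>, one copy of \<open>\<Delta>(1)\<close> on the right-hand side by \<open>\<Delta>(1)\<Delta>(h) = \<Delta>(h)\<close>. The second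
  identity follows in the same way from (lc), with \<open>h\<close> multiplied from the left.
\<close>

lemma hsw_counit_mult:
  assumes P: "kmod P" and f: "f \<in> Lin H P" and y: "y \<in> carrier HM" and h: "h \<in> carrier H"
  shows "hsw P (\<lambda>a b. \<epsilon> (y ** b) \<odot>\<^bsub>P\<^esub> f a) h = f (y ** h)"
    and "hsw P (\<lambda>a b. \<epsilon> (b ** y) \<odot>\<^bsub>P\<^esub> f a) h = f (h ** y)"
proof -
  obtain g where g: "g \<in> carrier H" and yg: "y = es g" using y by (auto simp: carrier_HM)
  note [simp] = P h g linear_mapsD(1)[OF f]
  note lf = lin_comp[OF f]
  let ?a = "\<lambda>c. hsw P (\<lambda>u v. \<epsilon> (c ** v) \<odot>\<^bsub>P\<^esub> f u) h" and ?b = "\<lambda>c. hsw P (\<lambda>u v. \<epsilon> (v ** c) \<odot>\<^bsub>P\<^esub> f u) h"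
  let ?e = "\<lambda>d. \<epsilon> (g ** d)"
  have "f (y ** h) = hsw P (\<lambda>a b. ?e b \<odot>\<^bsub>P\<^esub> f (a ** h)) \<eta>"
    unfolding yg by (rule es_push) (auto intro!: lf lin)
  also have "\<dots> = hsw P (\<lambda>a b. hsw P (\<lambda>a0 a1. ?e b \<odot>\<^bsub>P\<^esub> hsw P (\<lambda>h1 h2. \<epsilon> (a1 ** h2) \<odot>\<^bsub>P\<^esub> f (a0 ** h1)) h) a) \<eta>"
  proof (intro sw_cong)
    fix a b assume [simp]: "a \<in> carrier H" "b \<in> carrier H"
    have "f (a ** h) = hsw P (\<lambda>u v. \<epsilon> v \<odot>\<^bsub>P\<^esub> f u) (a ** h)"
      by (rule hsw_counit_right[symmetric]) (auto simp: f)
    also have "\<dots> = hsw P (\<lambda>a0 a1. hsw P (\<lambda>h1 h2. \<epsilon> (a1 ** h2) \<odot>\<^bsub>P\<^esub> f (a0 ** h1)) h) a"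
      by (rule hsw_mult) (auto intro!: lin lf simp: f)
    finally show "?e b \<odot>\<^bsub>P\<^esub> f (a ** h) = hsw P (\<lambda>a0 a1. ?e b \<odot>\<^bsub>P\<^esub> hsw P (\<lambda>h1 h2. \<epsilon> (a1 ** h2) \<odot>\<^bsub>P\<^esub> f (a0 ** h1)) h) a"
      by (simp add: sw_smult)
  qed auto
  also have "\<dots> = hsw P (\<lambda>a b. hsw P (\<lambda>c d. ?e d \<odot>\<^bsub>P\<^esub> hsw P (\<lambda>h1 h2. \<epsilon> ((c ** b) ** h2) \<odot>\<^bsub>P\<^esub> f (a ** h1)) h) \<eta>) \<eta>"
    by (rule sw_rc) (auto intro!: lin lf)
  also have "\<dots> = hsw P (\<lambda>c d. hsw P (\<lambda>a b. ?e d \<odot>\<^bsub>P\<^esub> hsw P (\<lambda>h1 h2. \<epsilon> ((c ** b) ** h2) \<odot>\<^bsub>P\<^esub> f (a ** h1)) h) \<eta>) \<eta>"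
    by (rule sw_swap) auto
  also have "\<dots> = hsw P (\<lambda>c d. ?e d \<odot>\<^bsub>P\<^esub> ?a c) \<eta>"
  proof (intro sw_cong)
    fix c d assume [simp]: "c \<in> carrier H" "d \<in> carrier H"
    have "?a c = hsw P (\<lambda>u v. \<epsilon> (c ** v) \<odot>\<^bsub>P\<^esub> f u) (\<eta> ** h)" by simp
    also have "\<dots> = hsw P (\<lambda>a b. hsw P (\<lambda>h1 h2. \<epsilon> (c ** (b ** h2)) \<odot>\<^bsub>P\<^esub> f (a ** h1)) h) \<eta>"
      by (rule hsw_mult) (auto intro!: lin lf simp: f)
    also have "\<dots> = hsw P (\<lambda>a b. hsw P (\<lambda>h1 h2. \<epsilon> ((c ** b) ** h2) \<odot>\<^bsub>P\<^esub> f (a ** h1)) h) \<eta>"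
      by (intro sw_cong) (auto simp: m_assoc)
    finally show "hsw P (\<lambda>a b. ?e d \<odot>\<^bsub>P\<^esub> hsw P (\<lambda>h1 h2. \<epsilon> ((c ** b) ** h2) \<odot>\<^bsub>P\<^esub> f (a ** h1)) h) \<eta> = ?e d \<odot>\<^bsub>P\<^esub> ?a c"
      by (simp add: sw_smult)
  qed auto
  also have "\<dots> = ?a y"
    unfolding yg by (rule es_push[symmetric]) (auto intro!: lin lf simp: f)
  finally show "?a y = f (y ** h)" by simp
  have "f (h ** y) = hsw P (\<lambda>a b. ?e b \<odot>\<^bsub>P\<^esub> f (h ** a)) \<eta>"
    unfolding yg by (rule es_push) (auto intro!: lf lin)
  also have "\<dots> = hsw P (\<lambda>a b. hsw P (\<lambda>a0 a1. ?e b \<odot>\<^bsub>P\<^esub> hsw P (\<lambda>h1 h2. \<epsilon> (h2 ** a1) \<odot>\<^bsub>P\<^esub> f (h1 ** a0)) h) a) \<eta>"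
  proof (intro sw_cong)
    fix a b assume [simp]: "a \<in> carrier H" "b \<in> carrier H"
    have "f (h ** a) = hsw P (\<lambda>u v. \<epsilon> v \<odot>\<^bsub>P\<^esub> f u) (h ** a)"
      by (rule hsw_counit_right[symmetric]) (auto simp: f)
    also have "\<dots> = hsw P (\<lambda>h1 h2. hsw P (\<lambda>a0 a1. \<epsilon> (h2 ** a1) \<odot>\<^bsub>P\<^esub> f (h1 ** a0)) a) h"
      by (rule hsw_mult) (auto intro!: lin lf simp: f)
    also have "\<dots> = hsw P (\<lambda>a0 a1. hsw P (\<lambda>h1 h2. \<epsilon> (h2 ** a1) \<odot>\<^bsub>P\<^esub> f (h1 ** a0)) h) a"
      by (rule sw_swap) auto
    finally show "?e b \<odot>\<^bsub>P\<^esub> f (h ** a) = hsw P (\<lambda>a0 a1. ?e b \<odot>\<^bsub>P\<^esub> hsw P (\<lambda>h1 h2. \<epsilon> (h2 ** a1) \<odot>\<^bsub>P\<^esub> f (h1 ** a0)) h) a"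
      by (simp add: sw_smult)
  qed auto
  also have "\<dots> = hsw P (\<lambda>a b. hsw P (\<lambda>c d. ?e d \<odot>\<^bsub>P\<^esub> hsw P (\<lambda>h1 h2. \<epsilon> (h2 ** (b ** c)) \<odot>\<^bsub>P\<^esub> f (h1 ** a)) h) \<eta>) \<eta>"
    by (rule sw_lc) (auto intro!: lin lf)
  also have "\<dots> = hsw P (\<lambda>c d. hsw P (\<lambda>a b. ?e d \<odot>\<^bsub>P\<^esub> hsw P (\<lambda>h1 h2. \<epsilon> (h2 ** (b ** c)) \<odot>\<^bsub>P\<^esub> f (h1 ** a)) h) \<eta>) \<eta>"
    by (rule sw_swap) auto
  also have "\<dots> = hsw P (\<lambda>c d. ?e d \<odot>\<^bsub>P\<^esub> ?b c) \<eta>"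
  proof (intro sw_cong)
    fix c d assume [simp]: "c \<in> carrier H" "d \<in> carrier H"
    have "?b c = hsw P (\<lambda>u v. \<epsilon> (v ** c) \<odot>\<^bsub>P\<^esub> f u) (h ** \<eta>)" by simp
    also have "\<dots> = hsw P (\<lambda>h1 h2. hsw P (\<lambda>a b. \<epsilon> ((h2 ** b) ** c) \<odot>\<^bsub>P\<^esub> f (h1 ** a)) \<eta>) h"
      by (rule hsw_mult) (auto intro!: lin lf simp: f)
    also have "\<dots> = hsw P (\<lambda>a b. hsw P (\<lambda>h1 h2. \<epsilon> ((h2 ** b) ** c) \<odot>\<^bsub>P\<^esub> f (h1 ** a)) h) \<eta>"
      by (rule sw_swap) auto
    also have "\<dots> = hsw P (\<lambda>a b. hsw P (\<lambda>h1 h2. \<epsilon> (h2 ** (b ** c)) \<odot>\<^bsub>P\<^esub> f (h1 ** a)) h) \<eta>"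
      by (intro sw_cong) (auto simp: m_assoc)
    finally show "hsw P (\<lambda>a b. ?e d \<odot>\<^bsub>P\<^esub> hsw P (\<lambda>h1 h2. \<epsilon> (h2 ** (b ** c)) \<odot>\<^bsub>P\<^esub> f (h1 ** a)) h) \<eta> = ?e d \<odot>\<^bsub>P\<^esub> ?b c"
      by (simp add: sw_smult)
  qed auto
  also have "\<dots> = ?b y"
    unfolding yg by (rule es_push[symmetric]) (auto intro!: lin lf simp: f)
  finally show "?b y = f (h ** y)" by simp
qed

end

section \<open>The actions of the unit object and the unit constraints\<close>

context prebialg
begin

text \<open>
  The actions \<open>y \<triangleright> m\<close> and \<open>m \<triangleleft> y\<close>. They are used for \<open>y\<close> in \<open>H\<^sub>s\<close>, and also for the second leg of \<open>\<Delta>(1)\<close>, which lies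
  only in \<open>H\<close>.
\<close>

definition lact where
  "lact M y m = csw M (und M) (\<lambda>m0 m1. \<epsilon> (y ** m1) \<odot>\<^bsub>und M\<^esub> m0) m"

definition ract where
  "ract M m y = csw M (und M) (\<lambda>m0 m1. \<epsilon> (m1 ** y) \<odot>\<^bsub>und M\<^esub> m0) m"

lemma act_closed [simp]:
  "comod M \<Longrightarrow> y \<in> carrier H \<Longrightarrow> m \<in> carrier (und M) \<Longrightarrow> lact M y m \<in> carrier (und M)"
  "comod M \<Longrightarrow> y \<in> carrier H \<Longrightarrow> m \<in> carrier (und M) \<Longrightarrow> ract M m y \<in> carrier (und M)"
  by (simp_all add: lact_def ract_def)

lemma lin_act [lin]:
  "f \<in> Lin A H \<Longrightarrow> m \<in> carrier (und M) \<Longrightarrow> comod M \<Longrightarrow> (\<lambda>x. lact M (f x) m) \<in> Lin A (und M)"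
  "y \<in> carrier H \<Longrightarrow> g \<in> Lin A (und M) \<Longrightarrow> comod M \<Longrightarrow> (\<lambda>x. lact M y (g x)) \<in> Lin A (und M)"
  "f \<in> Lin A H \<Longrightarrow> m \<in> carrier (und M) \<Longrightarrow> comod M \<Longrightarrow> (\<lambda>x. ract M m (f x)) \<in> Lin A (und M)"
  "y \<in> carrier H \<Longrightarrow> g \<in> Lin A (und M) \<Longrightarrow> comod M \<Longrightarrow> (\<lambda>x. ract M (g x) y) \<in> Lin A (und M)"
  unfolding lact_def ract_def by (intro lin; simp)+

lemma act_push:
  assumes "comod M" "kmod P" "f \<in> Lin (und M) P" "y \<in> carrier H" "m \<in> carrier (und M)"
  shows "f (lact M y m) = csw M P (\<lambda>m0 m1. \<epsilon> (y ** m1) \<odot>\<^bsub>P\<^esub> f m0) m"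
    and "f (ract M m y) = csw M P (\<lambda>m0 m1. \<epsilon> (m1 ** y) \<odot>\<^bsub>P\<^esub> f m0) m"
proof -
  note [simp] = assms(1,2,4,5)
  have "f (lact M y m) = csw M P (\<lambda>m0 m1. f (\<epsilon> (y ** m1) \<odot>\<^bsub>und M\<^esub> m0)) m"
    unfolding lact_def by (rule sw_push[OF _ _ _ assms(3)]) auto
  also have "\<dots> = csw M P (\<lambda>m0 m1. \<epsilon> (y ** m1) \<odot>\<^bsub>P\<^esub> f m0) m"
    by (intro sw_cong) (auto simp: linear_mapsD(3)[OF assms(3)])
  finally show "f (lact M y m) = csw M P (\<lambda>m0 m1. \<epsilon> (y ** m1) \<odot>\<^bsub>P\<^esub> f m0) m" .
  have "f (ract M m y) = csw M P (\<lambda>m0 m1. f (\<epsilon> (m1 ** y) \<odot>\<^bsub>und M\<^esub> m0)) m"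
    unfolding ract_def by (rule sw_push[OF _ _ _ assms(3)]) auto
  also have "\<dots> = csw M P (\<lambda>m0 m1. \<epsilon> (m1 ** y) \<odot>\<^bsub>P\<^esub> f m0) m"
    by (intro sw_cong) (auto simp: linear_mapsD(3)[OF assms(3)])
  finally show "f (ract M m y) = csw M P (\<lambda>m0 m1. \<epsilon> (m1 ** y) \<odot>\<^bsub>P\<^esub> f m0) m" .
qed

lemma act_one:
  assumes "comod M" "m \<in> carrier (und M)"
  shows "lact M \<eta> m = m" "ract M m \<eta> = m"
proof -
  have "csw M (und M) (\<lambda>m0 m1. \<epsilon> (\<eta> ** m1) \<odot>\<^bsub>und M\<^esub> m0) m = csw M (und M) (\<lambda>m0 m1. \<epsilon> m1 \<odot>\<^bsub>und M\<^esub> m0) m"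
    "csw M (und M) (\<lambda>m0 m1. \<epsilon> (m1 ** \<eta>) \<odot>\<^bsub>und M\<^esub> m0) m = csw M (und M) (\<lambda>m0 m1. \<epsilon> m1 \<odot>\<^bsub>und M\<^esub> m0) m"
    using assms by (intro sw_cong; simp)+
  then show "lact M \<eta> m = m" "ract M m \<eta> = m"
    using csw_counit[OF assms(1) _ lin_id assms(2)] assms by (simp_all add: lact_def ract_def)
qed

text \<open>
  The idempotent fixes its image, which contains \<open>dot m n\<close>; expand this generator and apply \<open>\<pi>\<close>.
\<close>

lemma dot_absorb:
  assumes M: "comod M" and N: "comod N" and m: "m \<in> carrier (und M)" and n: "n \<in> carrier (und N)"
  shows "dot M N m n = csw M (RM M N) (\<lambda>m0 m1. csw N (RM M N) (\<lambda>n0 n1. \<epsilon> (m1 ** n1) \<odot>\<^bsub>RM M N\<^esub> dot M N m0 n0) n) m"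
  using lin_dot_expand[OF M N kmod_RM[OF M N] rpi_closed(4)[OF M N] m n] rpi_closed(2)[OF M N dot_closed[OF M N m n]]
  by (simp add: dot_def)

text \<open>By multiplicativity of \<open>\<Delta>\<close> the sums over \<open>\<Delta>(g)\<close> and \<open>\<Delta>(h)\<close> are one sum over \<open>\<Delta>(gh)\<close>, where \<open>\<epsilon>\<close> cancels one leg.\<close>

lemma counit_mult_absorb:
  assumes P: "kmod P" and f: "f \<in> Lin H P" and g: "g \<in> carrier H" and h: "h \<in> carrier H"
  shows "hsw P (\<lambda>g1 g2. hsw P (\<lambda>h1 h2. \<epsilon> (g2 ** h2) \<odot>\<^bsub>P\<^esub> f (g1 ** h1)) h) g = f (g ** h)"
    and "hsw P (\<lambda>g1 g2. hsw P (\<lambda>h1 h2. \<epsilon> (g1 ** h1) \<odot>\<^bsub>P\<^esub> f (g2 ** h2)) h) g = f (g ** h)"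
proof -
  note [simp] = P g h linear_mapsD(1)[OF f]
  have "hsw P (\<lambda>g1 g2. hsw P (\<lambda>h1 h2. \<epsilon> (g2 ** h2) \<odot>\<^bsub>P\<^esub> f (g1 ** h1)) h) g = hsw P (\<lambda>a b. \<epsilon> b \<odot>\<^bsub>P\<^esub> f a) (g ** h)"
    by (rule hsw_mult[symmetric]) (auto intro!: lin simp: f)
  then show "hsw P (\<lambda>g1 g2. hsw P (\<lambda>h1 h2. \<epsilon> (g2 ** h2) \<odot>\<^bsub>P\<^esub> f (g1 ** h1)) h) g = f (g ** h)"
    using hsw_counit_right[OF P f, of "g ** h"] by simp
  have "hsw P (\<lambda>g1 g2. hsw P (\<lambda>h1 h2. \<epsilon> (g1 ** h1) \<odot>\<^bsub>P\<^esub> f (g2 ** h2)) h) g = hsw P (\<lambda>a b. \<epsilon> a \<odot>\<^bsub>P\<^esub> f b) (g ** h)"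
    by (rule hsw_mult[symmetric]) (auto intro!: lin simp: f)
  then show "hsw P (\<lambda>g1 g2. hsw P (\<lambda>h1 h2. \<epsilon> (g1 ** h1) \<odot>\<^bsub>P\<^esub> f (g2 ** h2)) h) g = f (g ** h)"
    using hsw_counit_left[OF P f, of "g ** h"] by simp
qed

lemma act_mult:
  assumes M: "comod M" and y: "y \<in> carrier H" and m: "m \<in> carrier (und M)"
  shows "hsw (und M) (\<lambda>a b. lact M a (lact M b m)) y = lact M y m"
    and "hsw (und M) (\<lambda>a b. ract M (ract M m b) a) y = ract M m y"
proof -
  note [simp] = M y m
  let ?P = "und M"
  have "hsw ?P (\<lambda>a b. lact M a (lact M b m)) y
    = hsw ?P (\<lambda>a b. csw M ?P (\<lambda>m0 m1. \<epsilon> (b ** m1) \<odot>\<^bsub>?P\<^esub> lact M a m0) m) y"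
    by (intro sw_cong act_push(1)) (auto intro!: lin)
  also have "\<dots> = hsw ?P (\<lambda>a b. csw M ?P (\<lambda>m0 m1. csw M ?P (\<lambda>m00 m01. \<epsilon> (b ** m1) \<odot>\<^bsub>?P\<^esub> (\<epsilon> (a ** m01) \<odot>\<^bsub>?P\<^esub> m00)) m0) m) y"
    by (intro sw_cong) (auto simp: lact_def sw_smult)
  also have "\<dots> = hsw ?P (\<lambda>a b. csw M ?P (\<lambda>m0 m1. hsw ?P (\<lambda>h1 h2. \<epsilon> (b ** h2) \<odot>\<^bsub>?P\<^esub> (\<epsilon> (a ** h1) \<odot>\<^bsub>?P\<^esub> m0)) m1) m) y"
    by (intro sw_cong sw_coassoc) (auto intro!: lin)
  also have "\<dots> = csw M ?P (\<lambda>m0 m1. hsw ?P (\<lambda>a b. hsw ?P (\<lambda>h1 h2. \<epsilon> (b ** h2) \<odot>\<^bsub>?P\<^esub> (\<epsilon> (a ** h1) \<odot>\<^bsub>?P\<^esub> m0)) m1) y) m"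
    by (rule sw_swap) auto
  also have "\<dots> = lact M y m"
    unfolding lact_def by (intro sw_cong counit_mult_absorb(1)[of ?P "\<lambda>h. \<epsilon> h \<odot>\<^bsub>?P\<^esub> _"]) (auto intro!: lin)
  finally show "hsw ?P (\<lambda>a b. lact M a (lact M b m)) y = lact M y m" .
  have "hsw ?P (\<lambda>a b. ract M (ract M m b) a) y
    = hsw ?P (\<lambda>a b. csw M ?P (\<lambda>m0 m1. \<epsilon> (m1 ** b) \<odot>\<^bsub>?P\<^esub> ract M m0 a) m) y"
    by (intro sw_cong act_push(2)) (auto intro!: lin)
  also have "\<dots> = hsw ?P (\<lambda>a b. csw M ?P (\<lambda>m0 m1. csw M ?P (\<lambda>m00 m01. \<epsilon> (m1 ** b) \<odot>\<^bsub>?P\<^esub> (\<epsilon> (m01 ** a) \<odot>\<^bsub>?P\<^esub> m00)) m0) m) y"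
    by (intro sw_cong) (auto simp: ract_def sw_smult)
  also have "\<dots> = hsw ?P (\<lambda>a b. csw M ?P (\<lambda>m0 m1. hsw ?P (\<lambda>h1 h2. \<epsilon> (h2 ** b) \<odot>\<^bsub>?P\<^esub> (\<epsilon> (h1 ** a) \<odot>\<^bsub>?P\<^esub> m0)) m1) m) y"
    by (intro sw_cong sw_coassoc) (auto intro!: lin)
  also have "\<dots> = csw M ?P (\<lambda>m0 m1. hsw ?P (\<lambda>a b. hsw ?P (\<lambda>h1 h2. \<epsilon> (h2 ** b) \<odot>\<^bsub>?P\<^esub> (\<epsilon> (h1 ** a) \<odot>\<^bsub>?P\<^esub> m0)) m1) y) m"
    by (rule sw_swap) auto
  also have "\<dots> = csw M ?P (\<lambda>m0 m1. hsw ?P (\<lambda>h1 h2. hsw ?P (\<lambda>a b. \<epsilon> (h2 ** b) \<odot>\<^bsub>?P\<^esub> (\<epsilon> (h1 ** a) \<odot>\<^bsub>?P\<^esub> m0)) y) m1) m"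
    by (intro sw_cong sw_swap) auto
  also have "\<dots> = ract M m y"
    unfolding ract_def by (intro sw_cong counit_mult_absorb(1)[of ?P "\<lambda>h. \<epsilon> h \<odot>\<^bsub>?P\<^esub> _"]) (auto intro!: lin)
  finally show "hsw ?P (\<lambda>a b. ract M (ract M m b) a) y = ract M m y" .
qed

end

context comonoidal
begin

text \<open>
  By \<open>\<Delta>(y) = 1\<^sub>1 \<otimes> 1\<^sub>2y\<close> the element \<open>1 \<triangleleft> y = \<epsilon>(1\<^sub>2y)1\<^sub>1\<close> is the counit applied to \<open>\<Delta>(y)\<close>; similarly for \<open>y \<triangleright> 1\<close>.
\<close>

lemma one_act:
  assumes "y \<in> carrier HM"
  shows "ract S \<eta> y = y" "lact S y \<eta> = y"
proof -
  have b: "bilin HM H HM (\<lambda>a b. \<epsilon> b \<odot>\<^bsub>HM\<^esub> a)" by (rule cpi_bilin[OF Hs.R_coaction])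
  note c = csw_counit[OF comod_S Hs.R_kmod, of "\<lambda>x. x" y]
  show "ract S \<eta> y = y" using ssw_one(1)[OF Hs.R_kmod b assms] c assms by (simp add: ract_def)
  show "lact S y \<eta> = y" using ssw_one(2)[OF Hs.R_kmod b assms] c assms by (simp add: lact_def)
qed

text \<open>Both sides are equal to \<open>\<epsilon>(m\<^sub>1yn\<^sub>1) dot m\<^sub>0 n\<^sub>0\<close>, by the two identities of \<open>hsw_counit_mult\<close>.\<close>

lemma dot_balanced:
  assumes M: "comod M" and N: "comod N" and m: "m \<in> carrier (und M)" and n: "n \<in> carrier (und N)"
    and y: "y \<in> carrier HM"
  shows "dot M N (ract M m y) n = dot M N m (lact N y n)"
proof -
  note [simp] = M N m n y
  let ?R = "RM M N" and ?d = "dot M N"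
  have "?d (ract M m y) n = csw M ?R (\<lambda>m0 m1. \<epsilon> (m1 ** y) \<odot>\<^bsub>?R\<^esub> ?d m0 n) m"
    by (rule act_push(2)) (auto intro!: lin)
  also have "\<dots> = csw M ?R (\<lambda>m0 m1. csw M ?R (\<lambda>m00 m01. \<epsilon> (m1 ** y) \<odot>\<^bsub>?R\<^esub>
      csw N ?R (\<lambda>n0 n1. \<epsilon> (m01 ** n1) \<odot>\<^bsub>?R\<^esub> ?d m00 n0) n) m0) m"
    by (intro sw_cong) (auto simp: sw_smult dot_absorb[of M N _ n])
  also have "\<dots> = csw M ?R (\<lambda>m0 m1. hsw ?R (\<lambda>h1 h2. \<epsilon> (h2 ** y) \<odot>\<^bsub>?R\<^esub>
      csw N ?R (\<lambda>n0 n1. \<epsilon> (h1 ** n1) \<odot>\<^bsub>?R\<^esub> ?d m0 n0) n) m1) m"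
    by (rule sw_coassoc) (auto intro!: lin)
  also have "\<dots> = csw M ?R (\<lambda>m0 m1. csw N ?R (\<lambda>n0 n1. \<epsilon> ((m1 ** y) ** n1) \<odot>\<^bsub>?R\<^esub> ?d m0 n0) n) m"
    by (intro sw_cong hsw_counit_mult(2)[of ?R "\<lambda>h. csw N ?R (\<lambda>n0 n1. \<epsilon> (h ** n1) \<odot>\<^bsub>?R\<^esub> ?d _ n0) n"])
      (auto intro!: lin)
  also have "\<dots> = csw N ?R (\<lambda>n0 n1. csw M ?R (\<lambda>m0 m1. \<epsilon> ((m1 ** y) ** n1) \<odot>\<^bsub>?R\<^esub> ?d m0 n0) m) n"
    by (rule sw_swap) (auto)
  also have "\<dots> = csw N ?R (\<lambda>n0 n1. csw M ?R (\<lambda>m0 m1. \<epsilon> (m1 ** (y ** n1)) \<odot>\<^bsub>?R\<^esub> ?d m0 n0) m) n"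
    by (intro sw_cong) (auto simp: m_assoc)
  also have "\<dots> = csw N ?R (\<lambda>n0 n1. hsw ?R (\<lambda>h1 h2. \<epsilon> (y ** h2) \<odot>\<^bsub>?R\<^esub>
      csw M ?R (\<lambda>m0 m1. \<epsilon> (m1 ** h1) \<odot>\<^bsub>?R\<^esub> ?d m0 n0) m) n1) n"
    by (intro sw_cong hsw_counit_mult(1)[of ?R "\<lambda>h. csw M ?R (\<lambda>m0 m1. \<epsilon> (m1 ** h) \<odot>\<^bsub>?R\<^esub> ?d m0 _) m", symmetric])
      (auto intro!: lin)
  also have "\<dots> = csw N ?R (\<lambda>n0 n1. csw N ?R (\<lambda>n00 n01. \<epsilon> (y ** n1) \<odot>\<^bsub>?R\<^esub>
      csw M ?R (\<lambda>m0 m1. \<epsilon> (m1 ** n01) \<odot>\<^bsub>?R\<^esub> ?d m0 n00) m) n0) n"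
    by (rule sw_coassoc[symmetric]) (auto intro!: lin)
  also have "\<dots> = csw N ?R (\<lambda>n0 n1. \<epsilon> (y ** n1) \<odot>\<^bsub>?R\<^esub> ?d m n0) n"
  proof (intro sw_cong)
    fix n0 n1 assume [simp]: "n0 \<in> carrier (und N)" "n1 \<in> carrier H"
    have "?d m n0 = csw N ?R (\<lambda>n00 n01. csw M ?R (\<lambda>m0 m1. \<epsilon> (m1 ** n01) \<odot>\<^bsub>?R\<^esub> ?d m0 n00) m) n0"
      by (subst dot_absorb) (auto intro!: sw_swap)
    then show "csw N ?R (\<lambda>n00 n01. \<epsilon> (y ** n1) \<odot>\<^bsub>?R\<^esub> csw M ?R (\<lambda>m0 m1. \<epsilon> (m1 ** n01) \<odot>\<^bsub>?R\<^esub> ?d m0 n00) m) n0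
      = \<epsilon> (y ** n1) \<odot>\<^bsub>?R\<^esub> ?d m n0"
      by (simp add: sw_smult)
  qed auto
  also have "\<dots> = ?d m (lact N y n)"
    by (rule act_push(1)[symmetric]) (auto intro!: lin)
  finally show ?thesis .
qed

lemma dot_one_act:
  assumes "comod M" "y \<in> carrier HM" "m \<in> carrier (und M)"
  shows "dot S M \<eta> (lact M y m) = dot S M y m" "dot M S (ract M m y) \<eta> = dot M S m y"
  using dot_balanced[OF comod_S assms(1) _ assms(3,2), of \<eta>] dot_balanced[OF assms(1) comod_S assms(3) _ assms(2), of \<eta>]
    one_act[OF assms(2)] assms by simp_all


abbreviation "runit_l M \<equiv> tlift (und M) (\<lambda>y m. tlift (und M) (\<lambda>m0 m1. \<epsilon> (y ** m1) \<odot>\<^bsub>und M\<^esub> m0) (coact M m))"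
abbreviation "runit_r M \<equiv> tlift (und M) (\<lambda>m y. tlift (und M) (\<lambda>m0 m1. \<epsilon> (m1 ** y) \<odot>\<^bsub>und M\<^esub> m0) (coact M m))"

lemma runit_act: "runit_l M = tlift (und M) (lact M)" "runit_r M = tlift (und M) (ract M)"
  by (simp_all add: lact_def[abs_def] ract_def[abs_def] sw_def)

lemma act_bilin: "comod M \<Longrightarrow> bilin HM (und M) (und M) (lact M)" "comod M \<Longrightarrow> bilin (und M) HM (und M) (ract M)"
  by (intro bilinI lin_act lin_HM lin_id; simp)+

lemma runit_tensor_lin:
  "comod M \<Longrightarrow> runit_l M \<in> Lin (HM \<boxtimes> und M) (und M)"
  "comod M \<Longrightarrow> runit_r M \<in> Lin (und M \<boxtimes> HM) (und M)"
  unfolding runit_act by (intro lin_tlift act_bilin; simp)+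

lemma runit_lin [simp]:
  "comod M \<Longrightarrow> runit_l M \<in> Lin (RM S M) (und M)"
  "comod M \<Longrightarrow> runit_r M \<in> Lin (RM M S) (und M)"
  using rpi_closed(5)[OF comod_S, of M "runit_l M" "und M"] rpi_closed(5)[OF _ comod_S, of M "runit_r M" "und M"]
    runit_tensor_lin by auto

text \<open>
  On \<open>y \<otimes> m\<close> the constraint is the action; on \<open>dot y m = \<epsilon>(y\<^sub>2m\<^sub>1) y\<^sub>1 \<otimes> m\<^sub>0\<close> it is therefore \<open>y\<^sub>1 \<triangleright> (y\<^sub>2 \<triangleright> m)\<close>, and
  \<open>act_mult\<close> applies.
\<close>

lemma runit_dot:
  assumes M: "comod M" and y: "y \<in> carrier HM" and m: "m \<in> carrier (und M)"
  shows "runit_l M (dot S M y m) = lact M y m" "runit_r M (dot M S m y) = ract M m y"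
proof -
  note [simp] = M m y
  let ?P = "und M"
  have "runit_l M (dot S M y m) = ssw ?P (\<lambda>y0 y1. csw M ?P (\<lambda>m0 m1. \<epsilon> (y1 ** m1) \<odot>\<^bsub>?P\<^esub> runit_l M (tens k HM ?P y0 m0)) m) y"
    using lin_dot_expand[OF comod_S M, of ?P "runit_l M" y m] runit_tensor_lin(1)[OF M] by simp
  also have "\<dots> = ssw ?P (\<lambda>y0 y1. csw M ?P (\<lambda>m0 m1. \<epsilon> (y1 ** m1) \<odot>\<^bsub>?P\<^esub> lact M y0 m0) m) y"
    unfolding runit_act using Hs.R_coaction by (intro sw_cong) (auto simp: tlift_tens act_bilin)
  also have "\<dots> = ssw ?P (\<lambda>y0 y1. lact M y0 (lact M y1 m)) y"
    using Hs.R_coaction by (intro sw_cong act_push(1)[symmetric]) (auto intro!: lin)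
  also have "\<dots> = hsw ?P (\<lambda>y0 y1. lact M y0 (lact M y1 m)) y"
    by (rule ssw_hsw) (auto intro!: lin)
  also have "\<dots> = lact M y m"
    by (rule act_mult) auto
  finally show "runit_l M (dot S M y m) = lact M y m" .
  have "runit_r M (dot M S m y) = csw M ?P (\<lambda>m0 m1. ssw ?P (\<lambda>y0 y1. \<epsilon> (m1 ** y1) \<odot>\<^bsub>?P\<^esub> runit_r M (tens k ?P HM m0 y0)) y) m"
    using lin_dot_expand[OF M comod_S, of ?P "runit_r M" m y] runit_tensor_lin(2)[OF M] by simp
  also have "\<dots> = csw M ?P (\<lambda>m0 m1. ssw ?P (\<lambda>y0 y1. \<epsilon> (m1 ** y1) \<odot>\<^bsub>?P\<^esub> ract M m0 y0) y) m"
    unfolding runit_act using Hs.R_coaction by (intro sw_cong) (auto simp: tlift_tens act_bilin)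
  also have "\<dots> = ssw ?P (\<lambda>y0 y1. csw M ?P (\<lambda>m0 m1. \<epsilon> (m1 ** y1) \<odot>\<^bsub>?P\<^esub> ract M m0 y0) m) y"
    using Hs.R_coaction by (intro sw_swap) auto
  also have "\<dots> = ssw ?P (\<lambda>y0 y1. ract M (ract M m y1) y0) y"
    using Hs.R_coaction by (intro sw_cong act_push(2)[symmetric]) (auto intro!: lin)
  also have "\<dots> = hsw ?P (\<lambda>y0 y1. ract M (ract M m y1) y0) y"
    by (rule ssw_hsw) (auto intro!: lin)
  also have "\<dots> = ract M m y"
    by (rule act_mult) auto
  finally show "runit_r M (dot M S m y) = ract M m y" .
qed

lemma runit_inverse:
  assumes M: "comod M"
  shows "m \<in> carrier (und M) \<Longrightarrow> runit_l M (dot S M \<eta> m) = m"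
    and "m \<in> carrier (und M) \<Longrightarrow> runit_r M (dot M S m \<eta>) = m"
    and "t \<in> carrier (RM S M) \<Longrightarrow> dot S M \<eta> (runit_l M t) = t"
    and "u \<in> carrier (RM M S) \<Longrightarrow> dot M S (runit_r M u) \<eta> = u"
proof -
  show "m \<in> carrier (und M) \<Longrightarrow> runit_l M (dot S M \<eta> m) = m" "m \<in> carrier (und M) \<Longrightarrow> runit_r M (dot M S m \<eta>) = m"
    using M runit_dot[OF M one_HM] act_one[OF M] by auto
  show "dot S M \<eta> (runit_l M t) = t" if "t \<in> carrier (RM S M)"
    by (rule rtensor_ext[OF comod_S M kmod_RM[OF comod_S M] lin_dot2[OF _ runit_lin(1)] _ _ that, of _ "\<lambda>x. x"])
      (use M in \<open>auto simp: runit_dot dot_one_act\<close>)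
  show "dot M S (runit_r M u) \<eta> = u" if "u \<in> carrier (RM M S)"
    by (rule rtensor_ext[OF M comod_S kmod_RM[OF M comod_S] lin_dot1[OF runit_lin(2)] _ _ that, of _ "\<lambda>x. x"])
      (use M in \<open>auto simp: runit_dot dot_one_act\<close>)
qed

text \<open>
  The maps \<open>m \<mapsto> dot 1 m\<close> and \<open>m \<mapsto> dot m 1\<close> are colinear: in the coaction \<open>dot 1\<^sub>1 m\<^sub>0 \<otimes> 1\<^sub>2m\<^sub>1\<close> of \<open>dot 1 m\<close> the first
  factor is \<open>dot 1 (1\<^sub>1 \<triangleright> m\<^sub>0)\<close>, and \<open>\<Delta>(1)\<Delta>(m\<^sub>1) = \<Delta>(m\<^sub>1)\<close> leaves \<open>dot 1 m\<^sub>0 \<otimes> m\<^sub>1\<close>.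
\<close>

lemma sw_dot_one:
  assumes M: "comod M" and P: "kmod P" and m: "m \<in> carrier (und M)"
  shows "bilin (RM S M) H P \<phi> \<Longrightarrow> sw (RM S M) (coact (RT S M)) P \<phi> (dot S M \<eta> m) = csw M P (\<lambda>m0 m1. \<phi> (dot S M \<eta> m0) m1) m"
    and "bilin (RM M S) H P \<psi> \<Longrightarrow> sw (RM M S) (coact (RT M S)) P \<psi> (dot M S m \<eta>) = csw M P (\<lambda>m0 m1. \<psi> (dot M S m0 \<eta>) m1) m"
proof -
  note [simp] = M P m
  show "sw (RM S M) (coact (RT S M)) P \<phi> (dot S M \<eta> m) = csw M P (\<lambda>m0 m1. \<phi> (dot S M \<eta> m0) m1) m"
    if \<phi>: "bilin (RM S M) H P \<phi>"
  proof -
    let ?f = "\<lambda>m0 h. \<phi> (dot S M \<eta> m0) h"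
    have l1: "(\<lambda>x. ?f (f x) h) \<in> Lin A P" if "f \<in> Lin A (und M)" "h \<in> carrier H" for f h and A :: "('u, 'u, 'z) module_scheme"
      using that by (intro lin_comp[OF bilinD(1)[OF \<phi>]] lin) auto
    have l2: "(\<lambda>x. ?f m0 (f x)) \<in> Lin A P" if "f \<in> Lin A H" "m0 \<in> carrier (und M)" for f m0 and A :: "('u, 'u, 'z) module_scheme"
      using that by (intro lin_comp[OF bilinD(2)[OF \<phi>]]) auto
    have c [simp]: "?f m0 h \<in> carrier P" if "m0 \<in> carrier (und M)" "h \<in> carrier H" for m0 h
      using that by (intro bilin_closed[OF \<phi>]) auto
    have "sw (RM S M) (coact (RT S M)) P \<phi> (dot S M \<eta> m) = ssw P (\<lambda>y0 y1. csw M P (\<lambda>m0 m1. \<phi> (dot S M y0 m0) (y1 ** m1)) m) \<eta>"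
      using sw_dot[OF comod_S M P \<phi>] by simp
    also have "\<dots> = ssw P (\<lambda>y0 y1. csw M P (\<lambda>m0 m1. csw M P (\<lambda>m00 m01. \<epsilon> (y0 ** m01) \<odot>\<^bsub>P\<^esub> ?f m00 (y1 ** m1)) m0) m) \<eta>"
    proof (intro sw_cong)
      fix y0 y1 m0 m1 assume [simp]: "y0 \<in> carrier HM" "y1 \<in> carrier H" "m0 \<in> carrier (und M)" "m1 \<in> carrier H"
      have "\<phi> (dot S M y0 m0) (y1 ** m1) = ?f (lact M y0 m0) (y1 ** m1)" by (simp add: dot_one_act)
      also have "\<dots> = csw M P (\<lambda>m00 m01. \<epsilon> (y0 ** m01) \<odot>\<^bsub>P\<^esub> ?f m00 (y1 ** m1)) m0"
        by (rule act_push(1)) (auto intro!: l1 lin)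
      finally show "\<phi> (dot S M y0 m0) (y1 ** m1) = csw M P (\<lambda>m00 m01. \<epsilon> (y0 ** m01) \<odot>\<^bsub>P\<^esub> ?f m00 (y1 ** m1)) m0" .
    qed (use Hs.R_coaction in auto)
    also have "\<dots> = ssw P (\<lambda>y0 y1. csw M P (\<lambda>m0 m1. hsw P (\<lambda>h1 h2. \<epsilon> (y0 ** h1) \<odot>\<^bsub>P\<^esub> ?f m0 (y1 ** h2)) m1) m) \<eta>"
      using Hs.R_coaction by (intro sw_cong sw_coassoc) (auto intro!: lin l1 l2)
    also have "\<dots> = hsw P (\<lambda>y0 y1. csw M P (\<lambda>m0 m1. hsw P (\<lambda>h1 h2. \<epsilon> (y0 ** h1) \<odot>\<^bsub>P\<^esub> ?f m0 (y1 ** h2)) m1) m) \<eta>"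
      by (rule ssw_hsw) (auto intro!: lin l1 l2)
    also have "\<dots> = csw M P (\<lambda>m0 m1. hsw P (\<lambda>y0 y1. hsw P (\<lambda>h1 h2. \<epsilon> (y0 ** h1) \<odot>\<^bsub>P\<^esub> ?f m0 (y1 ** h2)) m1) \<eta>) m"
      by (rule sw_swap) auto
    also have "\<dots> = csw M P (\<lambda>m0 m1. ?f m0 (\<eta> ** m1)) m"
      by (intro sw_cong counit_mult_absorb(2)) (auto intro!: l2 lin_id)
    also have "\<dots> = csw M P (\<lambda>m0 m1. ?f m0 m1) m"
      by (intro sw_cong) auto
    finally show ?thesis .
  qed
  show "sw (RM M S) (coact (RT M S)) P \<psi> (dot M S m \<eta>) = csw M P (\<lambda>m0 m1. \<psi> (dot M S m0 \<eta>) m1) m"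
    if \<phi>: "bilin (RM M S) H P \<psi>"
  proof -
    let ?f = "\<lambda>m0 h. \<psi> (dot M S m0 \<eta>) h"
    have l1: "(\<lambda>x. ?f (f x) h) \<in> Lin A P" if "f \<in> Lin A (und M)" "h \<in> carrier H" for f h and A :: "('u, 'u, 'z) module_scheme"
      using that by (intro lin_comp[OF bilinD(1)[OF \<phi>]] lin) auto
    have l2: "(\<lambda>x. ?f m0 (f x)) \<in> Lin A P" if "f \<in> Lin A H" "m0 \<in> carrier (und M)" for f m0 and A :: "('u, 'u, 'z) module_scheme"
      using that by (intro lin_comp[OF bilinD(2)[OF \<phi>]]) auto
    have c [simp]: "?f m0 h \<in> carrier P" if "m0 \<in> carrier (und M)" "h \<in> carrier H" for m0 h
      using that by (intro bilin_closed[OF \<phi>]) auto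
    have "sw (RM M S) (coact (RT M S)) P \<psi> (dot M S m \<eta>) = csw M P (\<lambda>m0 m1. ssw P (\<lambda>y0 y1. \<psi> (dot M S m0 y0) (m1 ** y1)) \<eta>) m"
      using sw_dot[OF M comod_S P \<phi>] by simp
    also have "\<dots> = csw M P (\<lambda>m0 m1. ssw P (\<lambda>y0 y1. csw M P (\<lambda>m00 m01. \<epsilon> (m01 ** y0) \<odot>\<^bsub>P\<^esub> ?f m00 (m1 ** y1)) m0) \<eta>) m"
    proof (intro sw_cong)
      fix y0 y1 m0 m1 assume [simp]: "y0 \<in> carrier HM" "y1 \<in> carrier H" "m0 \<in> carrier (und M)" "m1 \<in> carrier H"
      have "\<psi> (dot M S m0 y0) (m1 ** y1) = ?f (ract M m0 y0) (m1 ** y1)" by (simp add: dot_one_act)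
      also have "\<dots> = csw M P (\<lambda>m00 m01. \<epsilon> (m01 ** y0) \<odot>\<^bsub>P\<^esub> ?f m00 (m1 ** y1)) m0"
        by (rule act_push(2)) (auto intro!: l1 lin)
      finally show "\<psi> (dot M S m0 y0) (m1 ** y1) = csw M P (\<lambda>m00 m01. \<epsilon> (m01 ** y0) \<odot>\<^bsub>P\<^esub> ?f m00 (m1 ** y1)) m0" .
    qed (use Hs.R_coaction in auto)
    also have "\<dots> = csw M P (\<lambda>m0 m1. hsw P (\<lambda>y0 y1. csw M P (\<lambda>m00 m01. \<epsilon> (m01 ** y0) \<odot>\<^bsub>P\<^esub> ?f m00 (m1 ** y1)) m0) \<eta>) m"
      by (intro sw_cong ssw_hsw) (auto intro!: lin l1 l2)
    also have "\<dots> = csw M P (\<lambda>m0 m1. csw M P (\<lambda>m00 m01. hsw P (\<lambda>y0 y1. \<epsilon> (m01 ** y0) \<odot>\<^bsub>P\<^esub> ?f m00 (m1 ** y1)) \<eta>) m0) m"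
      by (intro sw_cong sw_swap) auto
    also have "\<dots> = csw M P (\<lambda>m0 m1. hsw P (\<lambda>h1 h2. hsw P (\<lambda>y0 y1. \<epsilon> (h1 ** y0) \<odot>\<^bsub>P\<^esub> ?f m0 (h2 ** y1)) \<eta>) m1) m"
      by (rule sw_coassoc) (auto intro!: lin l1 l2)
    also have "\<dots> = csw M P (\<lambda>m0 m1. ?f m0 (m1 ** \<eta>)) m"
      by (intro sw_cong counit_mult_absorb(2)) (auto intro!: l2 lin_id)
    also have "\<dots> = csw M P (\<lambda>m0 m1. ?f m0 m1) m"
      by (intro sw_cong) auto
    finally show ?thesis .
  qed
qed

end

section \<open>Comodule maps and the associativity constraint\<close>

context prebialg
begin

abbreviation "CM \<equiv> comodule_maps k H"

lemma comodule_mapsD: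
  assumes f: "f \<in> CM M N"
  shows "f \<in> Lin (und M) (und N)"
    and "comod M \<Longrightarrow> comod N \<Longrightarrow> kmod P \<Longrightarrow> bilin (und N) H P \<phi> \<Longrightarrow> m \<in> carrier (und M)
      \<Longrightarrow> csw N P \<phi> (f m) = csw M P (\<lambda>m0 m1. \<phi> (f m0) m1) m"
proof -
  show l: "f \<in> Lin (und M) (und N)" using f by (simp add: comodule_maps_def)
  assume "comod M" "comod N" "kmod P" "bilin (und N) H P \<phi>" "m \<in> carrier (und M)"
  then show "csw N P \<phi> (f m) = csw M P (\<lambda>m0 m1. \<phi> (f m0) m1) m"
    using f tlift_tmap[of "und M" H "und N" H P f "\<lambda>x. x" \<phi> "coact M m"] l coactionD(2)[of "und M" "coact M" m]
    by (simp add: comodule_maps_def sw_def id_def)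
qed

lemma comodule_mapsI:
  assumes "comod M" "comod N" and f: "f \<in> Lin (und M) (und N)"
    and c: "\<And>m. m \<in> carrier (und M) \<Longrightarrow>
      csw N (und N \<boxtimes> H) (tens k (und N) H) (f m) = csw M (und N \<boxtimes> H) (\<lambda>m0 m1. tens k (und N) H (f m0) m1) m"
  shows "f \<in> CM M N"
  unfolding comodule_maps_def
proof (intro CollectI conjI ballI f)
  fix m assume m: "m \<in> carrier (und M)"
  show "coact N (f m) = tmap k (und N) H f id (coact M m)"
    using c[OF m] linear_mapsD(1)[OF f m] assms by (simp add: sw_tensor) (simp add: sw_def tmap_def)
qed

lemma comodule_maps_id: "comod M \<Longrightarrow> (\<lambda>x. x) \<in> CM M M"
  by (rule comodule_mapsI) auto

lemma comodule_maps_comp: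
  assumes "comod L" "comod M" "comod N" and f: "f \<in> CM L M" and g: "g \<in> CM M N"
  shows "(\<lambda>x. g (f x)) \<in> CM L N"
proof (rule comodule_mapsI)
  have b: "bilin (und N) H (und N \<boxtimes> H) (tens k (und N) H)" using assms by (intro bilin_tens) auto
  have b': "bilin (und M) H (und N \<boxtimes> H) (\<lambda>a. tens k (und N) H (g a))"
    using assms comodule_mapsD(1)[OF g] by (auto intro!: lin simp: linear_mapsD(1))
  fix x assume "x \<in> carrier (und L)"
  then show "csw N (und N \<boxtimes> H) (tens k (und N) H) (g (f x))
    = csw L (und N \<boxtimes> H) (\<lambda>m0. tens k (und N) H (g (f m0))) x"
    using assms linear_mapsD(1)[OF comodule_mapsD(1)[OF f]]
    by (simp add: comodule_mapsD(2)[OF g _ _ _ b] comodule_mapsD(2)[OF f _ _ _ b'])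
qed (use assms in \<open>auto intro: lin_comp comodule_mapsD(1)\<close>)

lemma comodule_maps_inverse:
  assumes M: "comod M" and N: "comod N" and f: "f \<in> CM M N" and g: "g \<in> Lin (und N) (und M)"
    and gf: "\<And>x. x \<in> carrier (und M) \<Longrightarrow> g (f x) = x" and fg: "\<And>y. y \<in> carrier (und N) \<Longrightarrow> f (g y) = y"
  shows "g \<in> CM N M"
proof (rule comodule_mapsI[OF N M g])
  fix y assume y: "y \<in> carrier (und N)"
  let ?T = "und M \<boxtimes> H"
  have gy: "g y \<in> carrier (und M)" using y linear_mapsD(1)[OF g] by simp
  have b: "bilin (und N) H ?T (\<lambda>a b. tens k (und M) H (g a) b)"
    using M linear_mapsD(1)[OF g] by (auto intro!: lin g)
  have "csw N ?T (\<lambda>a b. tens k (und M) H (g a) b) (f (g y)) = csw M ?T (\<lambda>a b. tens k (und M) H (g (f a)) b) (g y)"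
    using M N gy b by (intro comodule_mapsD(2)[OF f]) auto
  also have "\<dots> = csw M ?T (tens k (und M) H) (g y)"
    using M gy by (intro sw_cong) (auto simp: gf)
  finally show "csw M ?T (tens k (und M) H) (g y) = csw N ?T (\<lambda>a b. tens k (und M) H (g a) b) y"
    using fg[OF y] by simp
qed

text \<open>
  A variant of \<open>sw_dot\<close> for bilinear maps that are defined on the whole of \<open>M \<otimes> N\<close>, where no \<open>\<pi>\<close> remains.
\<close>

lemma sw_dot_tensor:
  assumes M: "comod M" and N: "comod N" and P: "kmod P" and \<phi>: "bilin (und M \<boxtimes> und N) H P \<phi>"
    and m: "m \<in> carrier (und M)" and n: "n \<in> carrier (und N)"
  shows "csw (RT M N) P \<phi> (dot M N m n)
    = csw M P (\<lambda>m0 m1. csw N P (\<lambda>n0 n1. \<phi> (tens k (und M) (und N) m0 n0) (m1 ** n1)) n) m"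
proof -
  let ?X = "und M \<boxtimes> und N" and ?\<rho> = "tco (und M) (coact M) (und N) (coact N)"
  interpret coaction_retract k H ?X ?\<rho> "rpi k H M N" "RM M N" "coact (RT M N)"
    by (rule rtensor_retract[OF M N])
  have b: "bilin (RM M N) H P \<phi>" using \<phi> by (auto simp: bilin_def restrict_lin R_closed)
  have t: "tens k (und M) (und N) m n \<in> carrier ?X" using m n by simp
  have "csw (RT M N) P \<phi> (dot M N m n) = sw ?X ?\<rho> P \<phi> (dot M N m n)"
    using sw_R[OF P b] sw_stable[OF P \<phi>] M N m n by simp
  also have "\<dots> = sw ?X ?\<rho> P \<phi> (tens k (und M) (und N) m n)"
    unfolding dot_def rpi_cpi[OF M N t] by (rule sw_cpi_arg[OF ncomod_X P \<phi> t])
  also have "\<dots> = csw M P (\<lambda>m0 m1. csw N P (\<lambda>n0 n1. \<phi> (tens k (und M) (und N) m0 n0) (m1 ** n1)) n) m"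
    by (rule sw_tco) (use M N P \<phi> m n in auto)
  finally show ?thesis .
qed

lemma lin_into_rtensor:
  assumes "comod M" "comod N" "kmod Q" "f \<in> Lin Q (und M \<boxtimes> und N)"
    and "\<And>t. t \<in> carrier Q \<Longrightarrow> rpi k H M N (f t) = f t"
  shows "f \<in> Lin Q (RM M N)"
  by (rule linear_maps_cong[OF lin_comp[OF rpi_closed(4) assms(4)]]) (use assms in auto)

text \<open>
  Being fixed by \<open>\<pi>\<close> is a linear condition, so it can be tested on generators.
\<close>

lemma rtensor_map_closed:
  assumes "comod L" "comod L'" "comod M" "comod N" and f: "f \<in> Lin (RM L L') (und M \<boxtimes> und N)"
    and "\<And>l l'. l \<in> carrier (und L) \<Longrightarrow> l' \<in> carrier (und L') \<Longrightarrow> f (dot L L' l l') \<in> carrier (RM M N)"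
  shows "f \<in> Lin (RM L L') (RM M N)"
proof (rule lin_into_rtensor[OF assms(3,4) _ f])
  fix t assume "t \<in> carrier (RM L L')"
  then show "rpi k H M N (f t) = f t"
    by (rule rtensor_ext[OF assms(1,2) _ lin_comp[OF rpi_lin[OF assms(3,4)] f] f, rotated 2])
      (use assms rpi_closed(2)[OF assms(3,4)] in auto)
qed (use assms in auto)

lemma rtensor_ext_left:
  assumes "comod M" "comod N" "comod L" "kmod P"
    and f: "f \<in> Lin (RM (RT M N) L) P" and g: "g \<in> Lin (RM (RT M N) L) P"
    and e: "\<And>m n l. m \<in> carrier (und M) \<Longrightarrow> n \<in> carrier (und N) \<Longrightarrow> l \<in> carrier (und L)
      \<Longrightarrow> f (dot (RT M N) L (dot M N m n) l) = g (dot (RT M N) L (dot M N m n) l)"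
    and t: "t \<in> carrier (RM (RT M N) L)"
  shows "f t = g t"
proof (rule rtensor_ext[OF _ assms(3,4) f g _ t])
  fix s l assume s: "s \<in> carrier (RM M N)" and l: "l \<in> carrier (und L)"
  have L: "(\<lambda>s. h (dot (RT M N) L s l)) \<in> Lin (RM M N) P" if "h \<in> Lin (RM (RT M N) L) P" for h
    using l assms(1-4) by (intro lin_comp[OF that] lin_dot1 lin_id) auto
  show "f (dot (RT M N) L s l) = g (dot (RT M N) L s l)"
    by (rule rtensor_ext[OF assms(1,2,4) L[OF f] L[OF g] e s]) (use l in auto)
qed (use assms in auto)

lemma rtensor_ext_right:
  assumes "comod M" "comod N" "comod L" "kmod P"
    and f: "f \<in> Lin (RM M (RT N L)) P" and g: "g \<in> Lin (RM M (RT N L)) P"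
    and e: "\<And>m n l. m \<in> carrier (und M) \<Longrightarrow> n \<in> carrier (und N) \<Longrightarrow> l \<in> carrier (und L)
      \<Longrightarrow> f (dot M (RT N L) m (dot N L n l)) = g (dot M (RT N L) m (dot N L n l))"
    and t: "t \<in> carrier (RM M (RT N L))"
  shows "f t = g t"
proof (rule rtensor_ext[OF assms(1) _ assms(4) f g _ t])
  fix m s assume s: "s \<in> carrier (RM N L)" and m: "m \<in> carrier (und M)"
  have L: "(\<lambda>s. h (dot M (RT N L) m s)) \<in> Lin (RM N L) P" if "h \<in> Lin (RM M (RT N L)) P" for h
    using m assms(1-4) by (intro lin_comp[OF that] lin_dot2 lin_id) auto
  show "f (dot M (RT N L) m s) = g (dot M (RT N L) m s)"
    by (rule rtensor_ext[OF assms(2,3,4) L[OF f] L[OF g] e s]) (use m in auto)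
qed (use assms in auto)

lemma rtensor_ext_left4:
  assumes "comod M" "comod N" "comod L" "comod L'" "kmod P"
    and f: "f \<in> Lin (RM (RT (RT M N) L) L') P" and g: "g \<in> Lin (RM (RT (RT M N) L) L') P"
    and e: "\<And>m n l l'. m \<in> carrier (und M) \<Longrightarrow> n \<in> carrier (und N) \<Longrightarrow> l \<in> carrier (und L) \<Longrightarrow> l' \<in> carrier (und L')
      \<Longrightarrow> f (dot (RT (RT M N) L) L' (dot (RT M N) L (dot M N m n) l) l')
        = g (dot (RT (RT M N) L) L' (dot (RT M N) L (dot M N m n) l) l')"
    and t: "t \<in> carrier (RM (RT (RT M N) L) L')"
  shows "f t = g t"
proof (rule rtensor_ext[OF _ assms(4,5) f g _ t])
  fix s l assume s: "s \<in> carrier (RM (RT M N) L)" and l: "l \<in> carrier (und L')"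
  have L: "(\<lambda>s. h (dot (RT (RT M N) L) L' s l)) \<in> Lin (RM (RT M N) L) P" if "h \<in> Lin (RM (RT (RT M N) L) L') P" for h
    using l assms(1-5) by (intro lin_comp[OF that] lin_dot1 lin_id) auto
  show "f (dot (RT (RT M N) L) L' s l) = g (dot (RT (RT M N) L) L' s l)"
    by (rule rtensor_ext_left[OF assms(1-3,5) L[OF f] L[OF g] e s]) (use l in auto)
qed (use assms in auto)

lemma comodule_maps_dotI:
  assumes "comod M" "comod N" "comod B" and f: "f \<in> Lin (RM M N) (und B)"
    and c: "\<And>m n. m \<in> carrier (und M) \<Longrightarrow> n \<in> carrier (und N) \<Longrightarrow>
      csw B (und B \<boxtimes> H) (tens k (und B) H) (f (dot M N m n)) =
      csw M (und B \<boxtimes> H) (\<lambda>m0 m1. csw N (und B \<boxtimes> H) (\<lambda>n0 n1. tens k (und B) H (f (dot M N m0 n0)) (m1 ** n1)) n) m"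
  shows "f \<in> CM (RT M N) B"
proof (rule comodule_mapsI[OF _ assms(3) f])
  have b: "bilin (RM M N) H (und B \<boxtimes> H) (\<lambda>a b. tens k (und B) H (f a) b)"
    using assms(1-3) linear_mapsD(1)[OF f] by (auto intro!: lin f)
  show "csw B (und B \<boxtimes> H) (tens k (und B) H) (f t) = csw (RT M N) (und B \<boxtimes> H) (\<lambda>a b. tens k (und B) H (f a) b) t"
    if "t \<in> carrier (RM M N)" for t
  proof (rule rtensor_ext[OF assms(1,2) _ _ _ _ that])
    show "(\<lambda>t. csw B (und B \<boxtimes> H) (tens k (und B) H) (f t)) \<in> Lin (RM M N) (und B \<boxtimes> H)"
      using assms(1-3) by (intro lin_sw1 bilin_tens f) auto
    show "(\<lambda>t. csw (RT M N) (und B \<boxtimes> H) (\<lambda>a b. tens k (und B) H (f a) b) t) \<in> Lin (RM M N) (und B \<boxtimes> H)"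
      using assms(1-3) by (intro lin_sw1 b lin_id) auto
  qed (use assms(1-3) c in \<open>auto simp: sw_dot[OF _ _ _ b]\<close>)
qed (use assms in auto)

lemma comodule_maps_dot3I:
  assumes "comod M" "comod N" "comod L" "comod B" and f: "f \<in> Lin (RM (RT M N) L) (und B)"
    and c: "\<And>m n l. m \<in> carrier (und M) \<Longrightarrow> n \<in> carrier (und N) \<Longrightarrow> l \<in> carrier (und L) \<Longrightarrow>
      csw B (und B \<boxtimes> H) (tens k (und B) H) (f (dot (RT M N) L (dot M N m n) l)) =
      csw M (und B \<boxtimes> H) (\<lambda>m0 m1. csw N (und B \<boxtimes> H) (\<lambda>n0 n1. csw L (und B \<boxtimes> H) (\<lambda>l0 l1.
        tens k (und B) H (f (dot (RT M N) L (dot M N m0 n0) l0)) (m1 ** n1 ** l1)) l) n) m"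
  shows "f \<in> CM (RT (RT M N) L) B"
proof (rule comodule_maps_dotI[OF _ assms(3,4) f])
  note [simp] = assms(1-4) linear_mapsD(1)[OF f]
  let ?T = "und B \<boxtimes> H" and ?d = "dot (RT M N) L"
  fix t l assume t: "t \<in> carrier (RM M N)" and l [simp]: "l \<in> carrier (und L)"
  have b: "bilin (RM M N) H ?T (\<lambda>t0 t1. csw L ?T (\<lambda>l0 l1. tens k (und B) H (f (?d t0 l0)) (t1 ** l1)) l)"
    by (auto intro!: lin lin_comp[OF f])
  show "csw B ?T (tens k (und B) H) (f (?d t l)) =
    csw (RT M N) ?T (\<lambda>t0 t1. csw L ?T (\<lambda>l0 l1. tens k (und B) H (f (?d t0 l0)) (t1 ** l1)) l) t"
  proof (rule rtensor_ext[OF assms(1,2) _ _ _ _ t])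
    show "(\<lambda>t. csw B ?T (tens k (und B) H) (f (?d t l))) \<in> Lin (RM M N) ?T"
      by (intro lin_sw1 bilin_tens lin_comp[OF f] lin_dot1 lin_id) auto
    show "(\<lambda>t. csw (RT M N) ?T (\<lambda>t0 t1. csw L ?T (\<lambda>l0 l1. tens k (und B) H (f (?d t0 l0)) (t1 ** l1)) l) t)
        \<in> Lin (RM M N) ?T"
      by (intro lin_sw1 b lin_id) auto
  qed (auto simp: c sw_dot[OF _ _ _ b])
qed (use assms in auto)

text \<open>Comodule maps commute with the coactions occurring in \<open>dot\<close>.\<close>

lemma tmap_dot:
  assumes M: "comod M" "comod M'" and N: "comod N" "comod N'" and f: "f \<in> CM M M'" and g: "g \<in> CM N N'"
    and m: "m \<in> carrier (und M)" and n: "n \<in> carrier (und N)"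
  shows "tmap k (und M') (und N') f g (dot M N m n) = dot M' N' (f m) (g n)"
proof -
  let ?T = "und M' \<boxtimes> und N'" and ?t = "tens k (und M') (und N')"
  note lf = comodule_mapsD(1)[OF f] and lg = comodule_mapsD(1)[OF g]
  note [simp] = M N m n linear_mapsD(1)[OF lf] linear_mapsD(1)[OF lg]
  have "tmap k (und M') (und N') f g (dot M N m n)
    = csw M ?T (\<lambda>m0 m1. csw N ?T (\<lambda>n0 n1. \<epsilon> (m1 ** n1) \<odot>\<^bsub>?T\<^esub> tmap k (und M') (und N') f g (tens k (und M) (und N) m0 n0)) n) m"
    by (rule lin_dot_expand) (auto intro!: tmap_lin lf lg)
  also have "\<dots> = csw M ?T (\<lambda>m0 m1. csw N ?T (\<lambda>n0 n1. \<epsilon> (m1 ** n1) \<odot>\<^bsub>?T\<^esub> ?t (f m0) (g n0)) n) m"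
    by (intro sw_cong) (auto simp: tmap_tens lf lg)
  also have "\<dots> = csw M ?T (\<lambda>m0 m1. csw N' ?T (\<lambda>n0 n1. \<epsilon> (m1 ** n1) \<odot>\<^bsub>?T\<^esub> ?t (f m0) n0) (g n)) m"
    by (intro sw_cong comodule_mapsD(2)[OF g, symmetric]) (auto intro!: lin)
  also have "\<dots> = csw M' ?T (\<lambda>m0 m1. csw N' ?T (\<lambda>n0 n1. \<epsilon> (m1 ** n1) \<odot>\<^bsub>?T\<^esub> ?t m0 n0) (g n)) (f m)"
    by (intro comodule_mapsD(2)[OF f, symmetric]) (auto intro!: lin)
  also have "\<dots> = dot M' N' (f m) (g n)"
    by (rule dot_eq[symmetric]) auto
  finally show ?thesis .
qed

lemma tmap_comodule_map:
  assumes M: "comod M" "comod M'" and N: "comod N" "comod N'" and f: "f \<in> CM M M'" and g: "g \<in> CM N N'"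
  shows "tmap k (und M') (und N') f g \<in> CM (RT M N) (RT M' N')"
proof (rule comodule_maps_dotI)
  note lf = comodule_mapsD(1)[OF f] and lg = comodule_mapsD(1)[OF g]
  note [simp] = M N linear_mapsD(1)[OF lf] linear_mapsD(1)[OF lg]
  show "tmap k (und M') (und N') f g \<in> Lin (RM M N) (RM M' N')"
    by (rule rtensor_map_closed) (auto intro!: rpi_closed(5) tmap_lin lf lg simp: tmap_dot[OF M N f g])
  fix m n assume [simp]: "m \<in> carrier (und M)" "n \<in> carrier (und N)"
  let ?R = "RM M' N'"
  let ?T = "?R \<boxtimes> H"
  let ?\<phi> = "\<lambda>m0 m1 n0 n1. tens k ?R H (dot M' N' m0 n0) (m1 ** n1)"
  have "csw (RT M' N') ?T (tens k ?R H) (dot M' N' (f m) (g n)) = csw M' ?T (\<lambda>m0 m1. csw N' ?T (?\<phi> m0 m1) (g n)) (f m)"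
    by (rule sw_dot) (auto intro!: bilin_tens)
  also have "\<dots> = csw M ?T (\<lambda>m0 m1. csw N' ?T (?\<phi> (f m0) m1) (g n)) m"
    by (rule comodule_mapsD(2)[OF f]) (auto intro!: lin)
  also have "\<dots> = csw M ?T (\<lambda>m0 m1. csw N ?T (\<lambda>n0 n1. ?\<phi> (f m0) m1 (g n0) n1) n) m"
    by (intro sw_cong comodule_mapsD(2)[OF g]) (auto intro!: lin)
  also have "\<dots> = csw M ?T (\<lambda>m0 m1. csw N ?T (\<lambda>n0 n1. tens k ?R H (tmap k (und M') (und N') f g (dot M N m0 n0)) (m1 ** n1)) n) m"
    by (intro sw_cong) (auto simp: tmap_dot[OF M N f g])
  finally show "csw (RT M' N') ?T (tens k ?R H) (tmap k (und M') (und N') f g (dot M N m n)) =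
     csw M ?T (\<lambda>m0 m1. csw N ?T (\<lambda>n0 n1. tens k ?R H (tmap k (und M') (und N') f g (dot M N m0 n0)) (m1 ** n1)) n) m"
    by (simp add: tmap_dot[OF M N f g, of m n])
qed (use M N in auto)

definition rassoc_inv where
  "rassoc_inv M N P = (let T = RM M N \<boxtimes> und P in
     tlift T (\<lambda>m s. tlift T (\<lambda>n p. tens k (RM M N) (und P) (dot M N m n) p) s))"

lemma rassoc_eq:
  "rassoc k H M N P = (let T = und M \<boxtimes> RM N P in
     tlift T (\<lambda>s p. tlift T (\<lambda>m n. tens k (und M) (RM N P) m (dot N P n p)) s))"
  by (simp add: rassoc_def dot_def Let_def)

context
  fixes M N P :: "'u comod"
  assumes MNP [simp]: "comod M" "comod N" "comod P"
begin

lemma rassoc_bilin: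
  "bilin (und M \<boxtimes> und N) (und P) (und M \<boxtimes> RM N P)
     (\<lambda>s p. tlift (und M \<boxtimes> RM N P) (\<lambda>m n. tens k (und M) (RM N P) m (dot N P n p)) s)"
  "bilin (und M) (und N \<boxtimes> und P) (RM M N \<boxtimes> und P)
     (\<lambda>m s. tlift (RM M N \<boxtimes> und P) (\<lambda>n p. tens k (RM M N) (und P) (dot M N m n) p) s)"
  by (intro bilinI lin_tlift lin_tlift_param[of "und M" "und N"] lin_tlift_param[of "und N" "und P"] lin; simp)+

lemma rassoc_bilin':
  "bilin (RM M N) (und P) (und M \<boxtimes> RM N P)
     (\<lambda>s p. tlift (und M \<boxtimes> RM N P) (\<lambda>m n. tens k (und M) (RM N P) m (dot N P n p)) s)"
  "bilin (und M) (RM N P) (RM M N \<boxtimes> und P)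
     (\<lambda>m s. tlift (RM M N \<boxtimes> und P) (\<lambda>n p. tens k (RM M N) (und P) (dot M N m n) p) s)"
  using rassoc_bilin
  by (simp_all add: bilin_def rpi_closed(3,5)[OF MNP(1,2)] rpi_closed(3,5)[OF MNP(2,3)])

lemma rassoc_lin0:
  "rassoc k H M N P \<in> Lin (RM M N \<boxtimes> und P) (und M \<boxtimes> RM N P)"
  "rassoc_inv M N P \<in> Lin (und M \<boxtimes> RM N P) (RM M N \<boxtimes> und P)"
  unfolding rassoc_eq rassoc_inv_def Let_def by (intro lin_tlift rassoc_bilin'; simp)+

lemma rassoc_tens:
  "t \<in> carrier (RM M N) \<Longrightarrow> p \<in> carrier (und P) \<Longrightarrow> rassoc k H M N P (tens k (RM M N) (und P) t p)
    = tlift (und M \<boxtimes> RM N P) (\<lambda>m n. tens k (und M) (RM N P) m (dot N P n p)) t"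
  "m \<in> carrier (und M) \<Longrightarrow> s \<in> carrier (RM N P) \<Longrightarrow> rassoc_inv M N P (tens k (und M) (RM N P) m s)
    = tlift (RM M N \<boxtimes> und P) (\<lambda>n p. tens k (RM M N) (und P) (dot M N m n) p) s"
  unfolding rassoc_eq rassoc_inv_def Let_def
  using tlift_tens[OF _ _ _ rassoc_bilin'(1), of t p] tlift_tens[OF _ _ _ rassoc_bilin'(2), of m s] by auto

text \<open>
  Both sides are \<open>\<epsilon>(m\<^sub>1n\<^sub>1p\<^sub>1) m\<^sub>0 \<otimes> dot n\<^sub>0 p\<^sub>0\<close>.
\<close>

lemma rassoc_dot:
  assumes [simp]: "m \<in> carrier (und M)" "n \<in> carrier (und N)" "p \<in> carrier (und P)"
  shows "rassoc k H M N P (dot (RT M N) P (dot M N m n) p) = dot M (RT N P) m (dot N P n p)"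
proof -
  let ?T = "und M \<boxtimes> RM N P"
  let ?G = "\<lambda>p t. tlift ?T (\<lambda>m n. tens k (und M) (RM N P) m (dot N P n p)) t"
  note b = rassoc_bilin(1)
  have l1: "(\<lambda>x. ?G p (f x)) \<in> Lin A ?T" if "p \<in> carrier (und P)" "f \<in> Lin A (und M \<boxtimes> und N)" for p f and A :: "('u, 'u, 'z) module_scheme"
    using that by (intro lin_comp[OF bilinD(1)[OF b]])
  have l2: "(\<lambda>x. ?G (f x) t) \<in> Lin A ?T" if "t \<in> carrier (und M \<boxtimes> und N)" "f \<in> Lin A (und P)" for t f and A :: "('u, 'u, 'z) module_scheme"
    using that by (intro lin_comp[OF bilinD(2)[OF b]])
  have l3: "?G p t \<in> carrier ?T" if "p \<in> carrier (und P)" "t \<in> carrier (und M \<boxtimes> und N)" for p t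
    using that by (rule bilin_closed[OF b, rotated])
  have t: "t \<in> carrier (und M \<boxtimes> und N)" if "t \<in> carrier (RM M N)" for t
    using that by (intro rpi_closed(3)) auto
  have e: "?G p (tens k (und M) (und N) m n) = tens k (und M) (RM N P) m (dot N P n p)"
    if "m \<in> carrier (und M)" "n \<in> carrier (und N)" "p \<in> carrier (und P)" for m n p
    using that by (intro tlift_tens lin) auto
  have "rassoc k H M N P (dot (RT M N) P (dot M N m n) p) = csw (RT M N) ?T (\<lambda>x0 x1. csw P ?T (\<lambda>p0 p1.
      \<epsilon> (x1 ** p1) \<odot>\<^bsub>?T\<^esub> rassoc k H M N P (tens k (RM M N) (und P) x0 p0)) p) (dot M N m n)"
    by (rule lin_dot_expand) (auto intro!: rassoc_lin0)
  also have "\<dots> = csw (RT M N) ?T (\<lambda>x0 x1. csw P ?T (\<lambda>p0 p1. \<epsilon> (x1 ** p1) \<odot>\<^bsub>?T\<^esub> ?G p0 x0) p) (dot M N m n)"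
    by (intro sw_cong) (auto simp: rassoc_tens)
  also have "\<dots> = csw M ?T (\<lambda>m0 m1. csw N ?T (\<lambda>n0 n1. csw P ?T (\<lambda>p0 p1.
      \<epsilon> ((m1 ** n1) ** p1) \<odot>\<^bsub>?T\<^esub> ?G p0 (tens k (und M) (und N) m0 n0)) p) n) m"
    by (rule sw_dot_tensor) (auto intro!: lin l1 l2 l3 simp: t)
  also have "\<dots> = csw M ?T (\<lambda>m0 m1. csw N ?T (\<lambda>n0 n1. csw P ?T (\<lambda>p0 p1.
      \<epsilon> (m1 ** (n1 ** p1)) \<odot>\<^bsub>?T\<^esub> tens k (und M) (RM N P) m0 (dot N P n0 p0)) p) n) m"
    by (intro sw_cong) (auto simp: m_assoc e)
  also have "\<dots> = csw M ?T (\<lambda>m0 m1. csw (RT N P) ?T (\<lambda>y0 y1. \<epsilon> (m1 ** y1) \<odot>\<^bsub>?T\<^esub> tens k (und M) (RM N P) m0 y0) (dot N P n p)) m"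
    by (intro sw_cong sw_dot[symmetric]) (auto intro!: lin)
  also have "\<dots> = dot M (RT N P) m (dot N P n p)"
    by (rule dot_eq[symmetric]) auto
  finally show ?thesis .
qed

lemma rassoc_inv_dot:
  assumes [simp]: "m \<in> carrier (und M)" "n \<in> carrier (und N)" "p \<in> carrier (und P)"
  shows "rassoc_inv M N P (dot M (RT N P) m (dot N P n p)) = dot (RT M N) P (dot M N m n) p"
proof -
  let ?T = "RM M N \<boxtimes> und P"
  let ?G = "\<lambda>m t. tlift ?T (\<lambda>n p. tens k (RM M N) (und P) (dot M N m n) p) t"
  note b = rassoc_bilin(2)
  have l1: "(\<lambda>x. ?G (f x) t) \<in> Lin A ?T" if "t \<in> carrier (und N \<boxtimes> und P)" "f \<in> Lin A (und M)" for t f and A :: "('u, 'u, 'z) module_scheme"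
    using that by (intro lin_comp[OF bilinD(1)[OF b]])
  have l2: "(\<lambda>x. ?G m (f x)) \<in> Lin A ?T" if "m \<in> carrier (und M)" "f \<in> Lin A (und N \<boxtimes> und P)" for m f and A :: "('u, 'u, 'z) module_scheme"
    using that by (intro lin_comp[OF bilinD(2)[OF b]])
  have l3: "?G m t \<in> carrier ?T" if "m \<in> carrier (und M)" "t \<in> carrier (und N \<boxtimes> und P)" for m t
    using that by (rule bilin_closed[OF b])
  have t: "t \<in> carrier (und N \<boxtimes> und P)" if "t \<in> carrier (RM N P)" for t
    using that by (intro rpi_closed(3)) auto
  have e: "?G m (tens k (und N) (und P) n p) = tens k (RM M N) (und P) (dot M N m n) p"
    if "m \<in> carrier (und M)" "n \<in> carrier (und N)" "p \<in> carrier (und P)" for m n p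
    using that by (intro tlift_tens lin) auto
  have "rassoc_inv M N P (dot M (RT N P) m (dot N P n p)) = csw M ?T (\<lambda>m0 m1. csw (RT N P) ?T (\<lambda>y0 y1.
      \<epsilon> (m1 ** y1) \<odot>\<^bsub>?T\<^esub> rassoc_inv M N P (tens k (und M) (RM N P) m0 y0)) (dot N P n p)) m"
    by (rule lin_dot_expand) (auto intro!: rassoc_lin0)
  also have "\<dots> = csw M ?T (\<lambda>m0 m1. csw (RT N P) ?T (\<lambda>y0 y1. \<epsilon> (m1 ** y1) \<odot>\<^bsub>?T\<^esub> ?G m0 y0) (dot N P n p)) m"
    by (intro sw_cong) (auto simp: rassoc_tens)
  also have "\<dots> = csw M ?T (\<lambda>m0 m1. csw N ?T (\<lambda>n0 n1. csw P ?T (\<lambda>p0 p1.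
      \<epsilon> (m1 ** (n1 ** p1)) \<odot>\<^bsub>?T\<^esub> ?G m0 (tens k (und N) (und P) n0 p0)) p) n) m"
    by (intro sw_cong sw_dot_tensor) (auto intro!: lin l1 l2 l3 simp: t)
  also have "\<dots> = csw M ?T (\<lambda>m0 m1. csw N ?T (\<lambda>n0 n1. csw P ?T (\<lambda>p0 p1.
      \<epsilon> ((m1 ** n1) ** p1) \<odot>\<^bsub>?T\<^esub> tens k (RM M N) (und P) (dot M N m0 n0) p0) p) n) m"
    by (intro sw_cong) (auto simp: m_assoc e)
  also have "\<dots> = csw (RT M N) ?T (\<lambda>x0 x1. csw P ?T (\<lambda>p0 p1. \<epsilon> (x1 ** p1) \<odot>\<^bsub>?T\<^esub> tens k (RM M N) (und P) x0 p0) p) (dot M N m n)"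
    by (rule sw_dot[symmetric]) (auto intro!: lin)
  also have "\<dots> = dot (RT M N) P (dot M N m n) p"
    by (rule dot_eq[symmetric]) auto
  finally show ?thesis .
qed

lemma rassoc_lin:
  "rassoc k H M N P \<in> Lin (RM (RT M N) P) (RM M (RT N P))"
  "rassoc_inv M N P \<in> Lin (RM M (RT N P)) (RM (RT M N) P)"
proof -
  have 1: "rassoc k H M N P \<in> Lin (RM (RT M N) P) (und M \<boxtimes> RM N P)"
    and 2: "rassoc_inv M N P \<in> Lin (RM M (RT N P)) (RM M N \<boxtimes> und P)"
    by (rule rpi_closed(5); simp add: rassoc_lin0)+
  show "rassoc k H M N P \<in> Lin (RM (RT M N) P) (RM M (RT N P))"
  proof (rule lin_into_rtensor[OF _ _ _ 1])
    show "rpi k H M (RT N P) (rassoc k H M N P t) = rassoc k H M N P t" if "t \<in> carrier (RM (RT M N) P)" for t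
      by (rule rtensor_ext_left[OF _ _ _ _ lin_comp[OF rpi_lin 1] 1 _ that]) (auto simp: rassoc_dot rpi_closed(2))
  qed auto
  show "rassoc_inv M N P \<in> Lin (RM M (RT N P)) (RM (RT M N) P)"
  proof (rule lin_into_rtensor[OF _ _ _ 2])
    show "rpi k H (RT M N) P (rassoc_inv M N P t) = rassoc_inv M N P t" if "t \<in> carrier (RM M (RT N P))" for t
      by (rule rtensor_ext_right[OF _ _ _ _ lin_comp[OF rpi_lin 2] 2 _ that]) (auto simp: rassoc_inv_dot rpi_closed(2))
  qed auto
qed

lemma rassoc_inverse:
  "t \<in> carrier (RM (RT M N) P) \<Longrightarrow> rassoc_inv M N P (rassoc k H M N P t) = t"
  "u \<in> carrier (RM M (RT N P)) \<Longrightarrow> rassoc k H M N P (rassoc_inv M N P u) = u"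
  by (rule rtensor_ext_left[OF MNP _ lin_comp[OF rassoc_lin(2,1)] lin_id]
      rtensor_ext_right[OF MNP _ lin_comp[OF rassoc_lin(1,2)] lin_id]; simp add: rassoc_dot rassoc_inv_dot)+

lemma rassoc_comodule_map: "rassoc k H M N P \<in> CM (RT (RT M N) P) (RT M (RT N P))"
proof (rule comodule_maps_dot3I)
  let ?R = "RM M (RT N P)"
  let ?T = "?R \<boxtimes> H" and ?d = "\<lambda>m n p. dot M (RT N P) m (dot N P n p)"
  fix m n p assume [simp]: "m \<in> carrier (und M)" "n \<in> carrier (und N)" "p \<in> carrier (und P)"
  have "csw (RT M (RT N P)) ?T (tens k ?R H) (?d m n p)
    = csw M ?T (\<lambda>m0 m1. csw (RT N P) ?T (\<lambda>y0 y1. tens k ?R H (dot M (RT N P) m0 y0) (m1 ** y1)) (dot N P n p)) m"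
    by (rule sw_dot) (auto intro!: bilin_tens)
  also have "\<dots> = csw M ?T (\<lambda>m0 m1. csw N ?T (\<lambda>n0 n1. csw P ?T (\<lambda>p0 p1. tens k ?R H (?d m0 n0 p0) (m1 ** (n1 ** p1))) p) n) m"
    by (intro sw_cong sw_dot) (auto intro!: lin)
  also have "\<dots> = csw M ?T (\<lambda>m0 m1. csw N ?T (\<lambda>n0 n1. csw P ?T (\<lambda>p0 p1.
      tens k ?R H (rassoc k H M N P (dot (RT M N) P (dot M N m0 n0) p0)) (m1 ** n1 ** p1)) p) n) m"
    by (intro sw_cong) (auto simp: m_assoc rassoc_dot)
  finally show "csw (RT M (RT N P)) ?T (tens k ?R H) (rassoc k H M N P (dot (RT M N) P (dot M N m n) p))
    = csw M ?T (\<lambda>m0 m1. csw N ?T (\<lambda>n0 n1. csw P ?T (\<lambda>p0 p1.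
      tens k ?R H (rassoc k H M N P (dot (RT M N) P (dot M N m0 n0) p0)) (m1 ** n1 ** p1)) p) n) m"
    by (simp add: rassoc_dot)
qed (auto intro!: rassoc_lin)

end

end

context comonoidal
begin

lemma runit_comodule_map:
  assumes M: "comod M"
  shows "runit_l M \<in> CM (RT S M) M" "runit_r M \<in> CM (RT M S) M"
proof -
  note [simp] = M
  have "(\<lambda>m. dot S M \<eta> m) \<in> CM M (RT S M)"
    by (rule comodule_mapsI) (auto intro!: lin sw_dot_one bilin_tens)
  then show "runit_l M \<in> CM (RT S M) M"
    by (rule comodule_maps_inverse[rotated 2]) (auto simp: runit_inverse)
  have "(\<lambda>m. dot M S m \<eta>) \<in> CM M (RT M S)"
    by (rule comodule_mapsI) (auto intro!: lin sw_dot_one bilin_tens)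
  then show "runit_r M \<in> CM (RT M S) M"
    by (rule comodule_maps_inverse[rotated 2]) (auto simp: runit_inverse)
qed

end

section \<open>Comodules form a monoidal category\<close>

context prebialg
begin

abbreviation "\<C> \<equiv> comod_cat k H"

definition carr where
  "carr M f N = Arrow M (restrict f (carrier (und M))) N"

lemma carr_simps [simp]:
  "src (carr M f N) = M" "tgt (carr M f N) = N" "fn (carr M f N) = restrict f (carrier (und M))"
  by (simp_all add: carr_def)

lemma carr_eqI: "(\<And>x. x \<in> carrier (und M) \<Longrightarrow> f x = g x) \<Longrightarrow> carr M f N = carr M g N"
  by (auto simp: carr_def restrict_def)

lemma comodule_maps_cong:
  assumes f: "f \<in> CM M N" and M: "comod M" and N: "comod N" and e: "\<And>x. x \<in> carrier (und M) \<Longrightarrow> f x = g x"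
  shows "g \<in> CM M N"
proof (rule comodule_mapsI[OF M N])
  note lf = comodule_mapsD(1)[OF f]
  show lg: "g \<in> Lin (und M) (und N)" by (rule linear_maps_cong[OF lf]) (use M e in auto)
  fix m assume m: "m \<in> carrier (und M)"
  have b: "bilin (und N) H (und N \<boxtimes> H) (tens k (und N) H)" using N by (intro bilin_tens) auto
  show "csw N (und N \<boxtimes> H) (tens k (und N) H) (g m) = csw M (und N \<boxtimes> H) (\<lambda>m0 m1. tens k (und N) H (g m0) m1) m"
    unfolding e[OF m, symmetric] comodule_mapsD(2)[OF f M N kmod_tensor[OF comodule_simps(1)[OF N] kmod_H] b m]
    using M m by (intro sw_cong) (auto simp: e)
qed

lemma carr_Hom [simp]:
  assumes "comod M" "comod N" "f \<in> CM M N"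
  shows "carr M f N \<in> Hom \<C> M N"
proof -
  have "restrict f (carrier (und M)) \<in> CM M N"
    by (rule comodule_maps_cong[OF assms(3,1,2)]) simp
  then show ?thesis using assms by (auto simp: Hom_def comod_cat_def carr_def)
qed

lemma comod_HomE:
  assumes "\<phi> \<in> Hom \<C> M N"
  obtains f where "f \<in> CM M N" "\<phi> = carr M f N" "comod M" "comod N"
proof -
  from assms obtain f where f: "\<phi> = Arrow M f N" "comod M" "comod N" "f \<in> CM M N" "f \<in> extensional (carrier (und M))"
    by (auto simp: Hom_def comod_cat_def)
  then have "\<phi> = carr M f N" by (simp add: carr_def extensional_restrict)
  with f show ?thesis using that by blast
qed

lemma carr_comp [simp]:
  assumes "f \<in> CM M N"
  shows "carr N g P \<cdot>\<^bsub>\<C>\<^esub> carr M f N = carr M (\<lambda>x. g (f x)) P"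
  using linear_mapsD(1)[OF comodule_mapsD(1)[OF assms]]
  by (auto simp: comod_cat_def carr_def compose_def restrict_def)

lemma comod_cat_Ob [simp]: "M \<in> Ob \<C> \<longleftrightarrow> comod M"
  by (simp add: comod_cat_def)

lemma comod_cat_simps [simp]:
  "TensO \<C> M N = RT M N" "Ident \<C> M = carr M (\<lambda>x. x) M"
  "Assoc \<C> M N P = carr (RT (RT M N) P) (rassoc k H M N P) (RT M (RT N P))"
  by (simp_all add: comod_cat_def carr_def id_def)

lemma carr_tens [simp]:
  assumes "comod M" "comod N"
  shows "carr M f M' \<star>\<^bsub>\<C>\<^esub> carr N g N' = carr (RT M N) (tmap k (und M') (und N') f g) (RT M' N')"
  using assms rpi_closed(3)[OF assms]
  by (simp add: comod_cat_def) (auto simp: carr_def intro!: restrict_ext tmap_cong[of "und M" "und N"])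

lemma carr_inverse:
  assumes "comod M" "comod N" "f \<in> CM M N" "g \<in> CM N M"
    "\<And>x. x \<in> carrier (und M) \<Longrightarrow> g (f x) = x" "\<And>y. y \<in> carrier (und N) \<Longrightarrow> f (g y) = y"
  shows "inverse_arrows \<C> (carr M f N) (carr N g M)"
  using carr_Hom[OF assms(1-3)] carr_Hom[OF assms(2,1,4)] assms(3-6)
  by (auto simp: inverse_arrows_def Hom_def intro: carr_eqI)

lemma carr_Iso:
  assumes "comod M" "comod N" "f \<in> CM M N" "g \<in> Lin (und N) (und M)"
    "\<And>x. x \<in> carrier (und M) \<Longrightarrow> g (f x) = x" "\<And>y. y \<in> carrier (und N) \<Longrightarrow> f (g y) = y"
  shows "carr M f N \<in> Iso \<C> M N"
  using carr_inverse[OF assms(1-3) comodule_maps_inverse[OF assms] assms(5,6)] carr_Hom[OF assms(1-3)]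
  by (auto simp: Iso_def)

lemma category_comod_cat: "category \<C>"
proof
  show "Dom \<C> f \<in> Ob \<C>" "Cod \<C> f \<in> Ob \<C>" if "f \<in> Arr \<C>" for f
    using that by (auto simp: comod_cat_def)
  show "Ident \<C> A \<in> Hom \<C> A A" if "A \<in> Ob \<C>" for A
    using that by (auto simp: comodule_maps_id)
  fix \<phi> \<chi> \<omega> W X Y Z
  assume "\<phi> \<in> Hom \<C> X Y"
  then obtain f where f: "f \<in> CM X Y" "\<phi> = carr X f Y" "comod X" "comod Y" by (rule comod_HomE)
  then show "\<phi> \<cdot>\<^bsub>\<C>\<^esub> Ident \<C> X = \<phi>" "Ident \<C> Y \<cdot>\<^bsub>\<C>\<^esub> \<phi> = \<phi>"
    by (auto simp: comodule_maps_id)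
  assume "\<chi> \<in> Hom \<C> Y Z"
  then obtain g where g: "g \<in> CM Y Z" "\<chi> = carr Y g Z" "comod Z" by (rule comod_HomE)
  have gf: "(\<lambda>x. g (f x)) \<in> CM X Z" by (rule comodule_maps_comp[OF f(3,4) g(3) f(1) g(1)])
  then show "\<chi> \<cdot>\<^bsub>\<C>\<^esub> \<phi> \<in> Hom \<C> X Z" using f g by simp
  assume "\<omega> \<in> Hom \<C> W X"
  then obtain h where h: "h \<in> CM W X" "\<omega> = carr W h X" "comod W" by (rule comod_HomE)
  have "(\<lambda>x. f (h x)) \<in> CM W Y" by (rule comodule_maps_comp[OF h(3) f(3,4) h(1) f(1)])
  then show "(\<chi> \<cdot>\<^bsub>\<C>\<^esub> \<phi>) \<cdot>\<^bsub>\<C>\<^esub> \<omega> = \<chi> \<cdot>\<^bsub>\<C>\<^esub> \<phi> \<cdot>\<^bsub>\<C>\<^esub> \<omega>"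
    using f g h gf by simp
qed

lemma carr_ext:
  assumes "comod M" "comod N" "kmod (und B)" "f \<in> Lin (RM M N) (und B)" "g \<in> Lin (RM M N) (und B)"
    and "\<And>m n. m \<in> carrier (und M) \<Longrightarrow> n \<in> carrier (und N) \<Longrightarrow> f (dot M N m n) = g (dot M N m n)"
  shows "carr (RT M N) f B = carr (RT M N) g B"
  using assms by (intro carr_eqI) (rule rtensor_ext)

lemma carr_ext_left:
  assumes "comod M" "comod N" "comod L" "kmod (und B)"
    and "f \<in> Lin (RM (RT M N) L) (und B)" "g \<in> Lin (RM (RT M N) L) (und B)"
    and "\<And>m n l. m \<in> carrier (und M) \<Longrightarrow> n \<in> carrier (und N) \<Longrightarrow> l \<in> carrier (und L)
      \<Longrightarrow> f (dot (RT M N) L (dot M N m n) l) = g (dot (RT M N) L (dot M N m n) l)"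
  shows "carr (RT (RT M N) L) f B = carr (RT (RT M N) L) g B"
  using assms by (intro carr_eqI) (rule rtensor_ext_left)

lemma carr_ext_left4:
  assumes "comod M" "comod N" "comod L" "comod L'" "kmod (und B)"
    and "f \<in> Lin (RM (RT (RT M N) L) L') (und B)" "g \<in> Lin (RM (RT (RT M N) L) L') (und B)"
    and "\<And>m n l l'. m \<in> carrier (und M) \<Longrightarrow> n \<in> carrier (und N) \<Longrightarrow> l \<in> carrier (und L) \<Longrightarrow> l' \<in> carrier (und L')
      \<Longrightarrow> f (dot (RT (RT M N) L) L' (dot (RT M N) L (dot M N m n) l) l')
        = g (dot (RT (RT M N) L) L' (dot (RT M N) L (dot M N m n) l) l')"
  shows "carr (RT (RT (RT M N) L) L') f B = carr (RT (RT (RT M N) L) L') g B"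
  using assms by (intro carr_eqI) (rule rtensor_ext_left4)

lemma tmap_comodule_map_lin [simp]:
  "comod M \<Longrightarrow> comod M' \<Longrightarrow> comod N \<Longrightarrow> comod N' \<Longrightarrow> f \<in> CM M M' \<Longrightarrow> g \<in> CM N N'
    \<Longrightarrow> tmap k (und M') (und N') f g \<in> Lin (RM M N) (RM M' N')"
  by (rule comodule_mapsD(1)[OF tmap_comodule_map])

lemma comodule_map_closed: "f \<in> CM M N \<Longrightarrow> m \<in> carrier (und M) \<Longrightarrow> f m \<in> carrier (und N)"
  by (rule linear_mapsD(1)[OF comodule_mapsD(1)])

end

context comonoidal
begin

lemma comod_cat_units [simp]:
  "UnitO \<C> = S"
  "LUnit \<C> M = carr (RT S M) (runit_l M) M"
  "RUnit \<C> M = carr (RT M S) (runit_r M) M"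
  by (simp_all add: comod_cat_def carr_def)

text \<open>
  The inverses are needed explicitly, because they define the \<open>H\<^sub>s\<close>-coactions on comodules.
\<close>

lemma LUnit_inverse:
  assumes [simp]: "comod M"
  shows "inverse_arrows \<C> (LUnit \<C> M) (carr M (\<lambda>m. dot S M \<eta> m) (RT S M))"
    "inverse_arrows \<C> (RUnit \<C> M) (carr M (\<lambda>m. dot M S m \<eta>) (RT M S))"
proof -
  have "(\<lambda>m. dot S M \<eta> m) \<in> CM M (RT S M)" "(\<lambda>m. dot M S m \<eta>) \<in> CM M (RT M S)"
    by (rule comodule_maps_inverse[OF _ _ runit_comodule_map(1)] comodule_maps_inverse[OF _ _ runit_comodule_map(2)];
        auto simp: runit_inverse intro!: lin)+
  then show "inverse_arrows \<C> (LUnit \<C> M) (carr M (\<lambda>m. dot S M \<eta> m) (RT S M))"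
    "inverse_arrows \<C> (RUnit \<C> M) (carr M (\<lambda>m. dot M S m \<eta>) (RT M S))"
    by (auto intro!: carr_inverse simp: runit_comodule_map runit_inverse)
qed

text \<open>
  Every equation between arrows is checked on (iterated) generators. There both sides of the pentagon are
  \<open>dot w (dot x (dot y z))\<close>, and the triangle is \<open>dot_balanced\<close>.
\<close>

lemma monoidal_comod_cat: "monoidal_category \<C>"
proof (intro monoidal_category.intro category_comod_cat monoidal_category_axioms.intro)
  fix X X' X'' Y Y' Y'' \<phi> \<phi>' \<chi> \<chi>'
  assume "\<phi> \<in> Hom \<C> X X'" "\<chi> \<in> Hom \<C> Y Y'"
  then obtain f g where f: "f \<in> CM X X'" "\<phi> = carr X f X'" "comod X" "comod X'"
    and g: "g \<in> CM Y Y'" "\<chi> = carr Y g Y'" "comod Y" "comod Y'" by (elim comod_HomE)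
  then show "\<phi> \<star>\<^bsub>\<C>\<^esub> \<chi> \<in> Hom \<C> (X \<diamondop>\<^bsub>\<C>\<^esub> Y) (X' \<diamondop>\<^bsub>\<C>\<^esub> Y')"
    by (simp add: tmap_comodule_map)
  assume "\<phi>' \<in> Hom \<C> X' X''" "\<chi>' \<in> Hom \<C> Y' Y''"
  then obtain f' g' where f': "f' \<in> CM X' X''" "\<phi>' = carr X' f' X''" "comod X''"
    and g': "g' \<in> CM Y' Y''" "\<chi>' = carr Y' g' Y''" "comod Y''" by (elim comod_HomE)
  note c = comodule_maps_comp[OF f(3,4) f'(3) f(1) f'(1)] comodule_maps_comp[OF g(3,4) g'(3) g(1) g'(1)]
  show "(\<phi>' \<cdot>\<^bsub>\<C>\<^esub> \<phi>) \<star>\<^bsub>\<C>\<^esub> (\<chi>' \<cdot>\<^bsub>\<C>\<^esub> \<chi>) = (\<phi>' \<star>\<^bsub>\<C>\<^esub> \<chi>') \<cdot>\<^bsub>\<C>\<^esub> (\<phi> \<star>\<^bsub>\<C>\<^esub> \<chi>)"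
    using f g f' g' c
    by (auto simp: tmap_dot comodule_map_closed tmap_comodule_map
        intro!: carr_ext lin_comp[OF tmap_comodule_map_lin tmap_comodule_map_lin])
next
  fix X Y assume "X \<in> Ob \<C>" "Y \<in> Ob \<C>"
  then show "Ident \<C> X \<star>\<^bsub>\<C>\<^esub> Ident \<C> Y = Ident \<C> (X \<diamondop>\<^bsub>\<C>\<^esub> Y)"
    by (auto simp: tmap_dot comodule_maps_id intro!: carr_ext)
next
  fix X Y Z assume "X \<in> Ob \<C>" "Y \<in> Ob \<C>" "Z \<in> Ob \<C>"
  then show "Assoc \<C> X Y Z \<in> Iso \<C> ((X \<diamondop>\<^bsub>\<C>\<^esub> Y) \<diamondop>\<^bsub>\<C>\<^esub> Z) (X \<diamondop>\<^bsub>\<C>\<^esub> Y \<diamondop>\<^bsub>\<C>\<^esub> Z)"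
    by (auto simp: rassoc_inverse rassoc_comodule_map rassoc_lin intro!: carr_Iso[of _ _ _ "rassoc_inv X Y Z"])
next
  fix X X' Y Y' Z Z' f g h
  assume "f \<in> Hom \<C> X X'" "g \<in> Hom \<C> Y Y'" "h \<in> Hom \<C> Z Z'"
  then show "Assoc \<C> X' Y' Z' \<cdot>\<^bsub>\<C>\<^esub> ((f \<star>\<^bsub>\<C>\<^esub> g) \<star>\<^bsub>\<C>\<^esub> h) = (f \<star>\<^bsub>\<C>\<^esub> g \<star>\<^bsub>\<C>\<^esub> h) \<cdot>\<^bsub>\<C>\<^esub> Assoc \<C> X Y Z"
    by (auto elim!: comod_HomE simp: tmap_dot rassoc_dot comodule_map_closed tmap_comodule_map rassoc_comodule_map
        intro!: carr_ext_left lin_comp[OF rassoc_lin(1) tmap_comodule_map_lin] lin_comp[OF tmap_comodule_map_lin rassoc_lin(1)])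
next
  fix X assume "X \<in> Ob \<C>"
  then show "LUnit \<C> X \<in> Iso \<C> (UnitO \<C> \<diamondop>\<^bsub>\<C>\<^esub> X) X" "RUnit \<C> X \<in> Iso \<C> (X \<diamondop>\<^bsub>\<C>\<^esub> UnitO \<C>) X"
    using LUnit_inverse[of X] by (auto simp: Iso_def runit_comodule_map)
next
  fix f X X' assume "f \<in> Hom \<C> X X'"
  then obtain g where g: "g \<in> CM X X'" "f = carr X g X'" "comod X" "comod X'" by (elim comod_HomE)
  note [simp] = g(3,4) comodule_map_closed[OF g(1)]
  have act: "lact X' y (g m) = g (lact X y m)" "ract X' (g m) y = g (ract X m y)"
    if "y \<in> carrier H" "m \<in> carrier (und X)" for y m
  proof -
    have "bilin (und X') H (und X') (\<lambda>a b. \<epsilon> (y ** b) \<odot>\<^bsub>und X'\<^esub> a)" "bilin (und X') H (und X') (\<lambda>a b. \<epsilon> (b ** y) \<odot>\<^bsub>und X'\<^esub> a)"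
      using that by (auto intro!: lin)
    from this[THEN comodule_mapsD(2)[OF g(1) g(3,4) comodule_simps(1)[OF g(4)]], OF that(2)]
    show "lact X' y (g m) = g (lact X y m)" "ract X' (g m) y = g (ract X m y)"
      using that act_push[OF g(3) _ comodule_mapsD(1)[OF g(1)], of y m]
      by (simp_all add: lact_def[of X'] ract_def[of X'])
  qed
  show "LUnit \<C> X' \<cdot>\<^bsub>\<C>\<^esub> (Ident \<C> (UnitO \<C>) \<star>\<^bsub>\<C>\<^esub> f) = f \<cdot>\<^bsub>\<C>\<^esub> LUnit \<C> X"
    using g by (auto simp: tmap_dot runit_dot tmap_comodule_map comodule_maps_id runit_comodule_map act
        intro!: carr_ext lin_comp[OF runit_lin(1) tmap_comodule_map_lin] lin_comp[OF comodule_mapsD(1)[OF g(1)] runit_lin(1)])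
  show "RUnit \<C> X' \<cdot>\<^bsub>\<C>\<^esub> (f \<star>\<^bsub>\<C>\<^esub> Ident \<C> (UnitO \<C>)) = f \<cdot>\<^bsub>\<C>\<^esub> RUnit \<C> X"
    using g by (auto simp: tmap_dot runit_dot tmap_comodule_map comodule_maps_id runit_comodule_map act
        intro!: carr_ext lin_comp[OF runit_lin(2) tmap_comodule_map_lin] lin_comp[OF comodule_mapsD(1)[OF g(1)] runit_lin(2)])
next
  fix W X Y Z assume "W \<in> Ob \<C>" "X \<in> Ob \<C>" "Y \<in> Ob \<C>" "Z \<in> Ob \<C>"
  then have [simp]: "comod W" "comod X" "comod Y" "comod Z" by auto
  have 1: "(\<lambda>x. rassoc k H W (RT X Y) Z (tmap k (RM W (RT X Y)) (und Z) (rassoc k H W X Y) (\<lambda>x. x) x))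
      \<in> CM (RT (RT (RT W X) Y) Z) (RT W (RT (RT X Y) Z))"
    by (rule comodule_maps_comp[OF _ _ _ tmap_comodule_map rassoc_comodule_map]) (auto simp: comodule_maps_id rassoc_comodule_map)
  show "Assoc \<C> W X (Y \<diamondop>\<^bsub>\<C>\<^esub> Z) \<cdot>\<^bsub>\<C>\<^esub> Assoc \<C> (W \<diamondop>\<^bsub>\<C>\<^esub> X) Y Z =
       (Ident \<C> W \<star>\<^bsub>\<C>\<^esub> Assoc \<C> X Y Z) \<cdot>\<^bsub>\<C>\<^esub> Assoc \<C> W (X \<diamondop>\<^bsub>\<C>\<^esub> Y) Z \<cdot>\<^bsub>\<C>\<^esub> (Assoc \<C> W X Y \<star>\<^bsub>\<C>\<^esub> Ident \<C> Z)"
    by (auto simp: tmap_dot rassoc_dot tmap_comodule_map comodule_maps_id rassoc_comodule_map 1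
        intro!: carr_ext_left4 lin_comp[OF rassoc_lin(1) rassoc_lin(1)]
        lin_comp[OF tmap_comodule_map_lin comodule_mapsD(1)[OF 1]])
next
  fix X Y assume "X \<in> Ob \<C>" "Y \<in> Ob \<C>"
  then show "(Ident \<C> X \<star>\<^bsub>\<C>\<^esub> LUnit \<C> Y) \<cdot>\<^bsub>\<C>\<^esub> Assoc \<C> X (UnitO \<C>) Y = RUnit \<C> X \<star>\<^bsub>\<C>\<^esub> Ident \<C> Y"
    by (auto simp: tmap_dot rassoc_dot tmap_comodule_map comodule_maps_id runit_comodule_map rassoc_comodule_map
        runit_dot dot_balanced intro!: carr_ext_left lin_comp[OF tmap_comodule_map_lin rassoc_lin(1)])
qed auto


section \<open>The forgetful functor\<close>

lemma U_simps [simp]: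
  "U_arr (carr M f N) = marr (und M) f (und N)"
  "U_mon k H M N = marr (und M \<boxtimes> und N) (rpi k H M N) (RM M N)"
  "U_mon0 k H = marr K (\<lambda>x. x \<odot>\<^bsub>H\<^esub> \<eta>) HM"
  "U_opmon k H M N = marr (RM M N) (\<lambda>x. x) (und M \<boxtimes> und N)"
  "U_opmon0 k H = marr HM \<epsilon> K"
  by (simp_all add: U_arr_def U_mon_def U_mon0_def U_opmon_def U_opmon0_def marr_def Let_def id_def)

lemma cat_functor_U: "cat_functor \<C> \<M> und U_arr"
  by (intro cat_functor.intro category_comod_cat category_mod_cat cat_functor_axioms.intro)
    (auto elim!: comod_HomE simp: comodule_mapsD(1))

lemma lin_scalar_one: "(\<lambda>x. x \<odot>\<^bsub>H\<^esub> \<eta>) \<in> Lin K HM"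
  using lin_smult1[OF lin_id, of \<eta> HM] by (simp add: Hs_ops)

lemma scalar_one_HM [simp]: "a \<in> carrier k \<Longrightarrow> a \<odot>\<^bsub>H\<^esub> \<eta> \<in> carrier HM"
  using linear_mapsD(1)[OF lin_scalar_one] by simp

lemma act_scalar_one:
  assumes "comod M" "a \<in> carrier k" "m \<in> carrier (und M)"
  shows "lact M (a \<odot>\<^bsub>H\<^esub> \<eta>) m = a \<odot>\<^bsub>und M\<^esub> m" "ract M m (a \<odot>\<^bsub>H\<^esub> \<eta>) = a \<odot>\<^bsub>und M\<^esub> m"
  using linear_mapsD(3)[OF lin_act(1)[OF lin_id assms(3,1)] assms(2), of \<eta>]
    linear_mapsD(3)[OF lin_act(3)[OF lin_id assms(3,1)] assms(2), of \<eta>] act_one[OF assms(1,3)] by auto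

theorem monoidal_functor_U: "monoidal_functor \<C> \<M> und U_arr (U_mon k H) (U_mon0 k H)"
proof (intro monoidal_functor.intro monoidal_comod_cat monoidal_mod_cat cat_functor_U monoidal_functor_axioms.intro)
  fix X Y Z assume "X \<in> Ob \<C>" "Y \<in> Ob \<C>"
  then have [simp]: "comod X" "comod Y" by auto
  note d = dot_def[symmetric]
  show "U_mon k H X Y \<in> Hom \<M> (und X \<diamondop>\<^sub>\<M> und Y) (und (X \<diamondop>\<^bsub>\<C>\<^esub> Y))"
    by (simp add: rpi_closed(4))
  assume "Z \<in> Ob \<C>"
  then have [simp]: "comod Z" by auto
  have 1: "(\<lambda>x. rpi k H (RT X Y) Z (tmap k (RM X Y) (und Z) (rpi k H X Y) (\<lambda>x. x) x)) \<in> Lin ((und X \<boxtimes> und Y) \<boxtimes> und Z) (RM (RT X Y) Z)"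
    by (rule lin_comp[OF rpi_closed(4) tmap_lin]) (auto simp: rpi_closed(4))
  have 2: "(\<lambda>x. tmap k (und X) (RM Y Z) (\<lambda>x. x) (rpi k H Y Z) (tassoc k (und X) (und Y) (und Z) x)) \<in> Lin ((und X \<boxtimes> und Y) \<boxtimes> und Z) (und X \<boxtimes> RM Y Z)"
    by (rule lin_comp[OF tmap_lin tassoc_lin]) (auto simp: rpi_closed(4))
  show "U_arr (Assoc \<C> X Y Z) \<bullet> U_mon k H (X \<diamondop>\<^bsub>\<C>\<^esub> Y) Z \<bullet> (U_mon k H X Y \<otimes>\<^sub>\<M> Ident \<M> (und Z)) =
       U_mon k H X (Y \<diamondop>\<^bsub>\<C>\<^esub> Z) \<bullet> (Ident \<M> (und X) \<otimes>\<^sub>\<M> U_mon k H Y Z) \<bullet> Assoc \<M> (und X) (und Y) (und Z)"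
    using 1 2 by (auto simp: rpi_closed(4) tmap_tens tassoc_tens d rassoc_dot
        intro!: marr_ext_left lin_comp[OF rassoc_lin(1) 1] lin_comp[OF rpi_closed(4) 2])
next
  show "U_mon0 k H \<in> Hom \<M> (UnitO \<M>) (und (UnitO \<C>))"
    by (simp add: lin_scalar_one)
next
  fix f X X' g Y Y' assume "f \<in> Hom \<C> X X'" "g \<in> Hom \<C> Y Y'"
  then show "U_mon k H X' Y' \<bullet> (U_arr f \<otimes>\<^sub>\<M> U_arr g) = U_arr (f \<star>\<^bsub>\<C>\<^esub> g) \<bullet> U_mon k H X Y"
    by (auto elim!: comod_HomE simp: comodule_mapsD(1) rpi_closed(4) tmap_tens dot_def[symmetric] tmap_dot comodule_map_closed
        intro!: marr_ext lin_comp[OF rpi_closed(4) tmap_lin] lin_comp[OF tmap_comodule_map_lin rpi_closed(4)])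
next
  fix X assume "X \<in> Ob \<C>"
  then have [simp]: "comod X" by auto
  have 1: "(\<lambda>x. rpi k H S X (tmap k HM (und X) (\<lambda>x. x \<odot>\<^bsub>H\<^esub> \<eta>) (\<lambda>x. x) x)) \<in> Lin (K \<boxtimes> und X) (RM S X)"
    by (rule lin_comp[OF rpi_closed(4) tmap_lin]) (auto simp: lin_scalar_one)
  have 2: "(\<lambda>x. rpi k H X S (tmap k (und X) HM (\<lambda>x. x) (\<lambda>x. x \<odot>\<^bsub>H\<^esub> \<eta>) x)) \<in> Lin (und X \<boxtimes> K) (RM X S)"
    by (rule lin_comp[OF rpi_closed(4) tmap_lin]) (auto simp: lin_scalar_one)
  show "U_arr (LUnit \<C> X) \<bullet> U_mon k H (UnitO \<C>) X \<bullet> (U_mon0 k H \<otimes>\<^sub>\<M> Ident \<M> (und X)) = LUnit \<M> (und X)"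
    using 1 by (auto simp: rpi_closed(4) tmap_tens lin_scalar_one unit_tens dot_def[symmetric] runit_dot act_scalar_one
        intro!: marr_ext lin_comp[OF runit_lin(1) 1])
  show "U_arr (RUnit \<C> X) \<bullet> U_mon k H X (UnitO \<C>) \<bullet> (Ident \<M> (und X) \<otimes>\<^sub>\<M> U_mon0 k H) = RUnit \<M> (und X)"
    using 2 by (auto simp: rpi_closed(4) tmap_tens lin_scalar_one unit_tens dot_def[symmetric] runit_dot act_scalar_one
        intro!: marr_ext lin_comp[OF runit_lin(2) 2])
qed

end

context comonoidal
begin

text \<open>
  The inclusions of \<open>(M \<otimes>\<^sup>r N) \<otimes>\<^sup>r P\<close> and \<open>M \<otimes>\<^sup>r (N \<otimes>\<^sup>r P)\<close> into \<open>M \<otimes> (N \<otimes> P)\<close> are intertwined by the associativity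
  constraint: both send a generator to \<open>\<epsilon>(m\<^sub>[\<^sub>1\<^sub>]n\<^sub>[\<^sub>1\<^sub>]p\<^sub>[\<^sub>1\<^sub>]) m\<^sub>[\<^sub>0\<^sub>] \<otimes> n\<^sub>[\<^sub>0\<^sub>] \<otimes> p\<^sub>[\<^sub>0\<^sub>]\<close>.
\<close>

lemma lin_incl: "comod M \<Longrightarrow> comod N \<Longrightarrow> (\<lambda>x. x) \<in> Lin (RM M N) (und M \<boxtimes> und N)"
  by (rule rpi_closed(6)) auto

lemma incl_rassoc:
  assumes [simp]: "comod M" "comod N" "comod P" and t: "t \<in> carrier (RM (RT M N) P)"
  shows "tmap k (und M) (und N \<boxtimes> und P) (\<lambda>x. x) (\<lambda>x. x) (rassoc k H M N P t)
    = tassoc k (und M) (und N) (und P) (tmap k (und M \<boxtimes> und N) (und P) (\<lambda>x. x) (\<lambda>x. x) t)"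
proof -
  let ?X = "und M" and ?Y = "und N" and ?Z = "und P"
  let ?T = "?X \<boxtimes> ?Y \<boxtimes> ?Z"
  let ?r = "tmap k ?X (?Y \<boxtimes> ?Z) (\<lambda>x. x) (\<lambda>x. x)" and ?l = "tmap k (?X \<boxtimes> ?Y) ?Z (\<lambda>x. x) (\<lambda>x. x)"
  have r: "?r \<in> Lin (?X \<boxtimes> RM N P) ?T" and l: "?l \<in> Lin (RM M N \<boxtimes> ?Z) ((?X \<boxtimes> ?Y) \<boxtimes> ?Z)"
    by (intro tmap_lin lin_incl lin_id; simp)+
  note al = lin_comp[OF tassoc_lin l]
  show ?thesis
  proof (rule rtensor_ext_left[OF _ _ _ _ _ _ _ t])
    show "(\<lambda>t. ?r (rassoc k H M N P t)) \<in> Lin (RM (RT M N) P) ?T"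
      by (rule lin_comp[OF rpi_closed(5)[OF _ _ r] rassoc_lin(1)]) auto
    show "(\<lambda>t. tassoc k ?X ?Y ?Z (?l t)) \<in> Lin (RM (RT M N) P) ?T"
      by (rule rpi_closed(5)) (auto intro!: al)
    fix m n p assume [simp]: "m \<in> carrier ?X" "n \<in> carrier ?Y" "p \<in> carrier ?Z"
    let ?s = "\<lambda>f. csw M ?T (\<lambda>m0 m1. csw N ?T (\<lambda>n0 n1. csw P ?T (\<lambda>p0 p1.
       \<epsilon> (f m1 n1 p1) \<odot>\<^bsub>?T\<^esub> tens k ?X (?Y \<boxtimes> ?Z) m0 (tens k ?Y ?Z n0 p0)) p) n) m"
    have sub: "s \<in> carrier (?Y \<boxtimes> ?Z)" if "s \<in> carrier (RM N P)" for s
      using that by (intro rpi_closed(3)) auto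
    have sub': "s \<in> carrier (?X \<boxtimes> ?Y)" if "s \<in> carrier (RM M N)" for s
      using that by (intro rpi_closed(3)) auto
    have "?r (dot M (RT N P) m (dot N P n p)) = csw M ?T (\<lambda>m0 m1. csw (RT N P) ?T (\<lambda>y0 y1.
        \<epsilon> (m1 ** y1) \<odot>\<^bsub>?T\<^esub> ?r (tens k ?X (RM N P) m0 y0)) (dot N P n p)) m"
      by (rule lin_dot_expand) (auto intro!: r)
    also have "\<dots> = csw M ?T (\<lambda>m0 m1. csw (RT N P) ?T (\<lambda>y0 y1. \<epsilon> (m1 ** y1) \<odot>\<^bsub>?T\<^esub> tens k ?X (?Y \<boxtimes> ?Z) m0 y0) (dot N P n p)) m"
      by (intro sw_cong) (auto simp: tmap_tens lin_incl)
    also have "\<dots> = ?s (\<lambda>a b c. a ** (b ** c))"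
      by (intro sw_cong sw_dot_tensor) (auto intro!: lin simp: sub)
    also have "\<dots> = ?s (\<lambda>a b c. (a ** b) ** c)"
      by (intro sw_cong) (auto simp: m_assoc)
    also have "\<dots> = csw (RT M N) ?T (\<lambda>x0 x1. csw P ?T (\<lambda>p0 p1.
        \<epsilon> (x1 ** p1) \<odot>\<^bsub>?T\<^esub> tassoc k ?X ?Y ?Z (tens k (?X \<boxtimes> ?Y) ?Z x0 p0)) p) (dot M N m n)"
    proof -
      have "csw (RT M N) ?T (\<lambda>x0 x1. csw P ?T (\<lambda>p0 p1.
          \<epsilon> (x1 ** p1) \<odot>\<^bsub>?T\<^esub> tassoc k ?X ?Y ?Z (tens k (?X \<boxtimes> ?Y) ?Z x0 p0)) p) (dot M N m n)
        = csw M ?T (\<lambda>m0 m1. csw N ?T (\<lambda>n0 n1. csw P ?T (\<lambda>p0 p1.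
          \<epsilon> ((m1 ** n1) ** p1) \<odot>\<^bsub>?T\<^esub> tassoc k ?X ?Y ?Z (tens k (?X \<boxtimes> ?Y) ?Z (tens k ?X ?Y m0 n0) p0)) p) n) m"
        by (rule sw_dot_tensor) (auto intro!: lin linear_mapsD(1)[OF tassoc_lin] simp: sub')
      also have "\<dots> = ?s (\<lambda>a b c. (a ** b) ** c)"
        by (intro sw_cong) (auto simp: tassoc_tens)
      finally show ?thesis by simp
    qed
    also have "\<dots> = csw (RT M N) ?T (\<lambda>x0 x1. csw P ?T (\<lambda>p0 p1.
        \<epsilon> (x1 ** p1) \<odot>\<^bsub>?T\<^esub> tassoc k ?X ?Y ?Z (?l (tens k (RM M N) ?Z x0 p0))) p) (dot M N m n)"
      by (intro sw_cong) (auto simp: tmap_tens lin_incl)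
    also have "\<dots> = tassoc k ?X ?Y ?Z (?l (dot (RT M N) P (dot M N m n) p))"
      by (rule lin_dot_expand[symmetric, of "RT M N" P _ "\<lambda>t. tassoc k ?X ?Y ?Z (?l t)"]) (auto intro!: al)
    finally show "?r (rassoc k H M N P (dot (RT M N) P (dot M N m n) p)) = tassoc k ?X ?Y ?Z (?l (dot (RT M N) P (dot M N m n) p))"
      by (simp add: rassoc_dot)
  qed auto
qed

text \<open>
  In \<open>dot y m = \<epsilon>(y\<^sub>2m\<^sub>1) y\<^sub>1 \<otimes> m\<^sub>0\<close> the counit on \<open>y\<^sub>1\<close> cancels, which leaves \<open>\<epsilon>(ym\<^sub>1)m\<^sub>0\<close>.
\<close>

lemma counit_dot:
  assumes [simp]: "comod M" "m \<in> carrier (und M)" and y: "y \<in> carrier HM"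
  shows "tlift (und M) (\<lambda>a m. a \<odot>\<^bsub>und M\<^esub> m) (tmap k K (und M) \<epsilon> (\<lambda>x. x) (dot S M y m)) = lact M y m"
    and "tlift (und M) (\<lambda>m a. a \<odot>\<^bsub>und M\<^esub> m) (tmap k (und M) K (\<lambda>x. x) \<epsilon> (dot M S m y)) = ract M m y"
proof -
  let ?P = "und M"
  have eps: "\<epsilon> \<in> Lin HM K" by (rule Hs.restrict_lin[OF counit_linear])
  note [simp] = y
  have l: "(\<lambda>t. tlift ?P (\<lambda>a m. a \<odot>\<^bsub>?P\<^esub> m) (tmap k K ?P \<epsilon> (\<lambda>x. x) t)) \<in> Lin (HM \<boxtimes> ?P) ?P"
    and r: "(\<lambda>t. tlift ?P (\<lambda>m a. a \<odot>\<^bsub>?P\<^esub> m) (tmap k ?P K (\<lambda>x. x) \<epsilon> t)) \<in> Lin (?P \<boxtimes> HM) ?P"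
    by (intro lin_comp[OF unit_lin(1) tmap_lin] lin_comp[OF unit_lin(2) tmap_lin] eps lin_id; simp)+
  have "tlift ?P (\<lambda>a m. a \<odot>\<^bsub>?P\<^esub> m) (tmap k K ?P \<epsilon> (\<lambda>x. x) (dot S M y m))
    = ssw ?P (\<lambda>y0 y1. csw M ?P (\<lambda>m0 m1. \<epsilon> (y1 ** m1) \<odot>\<^bsub>?P\<^esub> tlift ?P (\<lambda>a m. a \<odot>\<^bsub>?P\<^esub> m) (tmap k K ?P \<epsilon> (\<lambda>x. x) (tens k HM ?P y0 m0))) m) y"
    by (rule lin_dot_expand[OF _ _ _ l]) auto
  also have "\<dots> = ssw ?P (\<lambda>y0 y1. csw M ?P (\<lambda>m0 m1. \<epsilon> (y1 ** m1) \<odot>\<^bsub>?P\<^esub> (\<epsilon> y0 \<odot>\<^bsub>?P\<^esub> m0)) m) y"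
    using Hs.R_coaction by (intro sw_cong) (auto simp: tmap_tens eps unit_tens)
  also have "\<dots> = ssw ?P (\<lambda>y0 y1. \<epsilon> y0 \<odot>\<^bsub>?P\<^esub> lact M y1 m) y"
    using Hs.R_coaction by (intro sw_cong) (auto simp: lact_def sw_smult module_smult_comm intro!: sw_cong)
  also have "\<dots> = hsw ?P (\<lambda>y0 y1. \<epsilon> y0 \<odot>\<^bsub>?P\<^esub> lact M y1 m) y"
    by (rule ssw_hsw) (auto intro!: lin)
  also have "\<dots> = lact M y m"
    by (rule hsw_counit_left) (auto intro!: lin)
  finally show "tlift ?P (\<lambda>a m. a \<odot>\<^bsub>?P\<^esub> m) (tmap k K ?P \<epsilon> (\<lambda>x. x) (dot S M y m)) = lact M y m" .
  have "tlift ?P (\<lambda>m a. a \<odot>\<^bsub>?P\<^esub> m) (tmap k ?P K (\<lambda>x. x) \<epsilon> (dot M S m y))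
    = csw M ?P (\<lambda>m0 m1. ssw ?P (\<lambda>y0 y1. \<epsilon> (m1 ** y1) \<odot>\<^bsub>?P\<^esub> tlift ?P (\<lambda>m a. a \<odot>\<^bsub>?P\<^esub> m) (tmap k ?P K (\<lambda>x. x) \<epsilon> (tens k ?P HM m0 y0))) y) m"
    by (rule lin_dot_expand[OF _ _ _ r]) auto
  also have "\<dots> = csw M ?P (\<lambda>m0 m1. ssw ?P (\<lambda>y0 y1. \<epsilon> (m1 ** y1) \<odot>\<^bsub>?P\<^esub> (\<epsilon> y0 \<odot>\<^bsub>?P\<^esub> m0)) y) m"
    using Hs.R_coaction by (intro sw_cong) (auto simp: tmap_tens eps unit_tens)
  also have "\<dots> = csw M ?P (\<lambda>m0 m1. hsw ?P (\<lambda>y0 y1. \<epsilon> (m1 ** y1) \<odot>\<^bsub>?P\<^esub> (\<epsilon> y0 \<odot>\<^bsub>?P\<^esub> m0)) y) m"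
    by (intro sw_cong ssw_hsw) (auto intro!: lin)
  also have "\<dots> = csw M ?P (\<lambda>m0 m1. hsw ?P (\<lambda>y0 y1. \<epsilon> y0 \<odot>\<^bsub>?P\<^esub> (\<epsilon> (m1 ** y1) \<odot>\<^bsub>?P\<^esub> m0)) y) m"
    by (intro sw_cong) (auto simp: module_smult_comm)
  also have "\<dots> = ract M m y"
    unfolding ract_def by (intro sw_cong hsw_counit_left) (auto intro!: lin)
  finally show "tlift ?P (\<lambda>m a. a \<odot>\<^bsub>?P\<^esub> m) (tmap k ?P K (\<lambda>x. x) \<epsilon> (dot M S m y)) = ract M m y" .
qed

theorem opmonoidal_functor_U: "opmonoidal_functor \<C> \<M> und U_arr (U_opmon k H) (U_opmon0 k H)"
proof (intro opmonoidal_functor.intro monoidal_comod_cat monoidal_mod_cat cat_functor_U opmonoidal_functor_axioms.intro)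
  have eps: "\<epsilon> \<in> Lin HM K" by (rule Hs.restrict_lin[OF counit_linear])
  show "U_opmon0 k H \<in> Hom \<M> (und (UnitO \<C>)) (UnitO \<M>)" by (simp add: eps)
  {
    fix X Y Z assume "X \<in> Ob \<C>" "Y \<in> Ob \<C>"
    then have [simp]: "comod X" "comod Y" by auto
    show "U_opmon k H X Y \<in> Hom \<M> (und (X \<diamondop>\<^bsub>\<C>\<^esub> Y)) (und X \<diamondop>\<^sub>\<M> und Y)"
      by (simp add: lin_incl)
    assume "Z \<in> Ob \<C>"
    then have [simp]: "comod Z" by auto
    show "(Ident \<M> (und X) \<otimes>\<^sub>\<M> U_opmon k H Y Z) \<bullet> U_opmon k H X (Y \<diamondop>\<^bsub>\<C>\<^esub> Z) \<bullet> U_arr (Assoc \<C> X Y Z) =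
         Assoc \<M> (und X) (und Y) (und Z) \<bullet> (U_opmon k H X Y \<otimes>\<^sub>\<M> Ident \<M> (und Z)) \<bullet> U_opmon k H (X \<diamondop>\<^bsub>\<C>\<^esub> Y) Z"
      by (auto simp: rassoc_lin lin_incl rpi_closed(5) rpi_closed(6)[OF _ _ rassoc_lin(1)] incl_rassoc intro!: marr_eqI)
  next
    fix f X X' g Y Y' assume "f \<in> Hom \<C> X X'" "g \<in> Hom \<C> Y Y'"
    then show "U_opmon k H X' Y' \<bullet> U_arr (f \<star>\<^bsub>\<C>\<^esub> g) = (U_arr f \<otimes>\<^sub>\<M> U_arr g) \<bullet> U_opmon k H X Y"
      by (auto elim!: comod_HomE simp: lin_incl)
  next
    fix X assume "X \<in> Ob \<C>"
    then have [simp]: "comod X" by auto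
    show "LUnit \<M> (und X) \<bullet> (U_opmon0 k H \<otimes>\<^sub>\<M> Ident \<M> (und X)) \<bullet> U_opmon k H (UnitO \<C>) X = U_arr (LUnit \<C> X)"
    proof -
      have l: "tmap k K (und X) \<epsilon> (\<lambda>x. x) \<in> Lin (RM S X) (K \<boxtimes> und X)"
        by (rule rpi_closed(5)) (auto simp: eps)
      show ?thesis
        using l by (simp add: lin_incl) (rule marr_eqI, rule rtensor_ext[OF comod_S _ _ lin_comp[OF unit_lin(1) l]];
            simp add: counit_dot runit_dot)
    qed
    show "RUnit \<M> (und X) \<bullet> (Ident \<M> (und X) \<otimes>\<^sub>\<M> U_opmon0 k H) \<bullet> U_opmon k H X (UnitO \<C>) = U_arr (RUnit \<C> X)"
    proof -
      have l: "tmap k (und X) K (\<lambda>x. x) \<epsilon> \<in> Lin (RM X S) (und X \<boxtimes> K)"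
        by (rule rpi_closed(5)) (auto simp: eps)
      show ?thesis
        using l by (simp add: lin_incl) (rule marr_eqI, rule rtensor_ext[OF _ comod_S _ lin_comp[OF unit_lin(2) l]];
            simp add: counit_dot runit_dot)
    qed
  }
qed


section \<open>The consequences of (lm) and (rm)\<close>

text \<open>
  Expanding both actions gives \<open>\<epsilon>(m\<^sub>1p)\<epsilon>(qn\<^sub>1) m\<^sub>0 \<otimes> n\<^sub>0\<close>. The pair \<open>(p, q)\<close> will be \<open>(1\<^sub>1, 1\<^sub>2)\<close> for (lm) and \<open>(1\<^sub>2, 1\<^sub>1)\<close>
  for (rm), and the axiom applied to \<open>m\<^sub>1 1 n\<^sub>1\<close> evaluates the product of the two counits to \<open>\<epsilon>(m\<^sub>1n\<^sub>1)\<close>.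
\<close>

lemma hsw_act_act:
  assumes [simp]: "comod M" "comod N" "m \<in> carrier (und M)" "n \<in> carrier (und N)"
    and pq [simp]: "\<And>a b. a \<in> carrier H \<Longrightarrow> b \<in> carrier H \<Longrightarrow> p a b \<in> carrier H"
      "\<And>a b. a \<in> carrier H \<Longrightarrow> b \<in> carrier H \<Longrightarrow> q a b \<in> carrier H"
    and \<epsilon>: "\<And>g h. g \<in> carrier H \<Longrightarrow> h \<in> carrier H \<Longrightarrow>
      hsw K (\<lambda>a b. \<epsilon> (g ** p a b) \<otimes>\<^bsub>k\<^esub> \<epsilon> (q a b ** h)) \<eta> = \<epsilon> (g ** h)"
  shows "hsw (und M \<boxtimes> und N) (\<lambda>a b. tens k (und M) (und N) (ract M m (p a b)) (lact N (q a b) n)) \<eta> = dot M N m n"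
proof -
  let ?T = "und M \<boxtimes> und N" and ?t = "tens k (und M) (und N)"
  let ?e = "\<lambda>m1 n1 a b. \<epsilon> (m1 ** p a b) \<otimes>\<^bsub>k\<^esub> \<epsilon> (q a b ** n1)"
  have "hsw ?T (\<lambda>a b. ?t (ract M m (p a b)) (lact N (q a b) n)) \<eta>
    = hsw ?T (\<lambda>a b. csw M ?T (\<lambda>m0 m1. csw N ?T (\<lambda>n0 n1. ?e m1 n1 a b \<odot>\<^bsub>?T\<^esub> ?t m0 n0) n) m) \<eta>"
  proof (intro sw_cong)
    fix a b assume [simp]: "a \<in> carrier H" "b \<in> carrier H"
    have "?t (ract M m (p a b)) (lact N (q a b) n) = csw M ?T (\<lambda>m0 m1. \<epsilon> (m1 ** p a b) \<odot>\<^bsub>?T\<^esub> ?t m0 (lact N (q a b) n)) m"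
      by (rule act_push(2)) (auto intro!: lin)
    also have "\<dots> = csw M ?T (\<lambda>m0 m1. \<epsilon> (m1 ** p a b) \<odot>\<^bsub>?T\<^esub> csw N ?T (\<lambda>n0 n1. \<epsilon> (q a b ** n1) \<odot>\<^bsub>?T\<^esub> ?t m0 n0) n) m"
      by (intro sw_cong arg_cong2[where f = "smult ?T"] act_push(1)) (auto intro!: lin)
    also have "\<dots> = csw M ?T (\<lambda>m0 m1. csw N ?T (\<lambda>n0 n1. ?e m1 n1 a b \<odot>\<^bsub>?T\<^esub> ?t m0 n0) n) m"
      by (intro sw_cong) (auto simp: sw_smult module_smult_smult intro!: sw_cong)
    finally show "?t (ract M m (p a b)) (lact N (q a b) n) = \<dots>" .
  qed auto
  also have "\<dots> = csw M ?T (\<lambda>m0 m1. hsw ?T (\<lambda>a b. csw N ?T (\<lambda>n0 n1. ?e m1 n1 a b \<odot>\<^bsub>?T\<^esub> ?t m0 n0) n) \<eta>) m"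
    by (rule sw_swap) auto
  also have "\<dots> = csw M ?T (\<lambda>m0 m1. csw N ?T (\<lambda>n0 n1. hsw ?T (\<lambda>a b. ?e m1 n1 a b \<odot>\<^bsub>?T\<^esub> ?t m0 n0) \<eta>) n) m"
    by (intro sw_cong sw_swap) auto
  also have "\<dots> = csw M ?T (\<lambda>m0 m1. csw N ?T (\<lambda>n0 n1. hsw K (?e m1 n1) \<eta> \<odot>\<^bsub>?T\<^esub> ?t m0 n0) n) m"
    by (intro sw_cong sw_scalar[symmetric]) auto
  also have "\<dots> = csw M ?T (\<lambda>m0 m1. csw N ?T (\<lambda>n0 n1. \<epsilon> (m1 ** n1) \<odot>\<^bsub>?T\<^esub> ?t m0 n0) n) m"
    by (intro sw_cong) (auto simp: \<epsilon>)
  also have "\<dots> = dot M N m n" by (rule dot_eq[symmetric]) auto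
  finally show ?thesis .
qed

lemma dot_split:
  assumes [simp]: "comod M" "comod N" "m \<in> carrier (und M)" "n \<in> carrier (und N)"
  shows "ax_lm k H \<Longrightarrow> dot M N m n = ssw (und M \<boxtimes> und N) (\<lambda>y h. tens k (und M) (und N) (ract M m y) (lact N h n)) \<eta>"
    and "ax_rm k H \<Longrightarrow> dot M N m n = ssw (und M \<boxtimes> und N) (\<lambda>y h. tens k (und M) (und N) (ract M m h) (lact N y n)) \<eta>"
proof -
  have K: "hsw K \<beta> \<eta> = tlift k \<beta> (\<Delta> \<eta>)" for \<beta> by (simp add: sw_def tlift_def)
  show "dot M N m n = ssw (und M \<boxtimes> und N) (\<lambda>y h. tens k (und M) (und N) (ract M m y) (lact N h n)) \<eta>" if "ax_lm k H"
  proof -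
    have "hsw K (\<lambda>a b. \<epsilon> (g ** a) \<otimes>\<^bsub>k\<^esub> \<epsilon> (b ** h)) \<eta> = \<epsilon> (g ** h)" if "g \<in> carrier H" "h \<in> carrier H" for g h
      using \<open>ax_lm k H\<close>[unfolded ax_lm_def, rule_format, of g \<eta> h] that by (simp add: K)
    then show ?thesis
      by (subst ssw_hsw) (auto intro!: lin hsw_act_act[symmetric])
  qed
  show "dot M N m n = ssw (und M \<boxtimes> und N) (\<lambda>y h. tens k (und M) (und N) (ract M m h) (lact N y n)) \<eta>" if "ax_rm k H"
  proof -
    have "hsw K (\<lambda>a b. \<epsilon> (g ** b) \<otimes>\<^bsub>k\<^esub> \<epsilon> (a ** h)) \<eta> = \<epsilon> (g ** h)" if "g \<in> carrier H" "h \<in> carrier H" for g h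
      using \<open>ax_rm k H\<close>[unfolded ax_rm_def, rule_format, of g \<eta> h] that by (simp add: K)
    then show ?thesis
      by (subst ssw_hsw) (auto intro!: lin hsw_act_act[symmetric])
  qed
qed

text \<open>The tensor \<open>m \<otimes> n\<close> has expansions of the same shape as \<open>dot m n\<close> in \<open>dot_split\<close>, with both actions on one side.\<close>

lemma tens_split:
  assumes [simp]: "comod M" "comod N" "m \<in> carrier (und M)" "n \<in> carrier (und N)"
  shows "tens k (und M) (und N) m n = ssw (und M \<boxtimes> und N) (\<lambda>y h. tens k (und M) (und N) m (lact N y (lact N h n))) \<eta>"
    and "tens k (und M) (und N) m n = ssw (und M \<boxtimes> und N) (\<lambda>y h. tens k (und M) (und N) (ract M (ract M m h) y) n) \<eta>"
proof -
  let ?T = "und M \<boxtimes> und N" and ?t = "tens k (und M) (und N)"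
  have "ssw ?T (\<lambda>y h. ?t m (lact N y (lact N h n))) \<eta> = hsw ?T (\<lambda>y h. ?t m (lact N y (lact N h n))) \<eta>"
    by (rule ssw_hsw) (auto intro!: lin)
  also have "\<dots> = ?t m (hsw (und N) (\<lambda>y h. lact N y (lact N h n)) \<eta>)"
    by (rule sw_tens(2)[symmetric]) auto
  finally show "?t m n = ssw ?T (\<lambda>y h. ?t m (lact N y (lact N h n))) \<eta>"
    by (simp add: act_mult act_one)
  have "ssw ?T (\<lambda>y h. ?t (ract M (ract M m h) y) n) \<eta> = hsw ?T (\<lambda>y h. ?t (ract M (ract M m h) y) n) \<eta>"
    by (rule ssw_hsw) (auto intro!: lin)
  also have "\<dots> = ?t (hsw (und M) (\<lambda>y h. ract M (ract M m h) y) \<eta>) n"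
    by (rule sw_tens(1)[symmetric]) auto
  finally show "?t m n = ssw ?T (\<lambda>y h. ?t (ract M (ract M m h) y) n) \<eta>"
    by (simp add: act_mult act_one)
qed

end

section \<open>Quotient modules\<close>

context base
begin

text \<open>The first isomorphism theorem: the coset of \<open>t\<close> modulo the kernel is the fibre of \<open>f\<close> through \<open>t\<close>.\<close>

lemma first_isomorphism:
  assumes T: "kmod T" and N: "kmod N" and f: "f \<in> Lin T N" and surj: "f ` carrier T = carrier N"
    and B: "B = {t \<in> carrier T. f t = \<zero>\<^bsub>N\<^esub>}"
  shows "\<exists>\<theta>\<in>linear_isos k (quot_module T B) N. \<forall>t\<in>carrier T. \<theta> (B +>\<^bsub>T\<^esub> t) = f t"
proof -
  interpret T: Module.module k T by (rule T)
  interpret N: Module.module k N by (rule N)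
  note fD = linear_mapsD[OF f]
  have fminus: "f (s \<ominus>\<^bsub>T\<^esub> t) = f s \<ominus>\<^bsub>N\<^esub> f t" if "s \<in> carrier T" "t \<in> carrier T" for s t
  proof -
    have "f ((s \<ominus>\<^bsub>T\<^esub> t) \<oplus>\<^bsub>T\<^esub> t) = f (s \<ominus>\<^bsub>T\<^esub> t) \<oplus>\<^bsub>N\<^esub> f t" using that by (intro fD(2)) auto
    moreover have "(s \<ominus>\<^bsub>T\<^esub> t) \<oplus>\<^bsub>T\<^esub> t = s" using that by (simp add: T.minus_eq T.a_assoc T.l_neg)
    ultimately show ?thesis using that fD(1) by (simp add: N.minus_eq N.a_assoc N.r_neg)
  qed
  have coset: "B +>\<^bsub>T\<^esub> t = {s \<in> carrier T. f s = f t}" if t: "t \<in> carrier T" for t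
  proof (intro equalityI subsetI)
    fix s assume "s \<in> B +>\<^bsub>T\<^esub> t"
    then show "s \<in> {s \<in> carrier T. f s = f t}" using t fD by (auto simp: a_r_coset_def' B)
  next
    fix s assume s: "s \<in> {s \<in> carrier T. f s = f t}"
    then have "s \<ominus>\<^bsub>T\<^esub> t \<in> B" using t fD(1) by (simp add: B fminus N.minus_eq N.r_neg)
    moreover have "s = (s \<ominus>\<^bsub>T\<^esub> t) \<oplus>\<^bsub>T\<^esub> t" using s t by (simp add: T.minus_eq T.a_assoc T.l_neg)
    ultimately show "s \<in> B +>\<^bsub>T\<^esub> t" by (auto simp: a_r_coset_def')
  qed
  let ?Q = "quot_module T B"
  have Q: "carrier ?Q = (\<lambda>t. B +>\<^bsub>T\<^esub> t) ` carrier T"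
    by (auto simp: quot_module_def A_RCOSETS_def')
  have add: "(B +>\<^bsub>T\<^esub> s) \<oplus>\<^bsub>?Q\<^esub> (B +>\<^bsub>T\<^esub> t) = B +>\<^bsub>T\<^esub> (s \<oplus>\<^bsub>T\<^esub> t)" if st: "s \<in> carrier T" "t \<in> carrier T" for s t
  proof (intro equalityI subsetI)
    fix u assume "u \<in> (B +>\<^bsub>T\<^esub> s) \<oplus>\<^bsub>?Q\<^esub> (B +>\<^bsub>T\<^esub> t)"
    then show "u \<in> B +>\<^bsub>T\<^esub> (s \<oplus>\<^bsub>T\<^esub> t)" using st fD by (auto simp: quot_module_def set_add_def' coset)
  next
    fix u assume u: "u \<in> B +>\<^bsub>T\<^esub> (s \<oplus>\<^bsub>T\<^esub> t)"
    then have uT: "u \<in> carrier T" and fu: "f u = f s \<oplus>\<^bsub>N\<^esub> f t" using st fD by (auto simp: coset)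
    have "u = s \<oplus>\<^bsub>T\<^esub> (u \<ominus>\<^bsub>T\<^esub> s)" using uT st by (simp add: T.minus_eq T.a_comm[of s] T.a_assoc T.l_neg)
    moreover have "f (u \<ominus>\<^bsub>T\<^esub> s) = f t" using uT st fD(1)
      by (simp add: fminus fu N.minus_eq) (metis N.a_assoc N.a_comm N.a_inv_closed N.r_neg2)
    then have "s \<in> B +>\<^bsub>T\<^esub> s" "u \<ominus>\<^bsub>T\<^esub> s \<in> B +>\<^bsub>T\<^esub> t" using uT st by (auto simp: coset)
    ultimately show "u \<in> (B +>\<^bsub>T\<^esub> s) \<oplus>\<^bsub>?Q\<^esub> (B +>\<^bsub>T\<^esub> t)"
      unfolding quot_module_def set_add_def' by simp blast
  qed
  have smult: "a \<odot>\<^bsub>?Q\<^esub> (B +>\<^bsub>T\<^esub> t) = B +>\<^bsub>T\<^esub> (a \<odot>\<^bsub>T\<^esub> t)" if "a \<in> carrier k" "t \<in> carrier T" for a t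
    using that fD by (auto simp: quot_module_def coset)
  define \<theta> where "\<theta> c = f (SOME t. t \<in> c)" for c
  have \<theta>: "\<theta> (B +>\<^bsub>T\<^esub> t) = f t" if t: "t \<in> carrier T" for t
    using someI[of "\<lambda>s. s \<in> B +>\<^bsub>T\<^esub> t" t] t by (simp add: \<theta>_def coset)
  have "\<theta> \<in> linear_maps k ?Q N"
    by (rule linear_mapsI) (auto simp: Q \<theta> add smult fD)
  moreover have "bij_betw \<theta> (carrier ?Q) (carrier N)"
    unfolding bij_betw_def
  proof
    show "inj_on \<theta> (carrier ?Q)"
    proof (rule inj_onI)
      fix c d assume "c \<in> carrier ?Q" "d \<in> carrier ?Q" "\<theta> c = \<theta> d"
      then obtain s t where "s \<in> carrier T" "t \<in> carrier T" "c = B +>\<^bsub>T\<^esub> s" "d = B +>\<^bsub>T\<^esub> t" "f s = f t"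
        unfolding Q by (auto simp: \<theta>)
      then show "c = d" by (simp add: coset)
    qed
    show "\<theta> ` carrier ?Q = carrier N" unfolding surj[symmetric] Q image_image using \<theta> by (rule image_cong[OF HOL.refl])
  qed
  ultimately show ?thesis using \<theta> by (auto simp: linear_isos_def)
qed

lemma submodule_closed:
  assumes T: "kmod T" and S: "submodule S k T"
  shows "\<zero>\<^bsub>T\<^esub> \<in> S" "s \<in> S \<Longrightarrow> t \<in> S \<Longrightarrow> s \<oplus>\<^bsub>T\<^esub> t \<in> S" "a \<in> carrier k \<Longrightarrow> s \<in> S \<Longrightarrow> a \<odot>\<^bsub>T\<^esub> s \<in> S"
    "s \<in> S \<Longrightarrow> s \<in> carrier T"
proof -
  interpret T: Module.module k T by (rule T)
  note E = T.submoduleE[OF S]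
  interpret subgroup S "add_monoid T" using S by (rule submodule.axioms)
  show "\<zero>\<^bsub>T\<^esub> \<in> S" using one_closed by simp
  show "s \<in> S \<Longrightarrow> t \<in> S \<Longrightarrow> s \<oplus>\<^bsub>T\<^esub> t \<in> S" "a \<in> carrier k \<Longrightarrow> s \<in> S \<Longrightarrow> a \<odot>\<^bsub>T\<^esub> s \<in> S" "s \<in> S \<Longrightarrow> s \<in> carrier T"
    using E by auto
qed

lemma tlift_submodule:
  assumes "kmod M" "kmod N" and T: "kmod T" and S: "submodule S k T"
    and \<beta>: "\<And>m n. m \<in> carrier M \<Longrightarrow> n \<in> carrier N \<Longrightarrow> \<beta> m n \<in> S" and t: "t \<in> carrier (M \<boxtimes> N)"
  shows "tlift T \<beta> t \<in> S"
proof -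
  have "fsum T \<beta> xs \<in> S" if "xs \<in> pairs M N" for xs
    using that by (induction xs) (auto simp: submodule_closed[OF T S] \<beta>)
  then show ?thesis using tdecode_pairs[OF assms(1,2) t] by (simp add: tlift_fsum)
qed

end

section \<open>The forgetful functor is essentially strong\<close>

context comonoidal
begin

lemma U_inv_units:
  assumes "comod M"
  shows "inv_arr \<C> (LUnit \<C> M) = carr M (\<lambda>m. dot S M \<eta> m) (RT S M)"
    "inv_arr \<C> (RUnit \<C> M) = carr M (\<lambda>m. dot M S m \<eta>) (RT M S)"
  using category.inv_arr_eq[OF category_comod_cat] LUnit_inverse[OF assms] by blast+

lemma U_actions:
  assumes "comod M" "m \<in> carrier (und M)" "y \<in> carrier HM"
  shows "unit_lact k \<C> und U_arr (U_mon k H) M y m = lact M y m"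
    "unit_ract k \<C> und U_arr (U_mon k H) M m y = ract M m y"
  using assms by (simp_all add: unit_lact_def unit_ract_def dot_def[symmetric] runit_dot)

lemma U_coactions:
  assumes "comod M" "m \<in> carrier (und M)"
  shows "unit_lcoact \<C> und U_arr (U_opmon k H) M m = dot S M \<eta> m"
    "unit_rcoact \<C> und U_arr (U_opmon k H) M m = dot M S m \<eta>"
  using assms by (simp_all add: unit_lcoact_def unit_rcoact_def U_inv_units del: comod_cat_units(2,3))

context
  fixes M N :: "'u comod"
  assumes MN [simp]: "comod M" "comod N" and rm_lm: "ax_rm k H \<or> ax_lm k H"
begin

text \<open>
  Subtract the expansion of \<open>dot m n\<close> in \<open>dot_split\<close> from that of \<open>m \<otimes> n\<close> in \<open>tens_split\<close>: the summands differ by moving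
  the action of \<open>1\<^sub>1\<close>, an element of \<open>H\<^sub>s\<close>, across the tensor sign.
\<close>

lemma tens_dot_balanced:
  assumes Sub: "submodule Sub k (und M \<boxtimes> und N)"
    and gen: "\<And>m y n. m \<in> carrier (und M) \<Longrightarrow> y \<in> carrier HM \<Longrightarrow> n \<in> carrier (und N) \<Longrightarrow>
      tens k (und M) (und N) (ract M m y) n \<ominus>\<^bsub>und M \<boxtimes> und N\<^esub> tens k (und M) (und N) m (lact N y n) \<in> Sub"
    and [simp]: "m \<in> carrier (und M)" "n \<in> carrier (und N)"
  shows "tens k (und M) (und N) m n \<ominus>\<^bsub>und M \<boxtimes> und N\<^esub> dot M N m n \<in> Sub"
proof -
  let ?T = "und M \<boxtimes> und N" and ?t = "tens k (und M) (und N)"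
  interpret T: Module.module k ?T by simp
  have kT [simp]: "kmod ?T" by simp
  note [simp] = Hs.R_coaction
  have diff: "ssw ?T \<beta> \<eta> \<ominus>\<^bsub>?T\<^esub> ssw ?T \<gamma> \<eta> \<in> Sub"
    if \<beta>: "\<And>y h. y \<in> carrier HM \<Longrightarrow> h \<in> carrier H \<Longrightarrow> \<beta> y h \<in> carrier ?T"
      and \<gamma>: "\<And>y h. y \<in> carrier HM \<Longrightarrow> h \<in> carrier H \<Longrightarrow> \<gamma> y h \<in> carrier ?T"
      and d: "\<And>y h. y \<in> carrier HM \<Longrightarrow> h \<in> carrier H \<Longrightarrow> \<beta> y h \<ominus>\<^bsub>?T\<^esub> \<gamma> y h \<in> Sub" for \<beta> \<gamma>
  proof -
    have neg: "(\<ominus>\<^bsub>k\<^esub> \<one>\<^bsub>k\<^esub>) \<odot>\<^bsub>?T\<^esub> t = \<ominus>\<^bsub>?T\<^esub> t" if "t \<in> carrier ?T" for t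
      using that by (simp add: T.smult_l_minus)
    have "ssw ?T \<beta> \<eta> \<ominus>\<^bsub>?T\<^esub> ssw ?T \<gamma> \<eta> = ssw ?T \<beta> \<eta> \<oplus>\<^bsub>?T\<^esub> ssw ?T (\<lambda>y h. \<ominus>\<^bsub>?T\<^esub> \<gamma> y h) \<eta>"
    proof -
      have "\<ominus>\<^bsub>?T\<^esub> ssw ?T \<gamma> \<eta> = (\<ominus>\<^bsub>k\<^esub> \<one>\<^bsub>k\<^esub>) \<odot>\<^bsub>?T\<^esub> ssw ?T \<gamma> \<eta>"
        using \<gamma> by (intro neg[symmetric] sw_closed) auto
      also have "\<dots> = ssw ?T (\<lambda>y h. (\<ominus>\<^bsub>k\<^esub> \<one>\<^bsub>k\<^esub>) \<odot>\<^bsub>?T\<^esub> \<gamma> y h) \<eta>"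
        using \<gamma> by (intro sw_smult) auto
      also have "\<dots> = ssw ?T (\<lambda>y h. \<ominus>\<^bsub>?T\<^esub> \<gamma> y h) \<eta>"
        using \<gamma> by (intro sw_cong) (auto simp: neg)
      finally show ?thesis by (simp add: T.minus_eq)
    qed
    also have "\<dots> = ssw ?T (\<lambda>y h. \<beta> y h \<oplus>\<^bsub>?T\<^esub> \<ominus>\<^bsub>?T\<^esub> \<gamma> y h) \<eta>"
      unfolding sw_def using \<beta> \<gamma> coactionD(2)[OF Hs.R_coaction one_HM]
      by (intro tlift_add[symmetric, of HM H]) auto
    also have "\<dots> \<in> Sub"
      unfolding sw_def using d coactionD(2)[OF Hs.R_coaction one_HM]
      by (intro tlift_submodule[of HM H, OF _ _ _ Sub]) (auto simp: T.minus_eq)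
    finally show ?thesis .
  qed
  have swap: "s \<ominus>\<^bsub>?T\<^esub> t \<in> Sub" if "t \<ominus>\<^bsub>?T\<^esub> s \<in> Sub" "s \<in> carrier ?T" "t \<in> carrier ?T" for s t
  proof -
    have "(\<ominus>\<^bsub>k\<^esub> \<one>\<^bsub>k\<^esub>) \<odot>\<^bsub>?T\<^esub> (t \<ominus>\<^bsub>?T\<^esub> s) \<in> Sub" by (rule submodule_closed(3)[OF kT Sub neg_one_closed that(1)])
    moreover have "(\<ominus>\<^bsub>k\<^esub> \<one>\<^bsub>k\<^esub>) \<odot>\<^bsub>?T\<^esub> (t \<ominus>\<^bsub>?T\<^esub> s) = s \<ominus>\<^bsub>?T\<^esub> t"
      using that(2,3) by (simp add: T.smult_l_minus T.minus_eq T.minus_add T.a_comm)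
    ultimately show ?thesis by simp
  qed
  from rm_lm show ?thesis
  proof
    assume "ax_lm k H"
    note e = dot_split(1)[OF MN assms(3,4) this]
    show ?thesis unfolding e tens_split(1)[OF MN assms(3,4)]
      by (rule diff) (auto intro!: swap gen)
  next
    assume "ax_rm k H"
    note e = dot_split(2)[OF MN assms(3,4) this]
    show ?thesis unfolding e tens_split(2)[OF MN assms(3,4)]
      by (rule diff) (auto intro!: gen)
  qed
qed

text \<open>
  The generators of the balancing submodule are killed by \<open>\<pi>\<close> because \<open>dot\<close> is balanced. Conversely \<open>t - \<pi>(t)\<close> lies in that
  submodule for every \<open>t\<close>, and it is \<open>t\<close> itself for \<open>t\<close> in the kernel.
\<close>

lemma balancing_kernel:
  "balancing k (und M) (und N) HM (unit_ract k \<C> und U_arr (U_mon k H) M) (unit_lact k \<C> und U_arr (U_mon k H) N)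
    = {t \<in> carrier (und M \<boxtimes> und N). rpi k H M N t = \<zero>\<^bsub>RM M N\<^esub>}" (is "?B = ?K")
proof -
  let ?T = "und M \<boxtimes> und N" and ?t = "tens k (und M) (und N)"
  interpret T: Module.module k ?T by simp
  have kT [simp]: "kmod ?T" by simp
  have l: "rpi k H M N \<in> Lin ?T (RM M N)" by (rule rpi_closed(4)) auto
  note rD = linear_mapsD[OF l]
  let ?G = "{?t (ract M m y) n \<ominus>\<^bsub>?T\<^esub> ?t m (lact N y n) | m y n. m \<in> carrier (und M) \<and> y \<in> carrier HM \<and> n \<in> carrier (und N)}"
  have "?B = span_submodule k ?T ?G"
    unfolding balancing_def using U_actions MN
    by (intro arg_cong[where f = "span_submodule k ?T"] Collect_cong) (metis (no_types, lifting))
  moreover have "span_submodule k ?T ?G \<subseteq> ?K"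
  proof -
    have "submodule ?K k ?T"
    proof (rule T.submoduleI)
      show "\<zero>\<^bsub>?T\<^esub> \<in> ?K" using lin_zero[OF l] by simp
      fix a b c assume a: "a \<in> ?K" and b: "b \<in> ?K"
      show "a \<oplus>\<^bsub>?T\<^esub> b \<in> ?K" using a b rD by auto
      have "\<ominus>\<^bsub>?T\<^esub> a = (\<ominus>\<^bsub>k\<^esub> \<one>\<^bsub>k\<^esub>) \<odot>\<^bsub>?T\<^esub> a" using a by (simp add: T.smult_l_minus)
      then show "\<ominus>\<^bsub>?T\<^esub> a \<in> ?K" using a rD(3)[OF neg_one_closed, of a] by simp
      assume "c \<in> carrier k"
      then show "c \<odot>\<^bsub>?T\<^esub> a \<in> ?K" using a rD by auto
    qed auto
    moreover have "?G \<subseteq> ?K"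
    proof clarify
      fix m y n assume [simp]: "m \<in> carrier (und M)" "y \<in> carrier HM" "n \<in> carrier (und N)"
      have eq: "rpi k H M N (?t (ract M m y) n) = rpi k H M N (?t m (lact N y n))"
        using dot_balanced[of M N m n y] by (simp add: dot_def)
      have "?t (ract M m y) n \<ominus>\<^bsub>?T\<^esub> ?t m (lact N y n) = ?t (ract M m y) n \<oplus>\<^bsub>?T\<^esub> (\<ominus>\<^bsub>k\<^esub> \<one>\<^bsub>k\<^esub>) \<odot>\<^bsub>?T\<^esub> ?t m (lact N y n)"
        by (simp add: T.smult_l_minus T.minus_eq)
      then have "rpi k H M N (?t (ract M m y) n \<ominus>\<^bsub>?T\<^esub> ?t m (lact N y n)) =
        rpi k H M N (?t m (lact N y n)) \<oplus>\<^bsub>RM M N\<^esub> (\<ominus>\<^bsub>k\<^esub> \<one>\<^bsub>k\<^esub>) \<odot>\<^bsub>RM M N\<^esub> rpi k H M N (?t m (lact N y n))"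
        using eq by (simp add: rD)
      then show "?t (ract M m y) n \<ominus>\<^bsub>?T\<^esub> ?t m (lact N y n) \<in> carrier ?T \<and>
          rpi k H M N (?t (ract M m y) n \<ominus>\<^bsub>?T\<^esub> ?t m (lact N y n)) = \<zero>\<^bsub>RM M N\<^esub>"
        using rD(1) add_neg_one[OF kmod_RM[OF MN]] by simp
    qed
    ultimately show ?thesis unfolding span_submodule_def by blast
  qed
  moreover have "?K \<subseteq> Sub" if Sub: "submodule Sub k ?T" and G: "?G \<subseteq> Sub" for Sub
  proof
    fix t assume "t \<in> ?K"
    then have t: "t \<in> carrier ?T" and 0: "rpi k H M N t = \<zero>\<^bsub>?T\<^esub>" by (auto simp: rtensor_ops)
    note lT = rpi_lin[OF MN]
    have gen: "?t m n \<ominus>\<^bsub>?T\<^esub> rpi k H M N (?t m n) \<in> Sub" if "m \<in> carrier (und M)" "n \<in> carrier (und N)" for m n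
      using tens_dot_balanced[OF Sub _ that] G unfolding dot_def by blast
    have "t \<ominus>\<^bsub>?T\<^esub> rpi k H M N t \<in> Sub"
      using comodule_simps(1)[OF MN(1)] comodule_simps(1)[OF MN(2)] t
    proof (induction rule: tensor_induct)
      case zero
      have "\<zero>\<^bsub>?T\<^esub> \<ominus>\<^bsub>?T\<^esub> \<zero>\<^bsub>?T\<^esub> = \<zero>\<^bsub>?T\<^esub>" by (metis T.minus_eq T.r_neg T.zero_closed)
      then show ?case using submodule_closed(1)[OF kT Sub] lin_zero[OF lT] by simp
    next
      case (add m n t)
      have "(?t m n \<oplus>\<^bsub>?T\<^esub> t) \<ominus>\<^bsub>?T\<^esub> rpi k H M N (?t m n \<oplus>\<^bsub>?T\<^esub> t)
        = (?t m n \<ominus>\<^bsub>?T\<^esub> rpi k H M N (?t m n)) \<oplus>\<^bsub>?T\<^esub> (t \<ominus>\<^bsub>?T\<^esub> rpi k H M N t)"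
        using add(1-3) linear_mapsD(1,2)[OF lT] by (simp add: T.minus_eq T.minus_add T.a_ac)
      then show ?case using submodule_closed(2)[OF kT Sub gen[OF add(1,2)] add(4)] by simp
    qed
    moreover have "\<ominus>\<^bsub>?T\<^esub> \<zero>\<^bsub>?T\<^esub> = \<zero>\<^bsub>?T\<^esub>" by (metis T.r_neg T.l_zero T.a_inv_closed T.zero_closed)
    ultimately show "t \<in> Sub" using t 0 by (simp add: T.minus_eq)
  qed
  then have "?K \<subseteq> span_submodule k ?T ?G" unfolding span_submodule_def by blast
  ultimately show ?thesis by blast
qed

text \<open>
  At \<open>t = dot m n\<close> both sides are the image in \<open>M \<otimes> (H\<^sub>s \<otimes> N)\<close> of one element of \<open>(M \<otimes>\<^sup>r H\<^sub>s) \<otimes>\<^sup>r N\<close>, since the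
  constraints are coherent: \<open>dot (dot m 1) n\<close> is sent to \<open>dot m (dot 1 n)\<close>.
\<close>

lemma cotensor_equalizer:
  assumes t: "t \<in> carrier (und M \<boxtimes> und N)"
  shows "t \<in> carrier (RM M N) \<longleftrightarrow>
    tassoc k (und M) HM (und N) (tmap k (und M \<boxtimes> HM) (und N) (\<lambda>m. dot M S m \<eta>) (\<lambda>x. x) t)
    = tmap k (und M) (HM \<boxtimes> und N) (\<lambda>x. x) (\<lambda>n. dot S N \<eta> n) t" (is "_ \<longleftrightarrow> ?A t = ?B t")
proof
  let ?X = "und M" and ?Y = "und N"
  let ?T = "?X \<boxtimes> ?Y" and ?W = "?X \<boxtimes> HM \<boxtimes> ?Y"
  let ?f = "\<lambda>m. dot M S m \<eta>" and ?g = "\<lambda>n. dot S N \<eta> n"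
  have f: "?f \<in> Lin ?X (RM M S)" and g: "?g \<in> Lin ?Y (RM S N)" by (auto intro!: lin)
  have fI: "?f \<in> Lin ?X (?X \<boxtimes> HM)" and gI: "?g \<in> Lin ?Y (HM \<boxtimes> ?Y)" using f g by (auto intro: rpi_closed(6))
  have fC: "?f \<in> CM M (RT M S)" and gC: "?g \<in> CM N (RT S N)"
    by (rule comodule_mapsI; auto intro!: lin sw_dot_one bilin_tens)+
  have [simp]: "dot M S m \<eta> \<in> carrier (?X \<boxtimes> HM)" if "m \<in> carrier ?X" for m using that linear_mapsD(1)[OF fI] by simp
  have [simp]: "dot S N \<eta> n \<in> carrier (HM \<boxtimes> ?Y)" if "n \<in> carrier ?Y" for n using that linear_mapsD(1)[OF gI] by simp
  have lf: "tmap k (?X \<boxtimes> HM) ?Y ?f (\<lambda>x. x) \<in> Lin ?T ((?X \<boxtimes> HM) \<boxtimes> ?Y)" by (intro tmap_lin fI) auto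
  have A: "?A \<in> Lin ?T ?W" by (rule lin_comp[OF tassoc_lin lf]) auto
  have B: "?B \<in> Lin ?T ?W" by (intro tmap_lin gI) auto
  show "?A t = ?B t" if "t \<in> carrier (RM M N)"
  proof (rule rtensor_ext[OF MN _ rpi_closed(5)[OF MN A] rpi_closed(5)[OF MN B] _ that])
    fix m n assume mn [simp]: "m \<in> carrier ?X" "n \<in> carrier ?Y"
    have fac: "tmap k (?X \<boxtimes> HM) ?Y ?f (\<lambda>x. x) t
      = tmap k (?X \<boxtimes> HM) ?Y (\<lambda>x. x) (\<lambda>x. x) (tmap k (RM M S) ?Y ?f (\<lambda>x. x) t)"
      and gac: "?B t = tmap k ?X (HM \<boxtimes> ?Y) (\<lambda>x. x) (\<lambda>x. x) (tmap k ?X (RM S N) (\<lambda>x. x) ?g t)"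
      if "t \<in> carrier ?T" for t
    proof -
      show "tmap k (?X \<boxtimes> HM) ?Y ?f (\<lambda>x. x) t = tmap k (?X \<boxtimes> HM) ?Y (\<lambda>x. x) (\<lambda>x. x) (tmap k (RM M S) ?Y ?f (\<lambda>x. x) t)"
        by (rule tensor_ext[OF _ _ _ lf lin_comp[OF tmap_lin tmap_lin] _ that])
          (auto simp: tmap_tens f fI lin_incl linear_mapsD(1)[OF f])
      show "?B t = tmap k ?X (HM \<boxtimes> ?Y) (\<lambda>x. x) (\<lambda>x. x) (tmap k ?X (RM S N) (\<lambda>x. x) ?g t)"
        by (rule tensor_ext[OF _ _ _ B lin_comp[OF tmap_lin tmap_lin] _ that])
          (auto simp: tmap_tens g gI lin_incl linear_mapsD(1)[OF g])
    qed
    have d: "dot M N m n \<in> carrier ?T" by (intro rpi_closed(3)) auto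
    have "?A (dot M N m n) = tassoc k ?X HM ?Y (tmap k (?X \<boxtimes> HM) ?Y (\<lambda>x. x) (\<lambda>x. x) (dot (RT M S) N (dot M S m \<eta>) n))"
      unfolding fac[OF d] by (subst tmap_dot[OF _ _ _ _ fC comodule_maps_id]) auto
    also have "\<dots> = tmap k ?X (HM \<boxtimes> ?Y) (\<lambda>x. x) (\<lambda>x. x) (rassoc k H M S N (dot (RT M S) N (dot M S m \<eta>) n))"
      by (rule incl_rassoc[symmetric]) auto
    also have "\<dots> = tmap k ?X (HM \<boxtimes> ?Y) (\<lambda>x. x) (\<lambda>x. x) (dot M (RT S N) m (dot S N \<eta> n))"
      by (simp add: rassoc_dot)
    also have "\<dots> = ?B (dot M N m n)"
      unfolding gac[OF d] by (subst tmap_dot[OF _ _ _ _ comodule_maps_id gC]) auto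
    finally show "?A (dot M N m n) = ?B (dot M N m n)" .
  qed auto
  show "t \<in> carrier (RM M N)" if eq: "?A t = ?B t"
  proof -
    \<comment> \<open>Letting \<open>H\<^sub>s\<close> act on one factor is a map \<open>\<Theta>\<close> back to \<open>M \<otimes> N\<close>. One of its composites with the two sides is the
      identity, and by \<open>dot_split\<close> the other one is \<open>\<pi>\<close>. The factor is \<open>M\<close> for (lm) and \<open>N\<close> for (rm).\<close>
    have "rpi k H M N t = t"
      using rm_lm
    proof
      assume lm: "ax_lm k H"
      let ?\<Theta> = "\<lambda>w. tmap k ?X ?Y (runit_r M) (\<lambda>x. x) (tassoc_inv ?X HM ?Y w)"
      have \<Theta>: "?\<Theta> \<in> Lin ?W ?T" by (rule lin_comp[OF tmap_lin tassoc_inv_lin]) (auto intro: runit_tensor_lin)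
      have "?\<Theta> (?A t) = t"
      proof (rule tensor_ext[OF _ _ _ lin_comp[OF \<Theta> A] lin_id _ t])
        fix m n assume "m \<in> carrier ?X" "n \<in> carrier ?Y"
        then show "?\<Theta> (?A (tens k ?X ?Y m n)) = tens k ?X ?Y m n"
          by (simp add: tmap_tens fI tassoc_inverse runit_tensor_lin runit_inverse)
      qed auto
      moreover have "?\<Theta> (?B t) = rpi k H M N t"
      proof (rule tensor_ext[OF _ _ _ lin_comp[OF \<Theta> B] rpi_lin[OF MN] _ t])
        fix m n assume [simp]: "m \<in> carrier ?X" "n \<in> carrier ?Y"
        have G: "(\<lambda>s. ?\<Theta> (tens k ?X (HM \<boxtimes> ?Y) m s)) \<in> Lin (HM \<boxtimes> ?Y) ?T"
          by (rule lin_comp[OF \<Theta>]) (auto intro!: lin)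
        have "?\<Theta> (tens k ?X (HM \<boxtimes> ?Y) m (dot S N \<eta> n)) = ssw ?T (\<lambda>y0 y1. csw N ?T (\<lambda>n0 n1.
            \<epsilon> (y1 ** n1) \<odot>\<^bsub>?T\<^esub> ?\<Theta> (tens k ?X (HM \<boxtimes> ?Y) m (tens k HM ?Y y0 n0))) n) \<eta>"
          by (rule lin_dot_expand[OF _ _ _ G]) auto
        also have "\<dots> = ssw ?T (\<lambda>y0 y1. csw N ?T (\<lambda>n0 n1. \<epsilon> (y1 ** n1) \<odot>\<^bsub>?T\<^esub> tens k ?X ?Y (ract M m y0) n0) n) \<eta>"
          using Hs.R_coaction runit_tensor_lin(2)[OF MN(1)]
          by (intro sw_cong) (auto simp: tassoc_inv_tens tmap_tens runit_act tlift_tens act_bilin)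
        also have "\<dots> = ssw ?T (\<lambda>y h. tens k ?X ?Y (ract M m y) (lact N h n)) \<eta>"
          using Hs.R_coaction by (intro sw_cong act_push(1)[symmetric]) (auto intro!: lin)
        also have "\<dots> = dot M N m n" using lm by (intro dot_split(1)[symmetric]) auto
        finally show "?\<Theta> (?B (tens k ?X ?Y m n)) = rpi k H M N (tens k ?X ?Y m n)"
          by (simp add: tmap_tens gI) (simp add: dot_def)
      qed auto
      ultimately show ?thesis using eq by simp
    next
      assume rm: "ax_rm k H"
      let ?\<Theta> = "\<lambda>w. tmap k ?X ?Y (\<lambda>x. x) (runit_l N) w"
      have \<Theta>: "?\<Theta> \<in> Lin ?W ?T" by (rule tmap_lin) (auto intro: runit_tensor_lin)
      have "?\<Theta> (?B t) = t"
      proof (rule tensor_ext[OF _ _ _ lin_comp[OF \<Theta> B] lin_id _ t])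
        fix m n assume "m \<in> carrier ?X" "n \<in> carrier ?Y"
        then show "?\<Theta> (?B (tens k ?X ?Y m n)) = tens k ?X ?Y m n"
          by (simp add: tmap_tens gI runit_tensor_lin runit_inverse)
      qed auto
      moreover have "?\<Theta> (?A t) = rpi k H M N t"
      proof (rule tensor_ext[OF _ _ _ lin_comp[OF \<Theta> A] rpi_lin[OF MN] _ t])
        fix m n assume [simp]: "m \<in> carrier ?X" "n \<in> carrier ?Y"
        let ?G = "\<lambda>s. ?\<Theta> (tassoc k ?X HM ?Y (tens k (?X \<boxtimes> HM) ?Y s n))"
        have G: "?G \<in> Lin (?X \<boxtimes> HM) ?T"
          by (rule lin_comp[OF \<Theta>]) (auto intro!: lin)
        have "?G (dot M S m \<eta>) = csw M ?T (\<lambda>m0 m1. ssw ?T (\<lambda>y0 y1. \<epsilon> (m1 ** y1) \<odot>\<^bsub>?T\<^esub> ?G (tens k ?X HM m0 y0)) \<eta>) m"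
          by (rule lin_dot_expand[OF _ _ _ G]) auto
        also have "\<dots> = csw M ?T (\<lambda>m0 m1. ssw ?T (\<lambda>y0 y1. \<epsilon> (m1 ** y1) \<odot>\<^bsub>?T\<^esub> tens k ?X ?Y m0 (lact N y0 n)) \<eta>) m"
          using Hs.R_coaction runit_tensor_lin(1)[OF MN(2)]
          by (intro sw_cong) (auto simp: tassoc_tens tmap_tens runit_act tlift_tens act_bilin)
        also have "\<dots> = ssw ?T (\<lambda>y0 y1. csw M ?T (\<lambda>m0 m1. \<epsilon> (m1 ** y1) \<odot>\<^bsub>?T\<^esub> tens k ?X ?Y m0 (lact N y0 n)) m) \<eta>"
          using Hs.R_coaction by (intro sw_swap) auto
        also have "\<dots> = ssw ?T (\<lambda>y h. tens k ?X ?Y (ract M m h) (lact N y n)) \<eta>"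
          using Hs.R_coaction by (intro sw_cong act_push(2)[symmetric]) (auto intro!: lin)
        also have "\<dots> = dot M N m n" using rm by (intro dot_split(2)[symmetric]) auto
        finally show "?\<Theta> (?A (tens k ?X ?Y m n)) = rpi k H M N (tens k ?X ?Y m n)"
          by (simp add: tmap_tens fI) (simp add: dot_def)
      qed auto
      ultimately show ?thesis using eq by simp
    qed
    then show ?thesis using rpi_closed(1)[OF MN t] by simp
  qed
qed

end

theorem ess_strong_monoidal_U:
  assumes "ax_rm k H \<or> ax_lm k H"
  shows "ess_strong_monoidal k \<C> und U_arr (U_mon k H) (U_mon0 k H)"
  unfolding ess_strong_monoidal_def Let_def
proof (intro conjI monoidal_functor_U ballI)
  fix M N assume "M \<in> Ob \<C>" "N \<in> Ob \<C>"
  then have [simp]: "comod M" "comod N" by auto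
  have "\<exists>\<theta>\<in>linear_isos k (quot_module (und M \<boxtimes> und N) (balancing k (und M) (und N) HM
      (unit_ract k \<C> und U_arr (U_mon k H) M) (unit_lact k \<C> und U_arr (U_mon k H) N))) (RM M N).
     \<forall>t\<in>carrier (und M \<boxtimes> und N). \<theta> (balancing k (und M) (und N) HM
      (unit_ract k \<C> und U_arr (U_mon k H) M) (unit_lact k \<C> und U_arr (U_mon k H) N) +>\<^bsub>und M \<boxtimes> und N\<^esub> t) = rpi k H M N t"
    by (rule first_isomorphism) (auto simp: rpi_closed(4) carrier_rtensor balancing_kernel[OF _ _ assms])
  then show "\<exists>\<theta>\<in>linear_isos k (tensor_over k (und M) (und N) (und (UnitO \<C>))
      (unit_ract k \<C> und U_arr (U_mon k H) M) (unit_lact k \<C> und U_arr (U_mon k H) N)) (und (M \<diamondop>\<^bsub>\<C>\<^esub> N)).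
     \<forall>t\<in>carrier (und M \<boxtimes> und N). \<theta> (balancing k (und M) (und N) (und (UnitO \<C>))
      (unit_ract k \<C> und U_arr (U_mon k H) M) (unit_lact k \<C> und U_arr (U_mon k H) N) +>\<^bsub>und M \<boxtimes> und N\<^esub> t) = fn (U_mon k H M N) t"
    by (simp add: tensor_over_def)
qed

theorem ess_strong_opmonoidal_U:
  assumes "ax_rm k H \<or> ax_lm k H"
  shows "ess_strong_opmonoidal k \<C> und U_arr (U_opmon k H) (U_opmon0 k H)"
  unfolding ess_strong_opmonoidal_def
proof (intro conjI opmonoidal_functor_U ballI)
  fix M N assume "M \<in> Ob \<C>" "N \<in> Ob \<C>"
  then have [simp]: "comod M" "comod N" by auto
  let ?U = "und :: 'u comod \<Rightarrow> ('u, 'u) module"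
  let ?C = "cotensor k (und M) (und N) HM (unit_rcoact \<C> ?U U_arr (U_opmon k H) M) (unit_lcoact \<C> ?U U_arr (U_opmon k H) N)"
  have "carrier ?C = {t \<in> carrier (und M \<boxtimes> und N).
      tassoc k (und M) HM (und N) (tmap k (und M \<boxtimes> HM) (und N) (\<lambda>m. dot M S m \<eta>) (\<lambda>x. x) t)
      = tmap k (und M) (HM \<boxtimes> und N) (\<lambda>x. x) (\<lambda>n. dot S N \<eta> n) t}"
  proof -
    have "tmap k (und M \<boxtimes> HM) (und N) (unit_rcoact \<C> ?U U_arr (U_opmon k H) M) id t
        = tmap k (und M \<boxtimes> HM) (und N) (\<lambda>m. dot M S m \<eta>) (\<lambda>x. x) t"
      "tmap k (und M) (HM \<boxtimes> und N) id (unit_lcoact \<C> ?U U_arr (U_opmon k H) N) t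
        = tmap k (und M) (HM \<boxtimes> und N) (\<lambda>x. x) (\<lambda>n. dot S N \<eta> n) t" if "t \<in> carrier (und M \<boxtimes> und N)" for t
      by (rule tmap_cong[OF _ _ _ _ that]; simp add: U_coactions)+
    then show ?thesis by (auto simp: cotensor_def)
  qed
  also have "\<dots> = carrier (RM M N)"
    using cotensor_equalizer[OF _ _ assms, of M N] rpi_closed(3)[of M N] by auto
  finally have C: "carrier ?C = carrier (RM M N)" .
  have "restrict (\<lambda>x. x) (carrier (RM M N)) \<in> linear_maps k (RM M N) ?C"
    using kmod_RM[of M N] C
    by (intro linear_mapsI) (auto simp: cotensor_def simp flip: rtensor_ops)
  moreover have "bij_betw (restrict (\<lambda>x. x) (carrier (RM M N))) (carrier (RM M N)) (carrier ?C)"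
    unfolding C by (auto simp: bij_betw_def inj_on_def)
  ultimately show "fn (U_opmon k H M N) \<in> linear_isos k (und (M \<diamondop>\<^bsub>\<C>\<^esub> N))
      (cotensor k (und M) (und N) (und (UnitO \<C>)) (unit_rcoact \<C> ?U U_arr (U_opmon k H) M)
        (unit_lcoact \<C> ?U U_arr (U_opmon k H) N))"
    by (simp add: linear_isos_def)
qed

end

theorem theorem3p2:
  fixes k :: "'u::infinite ring" and H :: "'u prebialg"
  assumes "cring k" and "comonoidal_prebialgebra k H"
  shows "monoidal_functor (comod_cat k H) (mod_cat k) und U_arr (U_mon k H) (U_mon0 k H) \<and>
    opmonoidal_functor (comod_cat k H) (mod_cat k) und U_arr (U_opmon k H) (U_opmon0 k H) \<and>
    (ax_rm k H \<or> ax_lm k H \<longrightarrow>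
      ess_strong_monoidal k (comod_cat k H) und U_arr (U_mon k H) (U_mon0 k H) \<and>
      ess_strong_opmonoidal k (comod_cat k H) und U_arr (U_opmon k H) (U_opmon0 k H))"
proof -
  interpret comonoidal k H
    using assms by (intro comonoidal.intro prebialg.intro base.intro comonoidal_axioms.intro)
      (auto simp: comonoidal_prebialgebra_def)
  show ?thesis
    using monoidal_functor_U opmonoidal_functor_U ess_strong_monoidal_U ess_strong_opmonoidal_U by blast
qed

end
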